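(* Let $R$ be a coherent ring and let $P$ be an exact chain complex of projective $R$-modules. Then $\operatorname{Ext}^1_R(Z_nP,A)=0$ for every integer $n$ and every absolutely pure $R$-module $A$. Consequently, every cycle module $Z_nP$ is a retract (direct summand) of a transfinite extension of finitely presented modules.
   Context: "Coherent" means left and right coherent; modules are left $R$-modules. $Z_nP=\ker(P_n\to P_{n-1})$. A module $A$ is absolutely pure (= FP-injective) if $\operatorname{Ext}^1_R(N,A)=0$ for every finitely presented module $N$. A module $M$ is a transfinite extension of modules in a class $\mathcal{S}$ if there are an ordinal $\lambda$ and an increasing chain of submodules $(M_\alpha)_{\alpha<\lambda}$ of $M$, continuous (i.e. $M_\gamma=\bigcup_{\alpha<\gamma}M_\alpha$ for limit ordinals $\gamma<\lambda$), with $M=\bigcup_{\alpha<\lambda}M_\alpha$ and with $M_0$ and each $M_{\alpha+1}/M_\alpha$ (for $\alpha+1<\lambda$) isomorphic to a member of $\mathcal{S}$. *)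

theory Defs
  imports "HOL-Algebra.Module" "HOL-Algebra.AbelCoset" "HOL-Algebra.Elementary_Groups"
begin

section \<open>Left modules over a ring with unit, not necessarily commutative\<close>

text \<open>The locale \<^locale>\<open>module\<close> of the library requires a commutative ring. The following has the
  same axioms over an arbitrary ring with unit. The predicate \<^term>\<open>submodule\<close> of the library
  makes no commutativity assumption and is used as it is. The fields \<^const>\<open>mult\<close> and \<^const>\<open>one\<close>
  of the record of a module carry no meaning.\<close>

locale left_module = R?: ring R + M?: abelian_group M for R (structure) and M (structure) +
  assumes smult_closed [simp, intro]:
      "\<lbrakk>a \<in> carrier R; x \<in> carrier M\<rbrakk> \<Longrightarrow> a \<odot>\<^bsub>M\<^esub> x \<in> carrier M"
    and smult_l_distr:
      "\<lbrakk>a \<in> carrier R; b \<in> carrier R; x \<in> carrier M\<rbrakk> \<Longrightarrow>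
        (a \<oplus> b) \<odot>\<^bsub>M\<^esub> x = a \<odot>\<^bsub>M\<^esub> x \<oplus>\<^bsub>M\<^esub> b \<odot>\<^bsub>M\<^esub> x"
    and smult_r_distr:
      "\<lbrakk>a \<in> carrier R; x \<in> carrier M; y \<in> carrier M\<rbrakk> \<Longrightarrow>
        a \<odot>\<^bsub>M\<^esub> (x \<oplus>\<^bsub>M\<^esub> y) = a \<odot>\<^bsub>M\<^esub> x \<oplus>\<^bsub>M\<^esub> a \<odot>\<^bsub>M\<^esub> y"
    and smult_assoc:
      "\<lbrakk>a \<in> carrier R; b \<in> carrier R; x \<in> carrier M\<rbrakk> \<Longrightarrow>
        (a \<otimes> b) \<odot>\<^bsub>M\<^esub> x = a \<odot>\<^bsub>M\<^esub> (b \<odot>\<^bsub>M\<^esub> x)"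
    and smult_one [simp]:
      "x \<in> carrier M \<Longrightarrow> \<one> \<odot>\<^bsub>M\<^esub> x = x"

definition mod_hom :: "('r, 'x) ring_scheme \<Rightarrow> ('r, 'm) module \<Rightarrow> ('r, 'n) module \<Rightarrow> ('m \<Rightarrow> 'n) set" where
  "mod_hom R M N = {f \<in> carrier M \<rightarrow> carrier N.
     (\<forall>x\<in>carrier M. \<forall>y\<in>carrier M. f (x \<oplus>\<^bsub>M\<^esub> y) = f x \<oplus>\<^bsub>N\<^esub> f y) \<and>
     (\<forall>a\<in>carrier R. \<forall>x\<in>carrier M. f (a \<odot>\<^bsub>M\<^esub> x) = a \<odot>\<^bsub>N\<^esub> f x)}"

definition mod_iso :: "('r, 'x) ring_scheme \<Rightarrow> ('r, 'm) module \<Rightarrow> ('r, 'n) module \<Rightarrow> bool" where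
  "mod_iso R M N \<longleftrightarrow> (\<exists>f \<in> mod_hom R M N. bij_betw f (carrier M) (carrier N))"

definition retract :: "('r, 'x) ring_scheme \<Rightarrow> ('r, 'm) module \<Rightarrow> ('r, 'n) module \<Rightarrow> bool" where
  "retract R M N \<longleftrightarrow>
     (\<exists>i \<in> mod_hom R M N. \<exists>p \<in> mod_hom R N M. \<forall>x\<in>carrier M. p (i x) = x)"

definition quot_module :: "('r, 'm) module \<Rightarrow> 'm set \<Rightarrow> ('r, 'm set) module" where
  "quot_module M H =
     \<lparr>carrier = a_rcosets\<^bsub>M\<^esub> H, mult = (\<lambda>_ _. undefined), one = undefined,
      zero = H, add = set_add M,
      smult = (\<lambda>a X. \<Union>x\<in>X. H +>\<^bsub>M\<^esub> (a \<odot>\<^bsub>M\<^esub> x))\<rparr>"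

text \<open>The free module on \<open>X\<close>: finitely supported families of scalars, extended by zero outside \<open>X\<close>.\<close>

definition free_module :: "('r, 'x) ring_scheme \<Rightarrow> 'i set \<Rightarrow> ('r, 'i \<Rightarrow> 'r) module" where
  "free_module R X =
     \<lparr>carrier = {c. (\<forall>i. c i \<in> carrier R) \<and> (\<forall>i. i \<notin> X \<longrightarrow> c i = \<zero>\<^bsub>R\<^esub>) \<and> finite {i. c i \<noteq> \<zero>\<^bsub>R\<^esub>}},
      mult = (\<lambda>_ _. undefined), one = undefined,
      zero = (\<lambda>_. \<zero>\<^bsub>R\<^esub>), add = (\<lambda>c e i. c i \<oplus>\<^bsub>R\<^esub> e i),
      smult = (\<lambda>a c i. a \<otimes>\<^bsub>R\<^esub> c i)\<rparr>"


section \<open>Finiteness conditions and coherent rings\<close>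

definition finitely_generated :: "('r, 'x) ring_scheme \<Rightarrow> ('r, 'm) module \<Rightarrow> bool" where
  "finitely_generated R M \<longleftrightarrow> left_module R M \<and>
     (\<exists>n::nat. \<exists>\<psi> \<in> mod_hom R (free_module R {..<n}) M.
        \<psi> ` carrier (free_module R {..<n}) = carrier M)"

text \<open>There is an exact sequence \<open>R\<^sup>m \<rightarrow> R\<^sup>n \<rightarrow> M \<rightarrow> 0\<close>.\<close>

definition finitely_presented :: "('r, 'x) ring_scheme \<Rightarrow> ('r, 'm) module \<Rightarrow> bool" where
  "finitely_presented R M \<longleftrightarrow> left_module R M \<and>
     (\<exists>(m::nat) (n::nat).
        \<exists>\<phi> \<in> mod_hom R (free_module R {..<m}) (free_module R {..<n}).
        \<exists>\<psi> \<in> mod_hom R (free_module R {..<n}) M.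
          \<phi> ` carrier (free_module R {..<m}) = a_kernel (free_module R {..<n}) M \<psi> \<and>
          \<psi> ` carrier (free_module R {..<n}) = carrier M)"

definition regular_module :: "('r, 'x) ring_scheme \<Rightarrow> ('r, 'r) module" where
  "regular_module R =
     \<lparr>carrier = carrier R, mult = mult R, one = one R, zero = zero R, add = add R, smult = mult R\<rparr>"

definition opposite_ring :: "('r, 'x) ring_scheme \<Rightarrow> ('r, 'x) ring_scheme" where
  "opposite_ring R = R\<lparr>mult := (\<lambda>a b. b \<otimes>\<^bsub>R\<^esub> a)\<rparr>"

definition left_coherent :: "('r, 'x) ring_scheme \<Rightarrow> bool" where
  "left_coherent R \<longleftrightarrow> ring R \<and>
     (\<forall>I. submodule I R (regular_module R) \<longrightarrow>
        finitely_generated R ((regular_module R)\<lparr>carrier := I\<rparr>) \<longrightarrow>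
        finitely_presented R ((regular_module R)\<lparr>carrier := I\<rparr>))"

definition coherent :: "('r, 'x) ring_scheme \<Rightarrow> bool" where
  "coherent R \<longleftrightarrow> left_coherent R \<and> left_coherent (opposite_ring R)"


section \<open>The group \<open>Ext\<^sup>1\<close>\<close>

text \<open>The canonical free resolution of \<open>M\<close>: \<open>P\<^sub>0\<close> is free on the underlying set of \<open>M\<close>, and
  \<open>P\<^sub>i\<^sub>+\<^sub>1\<close> is free on the underlying set of the kernel of the map out of \<open>P\<^sub>i\<close>.\<close>

definition free_cover :: "('r, 'x) ring_scheme \<Rightarrow> ('r, 'm) module \<Rightarrow> ('r, 'm \<Rightarrow> 'r) module" where
  "free_cover R M = free_module R (carrier M)"

definition cover_map :: "('r, 'x) ring_scheme \<Rightarrow> ('r, 'm) module \<Rightarrow> ('m \<Rightarrow> 'r) \<Rightarrow> 'm" where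
  "cover_map R M c = (\<Oplus>\<^bsub>M\<^esub>x\<in>{x. c x \<noteq> \<zero>\<^bsub>R\<^esub>}. c x \<odot>\<^bsub>M\<^esub> x)"

definition syzygy :: "('r, 'x) ring_scheme \<Rightarrow> ('r, 'm) module \<Rightarrow> ('r, 'm \<Rightarrow> 'r) module" where
  "syzygy R M =
     (free_cover R M)\<lparr>carrier := a_kernel (free_cover R M) M (cover_map R M)\<rparr>"

text \<open>Homomorphisms are taken extensional, so that equal homomorphisms are equal functions.\<close>

definition Hom :: "('r, 'x) ring_scheme \<Rightarrow> ('r, 'm) module \<Rightarrow> ('r, 'n) module \<Rightarrow> ('m \<Rightarrow> 'n) monoid" where
  "Hom R M N =
     \<lparr>carrier = mod_hom R M N \<inter> extensional (carrier M),
      mult = (\<lambda>f g. \<lambda>x\<in>carrier M. f x \<oplus>\<^bsub>N\<^esub> g x),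
      one = (\<lambda>x\<in>carrier M. \<zero>\<^bsub>N\<^esub>)\<rparr>"

text \<open>First cohomology of \<open>Hom(P\<^sub>0, A) \<rightarrow> Hom(P\<^sub>1, A) \<rightarrow> Hom(P\<^sub>2, A)\<close> for the canonical
  free resolution \<open>P\<close> of \<open>M\<close>.\<close>

definition Ext1 ::
    "('r, 'x) ring_scheme \<Rightarrow> ('r, 'm) module \<Rightarrow> ('r, 'a) module \<Rightarrow> ((('m \<Rightarrow> 'r) \<Rightarrow> 'r) \<Rightarrow> 'a) set monoid" where
  "Ext1 R M A =
     (let K0 = syzygy R M;
          K1 = syzygy R K0;
          P0 = free_cover R M;
          P1 = free_cover R K0;
          P2 = free_cover R K1;
          d1 = cover_map R K0;
          d2 = cover_map R K1;
          cocycles = kernel (Hom R P1 A) (Hom R P2 A) (\<lambda>f. compose (carrier P2) f d2);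
          coboundaries = (\<lambda>f. compose (carrier P1) f d1) ` carrier (Hom R P0 A)
      in (Hom R P1 A)\<lparr>carrier := cocycles\<rparr> Mod coboundaries)"


section \<open>Absolutely pure modules and projective modules\<close>

text \<open>Every finitely presented module is a quotient of some \<open>R\<^sup>n\<close>, so up to isomorphism it lives on
  the following type of cosets of finitely supported sequences, see
  \<open>finitely_presented_representative\<close> below. Quantification over all
  finitely presented modules is quantification over those on this type.\<close>

type_synonym 'r coset_seq = "(nat \<Rightarrow> 'r) set"

definition absolutely_pure :: "('r, 'x) ring_scheme \<Rightarrow> ('r, 'a) module \<Rightarrow> bool" where
  "absolutely_pure R A \<longleftrightarrow> left_module R A \<and>
     (\<forall>N :: ('r, 'r coset_seq) module. finitely_presented R N \<longrightarrow> trivial_group (Ext1 R N A))"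

text \<open>The lifting property against surjections \<open>N \<rightarrow> N'\<close>. The types of \<open>N\<close> and \<open>N'\<close> are chosen such
  that the free module on the underlying set of \<open>P\<close> fits, so the lifting property follows for
  modules on arbitrary types, see \<open>projective_lift\<close> below.\<close>

definition projective :: "('r, 'x) ring_scheme \<Rightarrow> ('r, 'm) module \<Rightarrow> bool" where
  "projective R P \<longleftrightarrow> left_module R P \<and>
     (\<forall>(N :: ('r, 'm \<Rightarrow> 'r) module) (N' :: ('r, 'm) module).
        left_module R N \<longrightarrow> left_module R N' \<longrightarrow>
        (\<forall>g \<in> mod_hom R N N'. g ` carrier N = carrier N' \<longrightarrow>
          (\<forall>f \<in> mod_hom R P N'. \<exists>h \<in> mod_hom R P N. \<forall>x\<in>carrier P. g (h x) = f x)))"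


section \<open>Exact complexes\<close>

definition exact_complex ::
    "('r, 'x) ring_scheme \<Rightarrow> (int \<Rightarrow> ('r, 'm) module) \<Rightarrow> (int \<Rightarrow> 'm \<Rightarrow> 'm) \<Rightarrow> bool" where
  "exact_complex R P d \<longleftrightarrow>
     (\<forall>n. left_module R (P n)) \<and>
     (\<forall>n. d n \<in> mod_hom R (P n) (P (n - 1))) \<and>
     (\<forall>n. d (n + 1) ` carrier (P (n + 1)) = a_kernel (P n) (P (n - 1)) (d n))"

definition cycle_module :: "(int \<Rightarrow> ('r, 'm) module) \<Rightarrow> (int \<Rightarrow> 'm \<Rightarrow> 'm) \<Rightarrow> int \<Rightarrow> ('r, 'm) module" where
  "cycle_module P d n = (P n)\<lparr>carrier := a_kernel (P n) (P (n - 1)) (d n)\<rparr>"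


section \<open>Transfinite extensions\<close>

text \<open>An ordinal is represented by a well-order \<open>r\<close>, its elements by the field of \<open>r\<close>.\<close>

definition is_succ :: "'i rel \<Rightarrow> 'i \<Rightarrow> 'i \<Rightarrow> bool" where
  "is_succ r \<alpha> \<beta> \<longleftrightarrow> \<beta> \<in> aboveS r \<alpha> \<and> (\<forall>\<gamma> \<in> aboveS r \<alpha>. (\<beta>, \<gamma>) \<in> r)"

definition is_zero :: "'i rel \<Rightarrow> 'i \<Rightarrow> bool" where
  "is_zero r \<alpha> \<longleftrightarrow> \<alpha> \<in> Field r \<and> underS r \<alpha> = {}"

definition is_limit :: "'i rel \<Rightarrow> 'i \<Rightarrow> bool" where
  "is_limit r \<gamma> \<longleftrightarrow> \<gamma> \<in> Field r \<and> \<not> is_zero r \<gamma> \<and> \<not> (\<exists>\<alpha>. is_succ r \<alpha> \<gamma>)"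

text \<open>The well-order lives on the type of the elements of \<open>M\<close>. This is no restriction: in a chain
  without repetitions, \<open>C (\<alpha> + 1) - C \<alpha>\<close> is nonempty for all \<open>\<alpha>\<close> with \<open>\<alpha> + 1 < \<lambda>\<close>, and these sets are
  disjoint and do not contain zero, so there are at most as many indices as elements of \<open>M\<close>; and
  omitting repetitions preserves all conditions.\<close>

definition transfinite_extension ::
    "('r, 'x) ring_scheme \<Rightarrow> (('r, 's) module \<Rightarrow> bool) \<Rightarrow> ('r, 'm) module \<Rightarrow> bool" where
  "transfinite_extension R S M \<longleftrightarrow> left_module R M \<and>
     (\<exists>(r :: 'm rel) (C :: 'm \<Rightarrow> 'm set). Well_order r \<and>
        (\<forall>\<alpha>\<in>Field r. submodule (C \<alpha>) R M) \<and>
        (\<forall>\<alpha> \<beta>. (\<alpha>, \<beta>) \<in> r \<longrightarrow> C \<alpha> \<subseteq> C \<beta>) \<and>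
        (\<forall>\<gamma>. is_limit r \<gamma> \<longrightarrow> C \<gamma> = (\<Union>\<alpha>\<in>underS r \<gamma>. C \<alpha>)) \<and>
        carrier M = (\<Union>\<alpha>\<in>Field r. C \<alpha>) \<and>
        (\<forall>\<alpha>. is_zero r \<alpha> \<longrightarrow> (\<exists>N. S N \<and> mod_iso R (M\<lparr>carrier := C \<alpha>\<rparr>) N)) \<and>
        (\<forall>\<alpha> \<beta>. is_succ r \<alpha> \<beta> \<longrightarrow>
           (\<exists>N. S N \<and> mod_iso R (quot_module (M\<lparr>carrier := C \<beta>\<rparr>) (C \<alpha>)) N)))"

text \<open>The type of cosets in the free module on words over \<open>'m + 'r + nat\<close>: every module over a ring
  on \<open>'r\<close> that has a generating set of cardinality at most \<open>|'m| + |'r| + \<aleph>\<^sub>0\<close> has an isomorphic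
  copy on this type. It serves to state the existence of a module whose size is not bounded
  by that of \<open>'m\<close>.\<close>

type_synonym ('m, 'r) large = "(('m + 'r + nat) list \<Rightarrow> 'r) set"


section \<open>Adequacy of the types in the definitions of projective and absolutely pure modules\<close>

lemma mod_homI:
  assumes "\<And>x. x \<in> carrier M \<Longrightarrow> f x \<in> carrier N"
    and "\<And>x y. \<lbrakk>x \<in> carrier M; y \<in> carrier M\<rbrakk> \<Longrightarrow> f (x \<oplus>\<^bsub>M\<^esub> y) = f x \<oplus>\<^bsub>N\<^esub> f y"
    and "\<And>a x. \<lbrakk>a \<in> carrier R; x \<in> carrier M\<rbrakk> \<Longrightarrow> f (a \<odot>\<^bsub>M\<^esub> x) = a \<odot>\<^bsub>N\<^esub> f x"
  shows "f \<in> mod_hom R M N"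
  using assms by (auto simp: mod_hom_def)

lemma mod_homD:
  assumes "f \<in> mod_hom R M N"
  shows "x \<in> carrier M \<Longrightarrow> f x \<in> carrier N"
    and "\<lbrakk>x \<in> carrier M; y \<in> carrier M\<rbrakk> \<Longrightarrow> f (x \<oplus>\<^bsub>M\<^esub> y) = f x \<oplus>\<^bsub>N\<^esub> f y"
    and "\<lbrakk>a \<in> carrier R; x \<in> carrier M\<rbrakk> \<Longrightarrow> f (a \<odot>\<^bsub>M\<^esub> x) = a \<odot>\<^bsub>N\<^esub> f x"
  using assms by (auto simp: mod_hom_def)

lemma mod_hom_compose:
  assumes "f \<in> mod_hom R M N" "g \<in> mod_hom R N L"
  shows "(\<lambda>x. g (f x)) \<in> mod_hom R M L"
  using assms by (auto simp: mod_hom_def Pi_iff)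

lemma mod_hom_zero:
  assumes "left_module R M" "left_module R N" "f \<in> mod_hom R M N"
  shows "f \<zero>\<^bsub>M\<^esub> = \<zero>\<^bsub>N\<^esub>"
proof -
  interpret M: left_module R M by fact
  interpret N: left_module R N by fact
  have "f \<zero>\<^bsub>M\<^esub> \<oplus>\<^bsub>N\<^esub> f \<zero>\<^bsub>M\<^esub> = f \<zero>\<^bsub>M\<^esub>"
    using mod_homD(2)[OF assms(3), of "\<zero>\<^bsub>M\<^esub>" "\<zero>\<^bsub>M\<^esub>"] by simp
  then show ?thesis
    using mod_homD(1)[OF assms(3), of "\<zero>\<^bsub>M\<^esub>"] by (simp add: N.add.l_cancel_one')
qed

context left_module
begin

lemma smult_l_null [simp]: "x \<in> carrier M \<Longrightarrow> \<zero> \<odot>\<^bsub>M\<^esub> x = \<zero>\<^bsub>M\<^esub>"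
  using smult_l_distr[of \<zero> \<zero> x] by simp

lemma smult_r_null [simp]: "a \<in> carrier R \<Longrightarrow> a \<odot>\<^bsub>M\<^esub> \<zero>\<^bsub>M\<^esub> = \<zero>\<^bsub>M\<^esub>"
  using smult_r_distr[of a "\<zero>\<^bsub>M\<^esub>" "\<zero>\<^bsub>M\<^esub>"] by simp

end

lemma left_module_free_module:
  assumes "ring R"
  shows "left_module R (free_module R X)"
proof -
  interpret R: ring R by fact
  show ?thesis
  proof (intro left_module.intro left_module_axioms.intro assms abelian_groupI)
    fix x y assume x: "x \<in> carrier (free_module R X)" and y: "y \<in> carrier (free_module R X)"
    have "{i. x i \<oplus>\<^bsub>R\<^esub> y i \<noteq> \<zero>\<^bsub>R\<^esub>} \<subseteq> {i. x i \<noteq> \<zero>\<^bsub>R\<^esub>} \<union> {i. y i \<noteq> \<zero>\<^bsub>R\<^esub>}" by auto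
    then show "x \<oplus>\<^bsub>free_module R X\<^esub> y \<in> carrier (free_module R X)"
      using x y by (auto simp: free_module_def intro: finite_subset)
  next
    fix x assume x: "x \<in> carrier (free_module R X)"
    have "(\<lambda>i. \<ominus>\<^bsub>R\<^esub> x i) \<in> carrier (free_module R X)"
      using x by (auto simp: free_module_def elim: rev_finite_subset)
    moreover have "(\<lambda>i. \<ominus>\<^bsub>R\<^esub> x i) \<oplus>\<^bsub>free_module R X\<^esub> x = \<zero>\<^bsub>free_module R X\<^esub>"
      using x by (auto simp: free_module_def R.l_neg)
    ultimately show "\<exists>y\<in>carrier (free_module R X). y \<oplus>\<^bsub>free_module R X\<^esub> x = \<zero>\<^bsub>free_module R X\<^esub>"
      by blast
  next
    fix a x assume "a \<in> carrier R" "x \<in> carrier (free_module R X)"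
    then show "a \<odot>\<^bsub>free_module R X\<^esub> x \<in> carrier (free_module R X)"
      by (auto simp: free_module_def elim: rev_finite_subset)
  qed (auto simp: free_module_def R.a_ac R.l_distr R.r_distr R.m_assoc)
qed

definition lin_comb ::
    "('r, 'x) ring_scheme \<Rightarrow> ('r, 'm) module \<Rightarrow> ('i \<Rightarrow> 'm) \<Rightarrow> ('i \<Rightarrow> 'r) \<Rightarrow> 'm" where
  "lin_comb R N t c = (\<Oplus>\<^bsub>N\<^esub>x\<in>{x. c x \<noteq> \<zero>\<^bsub>R\<^esub>}. c x \<odot>\<^bsub>N\<^esub> t x)"

lemma free_moduleD:
  assumes "c \<in> carrier (free_module R X)"
  shows "c i \<in> carrier R" "{i. c i \<noteq> \<zero>\<^bsub>R\<^esub>} \<subseteq> X" "finite {i. c i \<noteq> \<zero>\<^bsub>R\<^esub>}" 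
  using assms by (auto simp: free_module_def)

lemma lin_comb_superset:
  assumes "left_module R N" "t \<in> X \<rightarrow> carrier N" "c \<in> carrier (free_module R X)"
    and "finite Y" "{i. c i \<noteq> \<zero>\<^bsub>R\<^esub>} \<subseteq> Y" "Y \<subseteq> X"
  shows "lin_comb R N t c = (\<Oplus>\<^bsub>N\<^esub>x\<in>Y. c x \<odot>\<^bsub>N\<^esub> t x)"
proof -
  interpret N: left_module R N by fact
  show ?thesis unfolding lin_comb_def
    using assms(2-) free_moduleD[OF assms(3)]
    by (intro N.M.add.finprod_mono_neutral_cong_left) (auto simp: Pi_iff)
qed

lemma mod_hom_finsum:
  assumes "left_module R M" "left_module R N" "f \<in> mod_hom R M N"
    and "finite Y" "u \<in> Y \<rightarrow> carrier M"
  shows "f (\<Oplus>\<^bsub>M\<^esub>x\<in>Y. u x) = (\<Oplus>\<^bsub>N\<^esub>x\<in>Y. f (u x))"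
proof -
  interpret M: left_module R M by fact
  interpret N: left_module R N by fact
  show ?thesis using assms(4,5)
    by (induction Y rule: finite_induct)
      (auto simp: mod_homD[OF assms(3)] mod_hom_zero[OF assms(1-3)] Pi_iff)
qed

lemma smult_finsum:
  assumes "left_module R M" "a \<in> carrier R" "finite Y" "u \<in> Y \<rightarrow> carrier M"
  shows "a \<odot>\<^bsub>M\<^esub> (\<Oplus>\<^bsub>M\<^esub>x\<in>Y. u x) = (\<Oplus>\<^bsub>M\<^esub>x\<in>Y. a \<odot>\<^bsub>M\<^esub> u x)"
proof -
  interpret M: left_module R M by fact
  show ?thesis using assms(3,4)
    by (induction Y rule: finite_induct) (auto simp: assms(2) M.smult_r_distr Pi_iff)
qed

lemma lin_comb_hom:
  assumes "left_module R N" "t \<in> X \<rightarrow> carrier N"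
  shows "lin_comb R N t \<in> mod_hom R (free_module R X) N"
proof (rule mod_homI)
  interpret N: left_module R N by fact
  interpret F: left_module R "free_module R X"
    by (rule left_module_free_module) (rule N.R.ring_axioms)
  note t = assms(2)[unfolded Pi_iff, rule_format]
  { fix x assume "x \<in> carrier (free_module R X)"
    then show "lin_comb R N t x \<in> carrier N"
      using free_moduleD[of x R X] t by (auto simp: lin_comb_def intro!: N.M.finsum_closed) }
  { fix x y assume x: "x \<in> carrier (free_module R X)" and y: "y \<in> carrier (free_module R X)"
    let ?Y = "{i. x i \<noteq> \<zero>\<^bsub>R\<^esub>} \<union> {i. y i \<noteq> \<zero>\<^bsub>R\<^esub>}"
    have Y: "finite ?Y" "?Y \<subseteq> X" using free_moduleD[OF x] free_moduleD[OF y] by auto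
    have xy: "x \<oplus>\<^bsub>free_module R X\<^esub> y = (\<lambda>i. x i \<oplus>\<^bsub>R\<^esub> y i)" by (simp add: free_module_def)
    have supp: "{i. (x \<oplus>\<^bsub>free_module R X\<^esub> y) i \<noteq> \<zero>\<^bsub>R\<^esub>} \<subseteq> ?Y" unfolding xy by auto
    have "lin_comb R N t (x \<oplus>\<^bsub>free_module R X\<^esub> y) = (\<Oplus>\<^bsub>N\<^esub>i\<in>?Y. (x i \<oplus>\<^bsub>R\<^esub> y i) \<odot>\<^bsub>N\<^esub> t i)"
      using lin_comb_superset[OF assms F.a_closed[OF x y] Y(1) supp Y(2)] unfolding xy .
    also have "\<dots> = (\<Oplus>\<^bsub>N\<^esub>i\<in>?Y. x i \<odot>\<^bsub>N\<^esub> t i \<oplus>\<^bsub>N\<^esub> y i \<odot>\<^bsub>N\<^esub> t i)"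
      using Y(2) t free_moduleD(1)[OF x] free_moduleD(1)[OF y]
      by (intro N.M.finsum_cong') (auto simp: N.smult_l_distr)
    also have "\<dots> = (\<Oplus>\<^bsub>N\<^esub>i\<in>?Y. x i \<odot>\<^bsub>N\<^esub> t i) \<oplus>\<^bsub>N\<^esub> (\<Oplus>\<^bsub>N\<^esub>i\<in>?Y. y i \<odot>\<^bsub>N\<^esub> t i)"
      using Y(2) t free_moduleD(1)[OF x] free_moduleD(1)[OF y]
      by (intro N.M.finsum_addf) auto
    also have "\<dots> = lin_comb R N t x \<oplus>\<^bsub>N\<^esub> lin_comb R N t y"
      using lin_comb_superset[OF assms x Y(1) _ Y(2)] lin_comb_superset[OF assms y Y(1) _ Y(2)]
      by auto
    finally show "lin_comb R N t (x \<oplus>\<^bsub>free_module R X\<^esub> y) = lin_comb R N t x \<oplus>\<^bsub>N\<^esub> lin_comb R N t y" . }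
  { fix a x assume a: "a \<in> carrier R" and x: "x \<in> carrier (free_module R X)"
    let ?Y = "{i. x i \<noteq> \<zero>\<^bsub>R\<^esub>}"
    have Y: "finite ?Y" "?Y \<subseteq> X" using free_moduleD[OF x] by auto
    have ax: "a \<odot>\<^bsub>free_module R X\<^esub> x = (\<lambda>i. a \<otimes>\<^bsub>R\<^esub> x i)" by (simp add: free_module_def)
    have supp: "{i. (a \<odot>\<^bsub>free_module R X\<^esub> x) i \<noteq> \<zero>\<^bsub>R\<^esub>} \<subseteq> ?Y" unfolding ax using a by auto
    have "lin_comb R N t (a \<odot>\<^bsub>free_module R X\<^esub> x) = (\<Oplus>\<^bsub>N\<^esub>i\<in>?Y. (a \<otimes>\<^bsub>R\<^esub> x i) \<odot>\<^bsub>N\<^esub> t i)"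
      using lin_comb_superset[OF assms F.smult_closed[OF a x] Y(1) supp Y(2)] unfolding ax .
    also have "\<dots> = (\<Oplus>\<^bsub>N\<^esub>i\<in>?Y. a \<odot>\<^bsub>N\<^esub> (x i \<odot>\<^bsub>N\<^esub> t i))"
      using Y(2) t free_moduleD(1)[OF x] a
      by (intro N.M.finsum_cong') (auto simp: N.smult_assoc)
    also have "\<dots> = a \<odot>\<^bsub>N\<^esub> (\<Oplus>\<^bsub>N\<^esub>i\<in>?Y. x i \<odot>\<^bsub>N\<^esub> t i)"
      using Y t free_moduleD(1)[OF x] a
      by (intro smult_finsum[OF assms(1), symmetric]) auto
    finally show "lin_comb R N t (a \<odot>\<^bsub>free_module R X\<^esub> x) = a \<odot>\<^bsub>N\<^esub> lin_comb R N t x"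
      by (simp add: lin_comb_def) }
qed


lemma projective_lift:
  assumes "projective R P" "left_module R N" "left_module R N'"
    and g: "g \<in> mod_hom R N N'" and surj: "g ` carrier N = carrier N'"
    and f: "f \<in> mod_hom R P N'"
  shows "\<exists>h \<in> mod_hom R P N. \<forall>x\<in>carrier P. g (h x) = f x"
proof -
  interpret P: left_module R P using assms(1) by (simp add: projective_def)
  interpret N: left_module R N by fact
  interpret N': left_module R N' by fact
  let ?F = "free_module R (carrier P)"
  have F: "left_module R ?F" by (rule left_module_free_module) (rule P.R.ring_axioms)
  have PM: "left_module R P" by (rule P.left_module_axioms)
  have c: "lin_comb R P (\<lambda>x. x) \<in> mod_hom R ?F P" by (rule lin_comb_hom[OF PM]) auto
  have "lin_comb R P (\<lambda>x. x) ` carrier ?F = carrier P"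
  proof
    show "lin_comb R P (\<lambda>x. x) ` carrier ?F \<subseteq> carrier P" using mod_homD(1)[OF c] by auto
    show "carrier P \<subseteq> lin_comb R P (\<lambda>x. x) ` carrier ?F"
    proof
      fix x assume x: "x \<in> carrier P"
      let ?c = "\<lambda>i. if i = x then \<one>\<^bsub>R\<^esub> else \<zero>\<^bsub>R\<^esub>"
      have c: "?c \<in> carrier ?F" using x by (auto simp: free_module_def)
      have "lin_comb R P (\<lambda>x. x) ?c = (\<Oplus>\<^bsub>P\<^esub>i\<in>{x}. ?c i \<odot>\<^bsub>P\<^esub> i)"
        using x by (intro lin_comb_superset[OF PM _ c]) auto
      also have "\<dots> = x" using x by simp
      finally show "x \<in> lin_comb R P (\<lambda>x. x) ` carrier ?F" using c by (metis image_eqI)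
    qed
  qed
  moreover have "(\<lambda>x. x) \<in> mod_hom R P P" by (auto intro: mod_homI)
  ultimately have "\<exists>s \<in> mod_hom R P ?F. \<forall>x\<in>carrier P. lin_comb R P (\<lambda>x. x) (s x) = x"
    using assms(1)[unfolded projective_def, THEN conjunct2, rule_format, OF F PM c] by blast
  then obtain s where s: "s \<in> mod_hom R P ?F" "\<forall>x\<in>carrier P. lin_comb R P (\<lambda>x. x) (s x) = x"
    by blast
  have "\<forall>x\<in>carrier P. \<exists>y\<in>carrier N. g y = f x"
    using surj mod_homD(1)[OF f] by (metis imageE)
  then obtain t where t: "\<And>x. x \<in> carrier P \<Longrightarrow> t x \<in> carrier N" "\<And>x. x \<in> carrier P \<Longrightarrow> g (t x) = f x"
    by metis
  have u: "lin_comb R N t \<in> mod_hom R ?F N" by (rule lin_comb_hom) (use assms t in auto)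
  have "g (lin_comb R N t (s x)) = f x" if x: "x \<in> carrier P" for x
  proof -
    let ?c = "s x"
    have cF: "?c \<in> carrier ?F" by (rule mod_homD(1)[OF s(1) x])
    note D = free_moduleD[OF cF]
    have supp: "i \<in> carrier P" if "?c i \<noteq> \<zero>\<^bsub>R\<^esub>" for i using D(2) that by blast
    have "g (lin_comb R N t ?c) = (\<Oplus>\<^bsub>N'\<^esub>i\<in>{i. ?c i \<noteq> \<zero>\<^bsub>R\<^esub>}. g (?c i \<odot>\<^bsub>N\<^esub> t i))"
      unfolding lin_comb_def
      by (rule mod_hom_finsum[OF assms(2,3) g D(3)]) (simp add: D(1) t(1) supp)
    also have "\<dots> = (\<Oplus>\<^bsub>N'\<^esub>i\<in>{i. ?c i \<noteq> \<zero>\<^bsub>R\<^esub>}. f (?c i \<odot>\<^bsub>P\<^esub> i))"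
      by (rule N'.M.finsum_cong')
        (simp_all add: D(1) t supp mod_homD(1)[OF f] mod_homD(3)[OF g] mod_homD(3)[OF f])
    also have "\<dots> = f (lin_comb R P (\<lambda>x. x) ?c)"
      unfolding lin_comb_def
      by (rule mod_hom_finsum[OF PM assms(3) f D(3), symmetric]) (simp add: D(1) supp)
    finally show ?thesis using s(2) x by simp
  qed
  then show ?thesis by (intro bexI[OF _ mod_hom_compose[OF s(1) u]]) simp
qed

text \<open>Transport of a module structure along an injection.\<close>

definition transport_module :: "('m \<Rightarrow> 'n) \<Rightarrow> ('r, 'm) module \<Rightarrow> ('r, 'n) module" where
  "transport_module e M =
     (let e' = inv_into (carrier M) e in
     \<lparr>carrier = e ` carrier M, mult = (\<lambda>_ _. undefined), one = undefined,
      zero = e \<zero>\<^bsub>M\<^esub>, add = (\<lambda>x y. e (e' x \<oplus>\<^bsub>M\<^esub> e' y)),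
      smult = (\<lambda>a x. e (a \<odot>\<^bsub>M\<^esub> e' x))\<rparr>)"

lemma
  assumes "left_module R M" and inj: "inj_on e (carrier M)"
  shows left_module_transport: "left_module R (transport_module e M)"
    and transport_hom: "e \<in> mod_hom R M (transport_module e M)"
    and mod_iso_transport: "mod_iso R M (transport_module e M)"
proof -
  interpret M: left_module R M by fact
  let ?T = "transport_module e M"
  have T: "carrier ?T = e ` carrier M" "\<zero>\<^bsub>?T\<^esub> = e \<zero>\<^bsub>M\<^esub>"
    "\<And>x y. \<lbrakk>x \<in> carrier M; y \<in> carrier M\<rbrakk> \<Longrightarrow> e x \<oplus>\<^bsub>?T\<^esub> e y = e (x \<oplus>\<^bsub>M\<^esub> y)"
    "\<And>a x. x \<in> carrier M \<Longrightarrow> a \<odot>\<^bsub>?T\<^esub> e x = e (a \<odot>\<^bsub>M\<^esub> x)"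
    by (simp_all add: transport_module_def Let_def inv_into_f_f[OF inj])
  show "left_module R ?T"
  proof (intro left_module.intro left_module_axioms.intro M.R.ring_axioms abelian_groupI)
    fix x assume "x \<in> carrier ?T"
    then obtain y where y: "y \<in> carrier M" "x = e y" by (auto simp: T(1))
    then have "e (\<ominus>\<^bsub>M\<^esub> y) \<oplus>\<^bsub>?T\<^esub> x = \<zero>\<^bsub>?T\<^esub>" by (simp add: T M.M.l_neg)
    then show "\<exists>z\<in>carrier ?T. z \<oplus>\<^bsub>?T\<^esub> x = \<zero>\<^bsub>?T\<^esub>"
      using y by (auto simp: T(1))
  next
    fix x y assume "x \<in> carrier ?T" "y \<in> carrier ?T"
    then obtain x' y' where "x' \<in> carrier M" "x = e x'" "y' \<in> carrier M" "y = e y'"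
      by (auto simp: T(1))
    then show "x \<oplus>\<^bsub>?T\<^esub> y = y \<oplus>\<^bsub>?T\<^esub> x" by (simp add: T M.M.a_comm)
  qed (auto simp: T M.M.a_assoc M.smult_l_distr M.smult_r_distr M.smult_assoc)
  show h: "e \<in> mod_hom R M ?T"
    by (rule mod_homI) (simp_all add: T)
  then show "mod_iso R M ?T" unfolding mod_iso_def
    using inj T(1) by (blast intro: bij_betw_imageI)
qed

lemma finitely_presented_representative:
  fixes N :: "('r, 'n) module"
  assumes "finitely_presented R N"
  shows "\<exists>N' :: ('r, 'r coset_seq) module. finitely_presented R N' \<and> mod_iso R N N'"
proof -
  interpret N: left_module R N using assms by (simp add: finitely_presented_def)
  have NM: "left_module R N" by (rule N.left_module_axioms)
  obtain m n :: nat and \<phi> \<psi> where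
    \<phi>: "\<phi> \<in> mod_hom R (free_module R {..<m}) (free_module R {..<n})" and
    \<psi>: "\<psi> \<in> mod_hom R (free_module R {..<n}) N" and
    ex: "\<phi> ` carrier (free_module R {..<m}) = a_kernel (free_module R {..<n}) N \<psi>" and
    surj: "\<psi> ` carrier (free_module R {..<n}) = carrier N"
    using assms unfolding finitely_presented_def by blast
  let ?F = "free_module R {..<n}"
  define e where "e x = {c \<in> carrier ?F. \<psi> c = x}" for x
  have inj: "inj_on e (carrier N)"
  proof (rule inj_onI)
    fix x y assume "x \<in> carrier N" "y \<in> carrier N" and xy: "e x = e y"
    then obtain c where "c \<in> carrier ?F" "\<psi> c = x" using surj by force
    then have "c \<in> e y" using xy by (auto simp: e_def)
    then show "x = y" using \<open>\<psi> c = x\<close> by (auto simp: e_def)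
  qed
  let ?T = "transport_module e N"
  have c: "(\<lambda>c. e (\<psi> c)) \<in> mod_hom R ?F ?T"
    by (rule mod_hom_compose[OF \<psi> transport_hom[OF NM inj]])
  moreover have "\<phi> ` carrier (free_module R {..<m}) = a_kernel ?F ?T (\<lambda>c. e (\<psi> c))"
  proof -
    have "e (\<psi> c) = e \<zero>\<^bsub>N\<^esub> \<longleftrightarrow> \<psi> c = \<zero>\<^bsub>N\<^esub>" if "c \<in> carrier ?F" for c
      by (rule inj_on_eq_iff[OF inj mod_homD(1)[OF \<psi> that] N.M.zero_closed])
    then show ?thesis unfolding ex a_kernel_def' by (auto simp: transport_module_def Let_def)
  qed
  moreover have "(\<lambda>c. e (\<psi> c)) ` carrier ?F = carrier ?T"
    by (simp add: transport_module_def Let_def surj[symmetric] image_image)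
  ultimately have "finitely_presented R ?T"
    using left_module_transport[OF NM inj] \<phi> by (auto simp only: finitely_presented_def)
  then show ?thesis using mod_iso_transport[OF NM inj] by blast
qed

end

(* Every cycle module Z_n of an exact complex P of projective modules is itself a transfinite
   extension of finitely presented modules, so the retraction can be taken to be an isomorphism,
   and Ext^1(Z_n, A) = 0 for absolutely pure A then follows from Eklof's lemma.

   A projective module is a direct summand of a free one, hence has a dual basis. Call a set S of
   (degree, basis element) pairs closed if it spans an exact subcomplex W(S) of direct summands.
   If S is closed and T is finite, the quotient of Z_n \<inter> W_n(S \<union> T) by Z_n \<inter> W_n(S) embeds into a
   free module of finite rank, where its image is the intersection of the kernels of finitely many
   functionals. By left coherence it is finitely presented. In particular finitely many new basis
   elements suffice to make all its cycles boundaries, so that after countably many finite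
   enlargements one reaches a larger closed set, passing through finitely presented steps only.
   Unions of chains of closed sets are closed, and Zorn's lemma yields the filtration of Z_n. *)

theory Submission
  imports Defs
begin

section \<open>Submodules\<close>

text \<open>All degrees have to grow together: enlarging the part in degree n calls for preimages of
  the new cycles in degree n + 1 and for the supports of differentials in degree n - 1. So even the
  filtration of a single Z_n is governed by pairs from the whole complex. The intermediate sets S
  \<union> T are not closed, their subcomplexes need not be exact, and the presentation argument
  does not apply relative to them. Every stage is therefore presented over the last closed set S,
  and the quotient of two stages is a finitely presented module modulo a finitely generated one.
  Exactness of W(S) is what makes the image computable. Let a coefficient vector c on T - S
  represent an element whose coordinates outside S are c and whose differential lies in W(S). That
  differential is then the boundary of an element of W(S), and subtracting this element gives a
  cycle with the same coordinates outside S. Existence of a cycle thus becomes a finite system of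
  linear equations, which coherence can solve. Zorn's lemma runs over filtrations as sets of
  submodules, ordered by end extension; ordinals appear only when the finished chain is
  translated.\<close>

lemma mem_set_add: "z \<in> K <+>\<^bsub>M\<^esub> L \<longleftrightarrow> (\<exists>x\<in>K. \<exists>y\<in>L. z = x \<oplus>\<^bsub>M\<^esub> y)"
  by (auto simp: set_add_def')

lemma set_addI: "x \<in> K \<Longrightarrow> y \<in> L \<Longrightarrow> z = x \<oplus>\<^bsub>M\<^esub> y \<Longrightarrow> z \<in> K <+>\<^bsub>M\<^esub> L"
  by (auto simp: mem_set_add)

context left_module
begin

lemma smult_minus_one: "x \<in> carrier M \<Longrightarrow> (\<ominus> \<one>) \<odot>\<^bsub>M\<^esub> x = \<ominus>\<^bsub>M\<^esub> x"
proof -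
  assume x: "x \<in> carrier M"
  have "(\<ominus> \<one>) \<odot>\<^bsub>M\<^esub> x \<oplus>\<^bsub>M\<^esub> x = (\<ominus> \<one> \<oplus> \<one>) \<odot>\<^bsub>M\<^esub> x"
    using smult_l_distr[of "\<ominus> \<one>" \<one> x] x by simp
  also have "\<dots> = \<zero>\<^bsub>M\<^esub>" using x by (simp add: R.l_neg)
  finally show ?thesis using x by (metis M.minus_equality R.a_inv_closed R.one_closed smult_closed)
qed

lemma minus_eq_zero_iff:
  assumes "x \<in> carrier M" "y \<in> carrier M"
  shows "x \<ominus>\<^bsub>M\<^esub> y = \<zero>\<^bsub>M\<^esub> \<longleftrightarrow> x = y"
proof
  assume "x \<ominus>\<^bsub>M\<^esub> y = \<zero>\<^bsub>M\<^esub>"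
  then have "(x \<ominus>\<^bsub>M\<^esub> y) \<oplus>\<^bsub>M\<^esub> y = y" using assms by simp
  then show "x = y" using assms by (simp add: a_minus_def M.a_assoc M.l_neg)
qed (use assms in \<open>simp add: a_minus_def M.r_neg\<close>)

lemma submodule_iff:
  "submodule H R M \<longleftrightarrow> H \<subseteq> carrier M \<and> \<zero>\<^bsub>M\<^esub> \<in> H \<and> (\<forall>x\<in>H. \<forall>y\<in>H. x \<oplus>\<^bsub>M\<^esub> y \<in> H) \<and>
     (\<forall>a\<in>carrier R. \<forall>x\<in>H. a \<odot>\<^bsub>M\<^esub> x \<in> H)" (is "_ \<longleftrightarrow> ?r")
proof
  assume "submodule H R M"
  then interpret H: submodule H R M .
  show ?r using H.subset H.one_closed H.m_closed H.smult_closed by auto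
next
  assume r: ?r
  show "submodule H R M"
  proof (intro submodule.intro subgroup.intro submodule_axioms.intro)
    fix x assume "x \<in> H"
    then have "\<ominus>\<^bsub>M\<^esub> x \<in> H" using r smult_minus_one[of x] R.a_inv_closed[OF R.one_closed] by (metis subsetD)
    then show "inv\<^bsub>add_monoid M\<^esub> x \<in> H" by (simp add: a_inv_def)
  qed (use r in auto)
qed

lemma submoduleD:
  assumes "submodule H R M"
  shows "H \<subseteq> carrier M" "\<And>x. x \<in> H \<Longrightarrow> x \<in> carrier M" "\<zero>\<^bsub>M\<^esub> \<in> H"
    "\<And>x y. \<lbrakk>x \<in> H; y \<in> H\<rbrakk> \<Longrightarrow> x \<oplus>\<^bsub>M\<^esub> y \<in> H"
    "\<And>a x. \<lbrakk>a \<in> carrier R; x \<in> H\<rbrakk> \<Longrightarrow> a \<odot>\<^bsub>M\<^esub> x \<in> H"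
    "\<And>x. x \<in> H \<Longrightarrow> \<ominus>\<^bsub>M\<^esub> x \<in> H"
    "\<And>x y. \<lbrakk>x \<in> H; y \<in> H\<rbrakk> \<Longrightarrow> x \<ominus>\<^bsub>M\<^esub> y \<in> H"
proof -
  show *: "H \<subseteq> carrier M" "\<zero>\<^bsub>M\<^esub> \<in> H" "\<And>x y. \<lbrakk>x \<in> H; y \<in> H\<rbrakk> \<Longrightarrow> x \<oplus>\<^bsub>M\<^esub> y \<in> H"
    "\<And>a x. \<lbrakk>a \<in> carrier R; x \<in> H\<rbrakk> \<Longrightarrow> a \<odot>\<^bsub>M\<^esub> x \<in> H" "\<And>x. x \<in> H \<Longrightarrow> x \<in> carrier M"
    using assms by (auto simp: submodule_iff)
  show **: "\<ominus>\<^bsub>M\<^esub> x \<in> H" if "x \<in> H" for x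
    using *(4)[of "\<ominus> \<one>" x] *(1) that smult_minus_one[of x] by auto
  show "\<And>x y. \<lbrakk>x \<in> H; y \<in> H\<rbrakk> \<Longrightarrow> x \<ominus>\<^bsub>M\<^esub> y \<in> H"
    unfolding a_minus_def using * ** by auto
qed

lemma left_module_submodule:
  assumes "submodule H R M"
  shows "left_module R (M\<lparr>carrier := H\<rparr>)"
proof (intro left_module.intro left_module_axioms.intro R.ring_axioms abelian_groupI)
  fix x assume "x \<in> carrier (M\<lparr>carrier := H\<rparr>)"
  then show "\<exists>y\<in>carrier (M\<lparr>carrier := H\<rparr>). y \<oplus>\<^bsub>M\<lparr>carrier := H\<rparr>\<^esub> x = \<zero>\<^bsub>M\<lparr>carrier := H\<rparr>\<^esub>"
    using submoduleD[OF assms] by (auto simp: M.l_neg intro!: bexI[of _ "\<ominus>\<^bsub>M\<^esub> x"])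
qed (use submoduleD[OF assms] in
    \<open>auto simp: M.a_ac smult_l_distr smult_r_distr smult_assoc subset_iff\<close>)

lemma submodule_carrier: "submodule (carrier M) R M"
  by (auto simp: submodule_iff)

lemma submodule_zero: "submodule {\<zero>\<^bsub>M\<^esub>} R M"
  by (auto simp: submodule_iff)

lemma submodule_Int: "submodule H R M \<Longrightarrow> submodule K R M \<Longrightarrow> submodule (H \<inter> K) R M"
  by (auto simp: submodule_iff)

lemma submodule_Union_chain:
  assumes "\<U> \<noteq> {}" "\<And>X. X \<in> \<U> \<Longrightarrow> submodule X R M"
    and "\<And>X Y. X \<in> \<U> \<Longrightarrow> Y \<in> \<U> \<Longrightarrow> X \<subseteq> Y \<or> Y \<subseteq> X"
  shows "submodule (\<Union>\<U>) R M"
  unfolding submodule_iff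
proof (intro conjI ballI)
  fix x y assume "x \<in> \<Union>\<U>" "y \<in> \<Union>\<U>"
  then obtain X Y where XY: "X \<in> \<U>" "Y \<in> \<U>" "x \<in> X" "y \<in> Y" by blast
  with assms(3)[of X Y] consider "x \<in> Y" | "y \<in> X" by blast
  then show "x \<oplus>\<^bsub>M\<^esub> y \<in> \<Union>\<U>"
    using XY submoduleD(4)[OF assms(2)] by cases blast+
next
  show "\<Union>\<U> \<subseteq> carrier M" using submoduleD(1)[OF assms(2)] by auto
  show "\<zero>\<^bsub>M\<^esub> \<in> \<Union>\<U>" using assms(1) submoduleD(3)[OF assms(2)] by auto
  show "a \<odot>\<^bsub>M\<^esub> x \<in> \<Union>\<U>" if "a \<in> carrier R" "x \<in> \<Union>\<U>" for a x
    using that submoduleD(5)[OF assms(2)] by blast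
qed

lemma submodule_set_add:
  assumes H: "submodule H R M" and K: "submodule K R M"
  shows "submodule (H <+>\<^bsub>M\<^esub> K) R M"
  unfolding submodule_iff mem_set_add
proof (intro conjI ballI)
  note [simp] = submoduleD(2)[OF H] submoduleD(2)[OF K]
  show "H <+>\<^bsub>M\<^esub> K \<subseteq> carrier M" by (auto simp: mem_set_add)
  show "\<exists>x\<in>H. \<exists>y\<in>K. \<zero>\<^bsub>M\<^esub> = x \<oplus>\<^bsub>M\<^esub> y"
    using submoduleD(3)[OF H] submoduleD(3)[OF K] by force
  fix u v assume "u \<in> H <+>\<^bsub>M\<^esub> K" "v \<in> H <+>\<^bsub>M\<^esub> K"
  then obtain a b c d where "a \<in> H" "c \<in> H" "b \<in> K" "d \<in> K" "u = a \<oplus>\<^bsub>M\<^esub> b" "v = c \<oplus>\<^bsub>M\<^esub> d"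
    by (auto simp: mem_set_add)
  then show "\<exists>x\<in>H. \<exists>y\<in>K. u \<oplus>\<^bsub>M\<^esub> v = x \<oplus>\<^bsub>M\<^esub> y"
    by (intro bexI[of _ "a \<oplus>\<^bsub>M\<^esub> c"] bexI[of _ "b \<oplus>\<^bsub>M\<^esub> d"])
      (auto simp: M.a_ac submoduleD(4)[OF H] submoduleD(4)[OF K])
next
  note [simp] = submoduleD(2)[OF H] submoduleD(2)[OF K]
  fix r u assume "r \<in> carrier R" "u \<in> H <+>\<^bsub>M\<^esub> K"
  then show "\<exists>x\<in>H. \<exists>y\<in>K. r \<odot>\<^bsub>M\<^esub> u = x \<oplus>\<^bsub>M\<^esub> y"
    using smult_r_distr submoduleD(5)[OF H] submoduleD(5)[OF K] by (fastforce simp: mem_set_add)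
qed

end

lemma mod_hom_minus:
  assumes "left_module R M" "left_module R N" "f \<in> mod_hom R M N" "x \<in> carrier M"
  shows "f (\<ominus>\<^bsub>M\<^esub> x) = \<ominus>\<^bsub>N\<^esub> f x"
proof -
  interpret M: left_module R M by fact
  interpret N: left_module R N by fact
  show ?thesis
    using M.smult_minus_one[OF assms(4)] N.smult_minus_one[OF mod_homD(1)[OF assms(3,4)]]
      mod_homD(3)[OF assms(3) _ assms(4)] by (metis M.R.a_inv_closed M.R.one_closed)
qed

lemma mod_hom_diff:
  assumes "left_module R M" "left_module R N" "f \<in> mod_hom R M N" "x \<in> carrier M" "y \<in> carrier M"
  shows "f (x \<ominus>\<^bsub>M\<^esub> y) = f x \<ominus>\<^bsub>N\<^esub> f y"
proof -
  interpret M: left_module R M by fact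
  show ?thesis using assms(4,5) mod_hom_minus[OF assms(1-3,5)] mod_homD(2)[OF assms(3)]
    by (simp add: a_minus_def)
qed

lemma submodule_image:
  assumes "left_module R M" "left_module R N" "f \<in> mod_hom R M N" "submodule H R M"
  shows "submodule (f ` H) R N"
proof -
  interpret M: left_module R M by fact
  interpret N: left_module R N by fact
  note H = M.submoduleD[OF assms(4)] and f = mod_homD[OF assms(3)]
  show ?thesis unfolding N.submodule_iff
  proof (intro conjI ballI)
    show "f ` H \<subseteq> carrier N" using H f by auto
    show "\<zero>\<^bsub>N\<^esub> \<in> f ` H" using mod_hom_zero[OF assms(1-3)] H(3) by (metis imageI)
  next
    fix x y assume "x \<in> f ` H" "y \<in> f ` H"
    then obtain a b where "a \<in> H" "b \<in> H" "x = f a" "y = f b" by auto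
    then show "x \<oplus>\<^bsub>N\<^esub> y \<in> f ` H" using f(2)[of a b] H(2,4) by (metis imageI)
  next
    fix r x assume "r \<in> carrier R" "x \<in> f ` H"
    then obtain a where "a \<in> H" "x = f a" by auto
    then show "r \<odot>\<^bsub>N\<^esub> x \<in> f ` H" using \<open>r \<in> carrier R\<close> f(3)[of r a] H(2,5) by (metis imageI)
  qed
qed

lemma submodule_vimage:
  assumes "left_module R M" "left_module R N" "f \<in> mod_hom R M N" "submodule H R N"
  shows "submodule {x \<in> carrier M. f x \<in> H} R M"
proof -
  interpret M: left_module R M by fact
  interpret N: left_module R N by fact
  show ?thesis unfolding M.submodule_iff
    using N.submoduleD[OF assms(4)] mod_homD[OF assms(3)] mod_hom_zero[OF assms(1-3)] by auto
qed

lemma submodule_equalizer: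
  assumes "left_module R M" "left_module R N" "f \<in> mod_hom R M N" "g \<in> mod_hom R M N"
  shows "submodule {x \<in> carrier M. f x = g x} R M"
proof -
  interpret M: left_module R M by fact
  show ?thesis unfolding M.submodule_iff
    using mod_homD[OF assms(3)] mod_homD[OF assms(4)] mod_hom_zero[OF assms(1-3)]
      mod_hom_zero[OF assms(1,2,4)] by auto
qed

lemma a_kernel_eq: "a_kernel M N f = {x \<in> carrier M. f x = \<zero>\<^bsub>N\<^esub>}"
  by (simp add: a_kernel_def')

lemma submodule_kernel:
  assumes "left_module R M" "left_module R N" "f \<in> mod_hom R M N"
  shows "submodule (a_kernel M N f) R M"
  using submodule_vimage[OF assms left_module.submodule_zero[OF assms(2)]]
  by (simp add: a_kernel_eq)

lemma mod_hom_add: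
  assumes "left_module R N" "f \<in> mod_hom R M N" "g \<in> mod_hom R M N"
  shows "(\<lambda>x. f x \<oplus>\<^bsub>N\<^esub> g x) \<in> mod_hom R M N"
proof -
  interpret N: left_module R N by fact
  show ?thesis
    by (rule mod_homI)
      (auto simp: mod_homD[OF assms(2)] mod_homD[OF assms(3)] N.M.a_ac N.smult_r_distr)
qed

lemma mod_hom_uminus:
  assumes "left_module R N" "f \<in> mod_hom R M N"
  shows "(\<lambda>x. \<ominus>\<^bsub>N\<^esub> f x) \<in> mod_hom R M N"
proof -
  interpret N: left_module R N by fact
  have "\<ominus>\<^bsub>N\<^esub> (a \<odot>\<^bsub>N\<^esub> y) = a \<odot>\<^bsub>N\<^esub> (\<ominus>\<^bsub>N\<^esub> y)" if "a \<in> carrier R" "y \<in> carrier N" for a y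
    using that N.smult_r_distr[of a y "\<ominus>\<^bsub>N\<^esub> y"]
    by (simp add: N.M.r_neg) (metis N.M.minus_equality N.M.a_comm N.M.a_inv_closed N.smult_closed)
  then show ?thesis
    by (intro mod_homI) (auto simp: mod_homD[OF assms(2)] N.M.minus_add)
qed

lemma mod_hom_sub:
  assumes "left_module R N" "f \<in> mod_hom R M N" "g \<in> mod_hom R M N"
  shows "(\<lambda>x. f x \<ominus>\<^bsub>N\<^esub> g x) \<in> mod_hom R M N"
  unfolding a_minus_def by (intro mod_hom_add mod_hom_uminus assms)

lemma mod_hom_id: "(\<lambda>x. x) \<in> mod_hom R M M"
  by (auto intro: mod_homI)

lemma mod_hom_subset:
  assumes "f \<in> mod_hom R M N" "H \<subseteq> carrier M" "\<And>x. x \<in> H \<Longrightarrow> f x \<in> K"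
  shows "f \<in> mod_hom R (M\<lparr>carrier := H\<rparr>) (N\<lparr>carrier := K\<rparr>)"
proof (rule mod_homI)
  have H: "x \<in> carrier M" if "x \<in> H" for x using assms(2) that by auto
  show "f (a \<odot>\<^bsub>M\<lparr>carrier := H\<rparr>\<^esub> x) = a \<odot>\<^bsub>N\<lparr>carrier := K\<rparr>\<^esub> f x"
    if "a \<in> carrier R" "x \<in> carrier (M\<lparr>carrier := H\<rparr>)" for a x
    using that mod_homD(3)[OF assms(1)] H by simp
qed (use assms mod_homD(2)[OF assms(1)] in \<open>auto simp: subset_iff\<close>)


section \<open>Finitely generated submodules\<close>

text \<open>For \<open>G\<close> outside the carrier the family is empty and the intersection is
  \<open>UNIV\<close>; hence the inclusion assumptions in what follows.\<close>

definition span :: "('r, 'x) ring_scheme \<Rightarrow> ('r, 'm, 'y) module_scheme \<Rightarrow> 'm set \<Rightarrow> 'm set" where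
  "span R M G = \<Inter>{H. submodule H R M \<and> G \<subseteq> H}"

lemma span_superset: "G \<subseteq> span R M G"
  by (auto simp: span_def)

lemma span_least: "submodule H R M \<Longrightarrow> G \<subseteq> H \<Longrightarrow> span R M G \<subseteq> H"
  by (auto simp: span_def)

lemma span_mono: "G \<subseteq> G' \<Longrightarrow> span R M G \<subseteq> span R M G'"
  by (auto simp: span_def)

lemma (in left_module) submodule_span:
  assumes "G \<subseteq> carrier M"
  shows "submodule (span R M G) R M"
proof -
  have "span R M G \<subseteq> carrier M" by (rule span_least[OF submodule_carrier assms])
  then show ?thesis unfolding submodule_iff span_def by (simp add: submodule_iff)
qed

lemma span_image:
  assumes "left_module R M" "left_module R N" "f \<in> mod_hom R M N" "G \<subseteq> carrier M"
  shows "f ` span R M G = span R N (f ` G)"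
proof
  interpret M: left_module R M by fact
  interpret N: left_module R N by fact
  have fG: "f ` G \<subseteq> carrier N" using assms(4) mod_homD(1)[OF assms(3)] by auto
  have "span R M G \<subseteq> {x \<in> carrier M. f x \<in> span R N (f ` G)}"
    using assms(4) span_superset[of "f ` G" R N]
    by (intro span_least submodule_vimage[OF assms(1-3)] N.submodule_span fG) auto
  then show "f ` span R M G \<subseteq> span R N (f ` G)" by auto
  show "span R N (f ` G) \<subseteq> f ` span R M G"
    by (intro span_least submodule_image[OF assms(1-3)] M.submodule_span assms(4) image_mono span_superset)
qed

lemma (in left_module) span_Un:
  assumes "G \<subseteq> carrier M" "G' \<subseteq> carrier M"
  shows "span R M (G \<union> G') = span R M G <+>\<^bsub>M\<^esub> span R M G'"
proof
  note s = submoduleD[OF submodule_span[OF assms(1)]] and s' = submoduleD[OF submodule_span[OF assms(2)]]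
  have "x \<in> span R M G <+>\<^bsub>M\<^esub> span R M G'" if "x \<in> span R M G" for x
    unfolding mem_set_add using that s(2) s'(3) by (intro bexI[of _ x] bexI[of _ "\<zero>\<^bsub>M\<^esub>"]) auto
  moreover have "x \<in> span R M G <+>\<^bsub>M\<^esub> span R M G'" if "x \<in> span R M G'" for x
    unfolding mem_set_add using that s'(2) s(3) by (intro bexI[of _ x] bexI[of _ "\<zero>\<^bsub>M\<^esub>"]) auto
  ultimately show "span R M (G \<union> G') \<subseteq> span R M G <+>\<^bsub>M\<^esub> span R M G'"
    using span_superset[of G R M] span_superset[of G' R M]
    by (intro span_least submodule_set_add submodule_span assms) blast
  have "span R M G \<subseteq> span R M (G \<union> G')" "span R M G' \<subseteq> span R M (G \<union> G')"
    by (intro span_mono; blast)+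
  then show "span R M G <+>\<^bsub>M\<^esub> span R M G' \<subseteq> span R M (G \<union> G')"
    using submoduleD(4)[OF submodule_span[of "G \<union> G'"]] assms by (auto simp: mem_set_add subset_iff)
qed

text \<open>Finite generation of a subset of a fixed ambient module, so that sums, images and
  kernels are handled as sets without changing carriers.\<close>

definition fg_sub :: "('r, 'x) ring_scheme \<Rightarrow> ('r, 'm, 'y) module_scheme \<Rightarrow> 'm set \<Rightarrow> bool" where
  "fg_sub R M K \<longleftrightarrow> (\<exists>G. finite G \<and> G \<subseteq> carrier M \<and> K = span R M G)"

lemma fg_sub_image:
  assumes "left_module R M" "left_module R N" "f \<in> mod_hom R M N" "fg_sub R M K"
  shows "fg_sub R N (f ` K)"
proof -
  obtain G where G: "finite G" "G \<subseteq> carrier M" "K = span R M G" using assms(4) by (auto simp: fg_sub_def)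
  then show ?thesis unfolding fg_sub_def
    using span_image[OF assms(1-3)] mod_homD(1)[OF assms(3)] by (intro exI[of _ "f ` G"]) auto
qed

lemma (in left_module) fg_sub_set_add:
  assumes "fg_sub R M K" "fg_sub R M L"
  shows "fg_sub R M (K <+>\<^bsub>M\<^esub> L)"
  using assms span_Un unfolding fg_sub_def by (metis finite_Un Un_subset_iff)

section \<open>Free modules and their unit vectors\<close>

definition unit_vec :: "('r, 'x) ring_scheme \<Rightarrow> 'i \<Rightarrow> 'i \<Rightarrow> 'r" where
  "unit_vec R i = (\<lambda>j. if j = i then \<one>\<^bsub>R\<^esub> else \<zero>\<^bsub>R\<^esub>)"

lemma unit_vec_closed:
  assumes "ring R" "i \<in> X"
  shows "unit_vec R i \<in> carrier (free_module R X)"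
proof -
  interpret ring R by fact
  show ?thesis using assms(2) by (auto simp: free_module_def unit_vec_def)
qed

lemma free_module_sel:
  "\<zero>\<^bsub>free_module R X\<^esub> = (\<lambda>_. \<zero>\<^bsub>R\<^esub>)" "x \<oplus>\<^bsub>free_module R X\<^esub> y = (\<lambda>i. x i \<oplus>\<^bsub>R\<^esub> y i)"
  "a \<odot>\<^bsub>free_module R X\<^esub> x = (\<lambda>i. a \<otimes>\<^bsub>R\<^esub> x i)"
  by (simp_all add: free_module_def)

lemma free_module_mono: "X \<subseteq> Y \<Longrightarrow> carrier (free_module R X) \<subseteq> carrier (free_module R Y)"
  by (auto simp: free_module_def)

text \<open>Families are extended by zero, so the free module on \<open>Y\<close> literally lies
  inside the free module on \<open>X\<close>. Later this allows a finite set of coordinates to be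
  treated inside the free cover of a whole module.\<close>

lemma free_module_span:
  assumes "ring R" "Y \<subseteq> X"
  shows "carrier (free_module R Y) = span R (free_module R X) (unit_vec R ` Y)"
proof
  interpret ring R by fact
  interpret F: left_module R "free_module R X" by (rule left_module_free_module) fact
  have u: "unit_vec R ` Y \<subseteq> carrier (free_module R X)"
    using assms(2) by (auto intro: unit_vec_closed[OF assms(1)])
  note s = F.submoduleD[OF F.submodule_span[OF u]]
  \<comment> \<open>The induction is over a finite set that contains the support; removing
    \<open>i\<close> from it corresponds to resetting the coordinate \<open>c i\<close> to zero and
    splitting off \<open>c i\<close> times a unit vector.\<close>
  have supp: "c \<in> span R (free_module R X) (unit_vec R ` Y)"
    if "finite Z" "Z \<subseteq> Y" "c \<in> carrier (free_module R Y)" "{i. c i \<noteq> \<zero>\<^bsub>R\<^esub>} \<subseteq> Z" for Z c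
    using that
  proof (induction Z arbitrary: c rule: finite_induct)
    case empty
    then have "c = \<zero>\<^bsub>free_module R X\<^esub>" by (auto simp: free_module_sel)
    then show ?case using s(3) by simp
  next
    case (insert i Z)
    note c = free_moduleD[OF insert.prems(2)]
    have "finite {j. (c(i := \<zero>\<^bsub>R\<^esub>)) j \<noteq> \<zero>\<^bsub>R\<^esub>}" by (rule finite_subset[OF _ c(3)]) auto
    then have c': "c(i := \<zero>\<^bsub>R\<^esub>) \<in> carrier (free_module R Y)"
      using insert.prems(2) by (auto simp: free_module_def)
    have 1: "c(i := \<zero>\<^bsub>R\<^esub>) \<in> span R (free_module R X) (unit_vec R ` Y)"
      using insert.prems by (intro insert.IH c') auto
    have "unit_vec R i \<in> span R (free_module R X) (unit_vec R ` Y)"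
      using insert.prems(1) span_superset[of "unit_vec R ` Y"] by blast
    then have 2: "c i \<odot>\<^bsub>free_module R X\<^esub> unit_vec R i \<in> span R (free_module R X) (unit_vec R ` Y)"
      using s(5) c(1) by simp
    have "c = c(i := \<zero>\<^bsub>R\<^esub>) \<oplus>\<^bsub>free_module R X\<^esub> c i \<odot>\<^bsub>free_module R X\<^esub> unit_vec R i"
      using c(1) by (auto simp: free_module_sel unit_vec_def)
    then show ?case using s(4)[OF 1 2] by simp
  qed
  show "carrier (free_module R Y) \<subseteq> span R (free_module R X) (unit_vec R ` Y)"
  proof
    fix c assume c: "c \<in> carrier (free_module R Y)"
    show "c \<in> span R (free_module R X) (unit_vec R ` Y)"
      by (rule supp[OF free_moduleD(3,2)[OF c] c subset_refl])
  qed
  have "submodule (carrier (free_module R Y)) R (free_module R X)"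
  proof -
    interpret Y: left_module R "free_module R Y" by (rule left_module_free_module[OF assms(1)])
    show ?thesis
      using Y.submodule_carrier free_module_mono[OF assms(2)]
      unfolding F.submodule_iff Y.submodule_iff by (simp add: free_module_sel)
  qed
  then show "span R (free_module R X) (unit_vec R ` Y) \<subseteq> carrier (free_module R Y)"
    using unit_vec_closed[OF assms(1)] by (intro span_least) auto
qed

lemma fg_sub_free_module:
  assumes "ring R" "Y \<subseteq> X" "finite Y"
  shows "fg_sub R (free_module R X) (carrier (free_module R Y))"
  unfolding fg_sub_def using free_module_span[OF assms(1,2)] assms(2,3)
  by (intro exI[of _ "unit_vec R ` Y"]) (auto intro: unit_vec_closed[OF assms(1)])

text \<open>The induction principle for free modules. Applied to an equalizer or to a preimage it
  reduces equality of homomorphisms and membership of values to unit vectors.\<close>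

lemma free_module_submodule_eq:
  assumes "ring R" "submodule H R (free_module R X)" "\<And>i. i \<in> X \<Longrightarrow> unit_vec R i \<in> H"
  shows "carrier (free_module R X) \<subseteq> H"
proof -
  have "unit_vec R ` X \<subseteq> H" using assms(3) by auto
  then show ?thesis unfolding free_module_span[OF assms(1) subset_refl] by (rule span_least[OF assms(2)])
qed

lemma free_module_hom_eq:
  assumes "ring R" "left_module R N" "f \<in> mod_hom R (free_module R X) N" "g \<in> mod_hom R (free_module R X) N"
    and "\<And>i. i \<in> X \<Longrightarrow> f (unit_vec R i) = g (unit_vec R i)" "c \<in> carrier (free_module R X)"
  shows "f c = g c"
  using free_module_submodule_eq[OF assms(1) submodule_equalizer[OF left_module_free_module[OF assms(1)] assms(2-4)]]
    assms(5,6) unit_vec_closed[OF assms(1)] by fastforce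

lemma lin_comb_unit_vec:
  assumes "left_module R N" "t \<in> X \<rightarrow> carrier N" "i \<in> X"
  shows "lin_comb R N t (unit_vec R i) = t i"
proof -
  interpret N: left_module R N by fact
  have "t i \<in> carrier N" using assms by auto
  have "lin_comb R N t (unit_vec R i) = (\<Oplus>\<^bsub>N\<^esub>j\<in>{i}. unit_vec R i j \<odot>\<^bsub>N\<^esub> t j)"
    using assms(3) by (intro lin_comb_superset[OF assms(1,2) unit_vec_closed[OF N.R.ring_axioms assms(3)]])
      (auto simp: unit_vec_def)
  also have "\<dots> = t i" using \<open>t i \<in> carrier N\<close> by (simp add: unit_vec_def)
  finally show ?thesis .
qed

lemma lin_comb_image:
  assumes "left_module R N" "t \<in> X \<rightarrow> carrier N"
  shows "lin_comb R N t ` carrier (free_module R X) = span R N (t ` X)"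
proof -
  interpret N: left_module R N by fact
  note r = N.R.ring_axioms
  have "lin_comb R N t ` carrier (free_module R X) = span R N (lin_comb R N t ` unit_vec R ` X)"
    unfolding free_module_span[OF r subset_refl]
    by (intro span_image lin_comb_hom assms left_module_free_module r) (auto simp: unit_vec_closed[OF r])
  also have "lin_comb R N t ` unit_vec R ` X = t ` X"
    using lin_comb_unit_vec[OF assms] by (auto simp: image_image)
  finally show ?thesis .
qed

text \<open>Links generating sets with maps out of \<open>R^n\<close>, the form in which
  \<open>finitely_generated\<close> and \<open>finitely_presented\<close> are stated.\<close>

lemma fg_sub_iff_image:
  assumes "left_module R M"
  shows "fg_sub R M K \<longleftrightarrow>
     (\<exists>n::nat. \<exists>\<psi> \<in> mod_hom R (free_module R {..<n}) M. \<psi> ` carrier (free_module R {..<n}) = K)"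
proof
  interpret M: left_module R M by fact
  note r = M.R.ring_axioms
  assume "fg_sub R M K"
  then obtain G where G: "finite G" "G \<subseteq> carrier M" "K = span R M G" by (auto simp: fg_sub_def)
  obtain n :: nat and t where t: "G = t ` {..<n}"
    using finite_imp_nat_seg_image_inj_on[OF G(1)] by (auto simp: lessThan_def)
  then have "t \<in> {..<n} \<rightarrow> carrier M" using G(2) by auto
  then show "\<exists>n::nat. \<exists>\<psi> \<in> mod_hom R (free_module R {..<n}) M. \<psi> ` carrier (free_module R {..<n}) = K"
    using lin_comb_hom[OF assms] lin_comb_image[OF assms] G(3) t by metis
next
  interpret M: left_module R M by fact
  note r = M.R.ring_axioms
  assume "\<exists>n::nat. \<exists>\<psi> \<in> mod_hom R (free_module R {..<n}) M. \<psi> ` carrier (free_module R {..<n}) = K"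
  then show "fg_sub R M K"
    using fg_sub_image[OF left_module_free_module[OF r] assms _ fg_sub_free_module[OF r subset_refl]] by blast
qed

section \<open>Coherence\<close>

lemma left_module_regular: "ring R \<Longrightarrow> left_module R (regular_module R)"
proof -
  assume "ring R"
  then interpret ring R .
  show ?thesis
    by (intro left_module.intro left_module_axioms.intro abelian_groupI ring_axioms)
      (auto simp: regular_module_def a_ac l_distr r_distr m_assoc intro!: bexI[of _ "\<ominus>\<^bsub>R\<^esub> _"] l_neg)
qed

lemma free_module_lift:
  assumes "left_module R N" "\<And>i. i \<in> X \<Longrightarrow> t i \<in> carrier N"
  shows "\<exists>f \<in> mod_hom R (free_module R X) N. \<forall>i\<in>X. f (unit_vec R i) = t i"
proof (intro bexI[of _ "lin_comb R N t"] ballI)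
  have t: "t \<in> X \<rightarrow> carrier N" using assms(2) by auto
  show "lin_comb R N t \<in> mod_hom R (free_module R X) N" by (rule lin_comb_hom[OF assms(1) t])
  show "lin_comb R N t (unit_vec R i) = t i" if "i \<in> X" for i by (rule lin_comb_unit_vec[OF assms(1) t that])
qed

lemma free_module_hom_in:
  assumes "left_module R N" "f \<in> mod_hom R (free_module R X) N" "submodule H R N"
    and "\<And>i. i \<in> X \<Longrightarrow> f (unit_vec R i) \<in> H" "c \<in> carrier (free_module R X)"
  shows "f c \<in> H"
proof -
  interpret N: left_module R N by fact
  note r = N.R.ring_axioms
  have "carrier (free_module R X) \<subseteq> {c \<in> carrier (free_module R X). f c \<in> H}"
    by (intro free_module_submodule_eq[OF r] submodule_vimage[OF left_module_free_module[OF r] assms(1-3)])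
      (simp add: assms(4) unit_vec_closed[OF r])
  then show ?thesis using assms(5) by auto
qed

text \<open>Schanuel's lemma: the kernel of \<open>\<chi>\<close> is the sum of the image of \<open>ker \<psi>\<close> under a lift of \<open>\<psi>\<close>
  and of the image of \<open>id - \<alpha>\<beta>\<close>, where \<open>\<alpha>\<close> and \<open>\<beta>\<close> are lifts of \<open>\<psi>\<close> and \<open>\<chi>\<close> along each other.\<close>

lemma schanuel_fg:
  assumes I: "left_module R I" and Y: "finite Y"
    and \<psi>: "\<psi> \<in> mod_hom R (free_module R X) I" "\<psi> ` carrier (free_module R X) = carrier I"
    and \<chi>: "\<chi> \<in> mod_hom R (free_module R Y) I" "\<chi> ` carrier (free_module R Y) = carrier I"
    and fg: "fg_sub R (free_module R X) (a_kernel (free_module R X) I \<psi>)"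
  shows "fg_sub R (free_module R Y) (a_kernel (free_module R Y) I \<chi>)"
proof -
  interpret I: left_module R I by fact
  note r = I.R.ring_axioms
  let ?X = "free_module R X" and ?Y = "free_module R Y"
  have X: "left_module R ?X" and Ym: "left_module R ?Y" using left_module_free_module[OF r] by auto
  interpret X: left_module R ?X by (rule X)
  interpret Y: left_module R ?Y by (rule Ym)
  have "\<forall>i\<in>X. \<exists>y\<in>carrier ?Y. \<chi> y = \<psi> (unit_vec R i)"
    using \<chi>(2) mod_homD(1)[OF \<psi>(1) unit_vec_closed[OF r]] by (metis imageE)
  then obtain ta where ta: "\<And>i. i \<in> X \<Longrightarrow> ta i \<in> carrier ?Y" "\<And>i. i \<in> X \<Longrightarrow> \<chi> (ta i) = \<psi> (unit_vec R i)"
    by metis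
  have "\<forall>i\<in>Y. \<exists>y\<in>carrier ?X. \<psi> y = \<chi> (unit_vec R i)"
    using \<psi>(2) mod_homD(1)[OF \<chi>(1) unit_vec_closed[OF r]] by (metis imageE)
  then obtain tb where tb: "\<And>i. i \<in> Y \<Longrightarrow> tb i \<in> carrier ?X" "\<And>i. i \<in> Y \<Longrightarrow> \<psi> (tb i) = \<chi> (unit_vec R i)"
    by metis
  obtain \<alpha> where \<alpha>: "\<alpha> \<in> mod_hom R ?X ?Y" "\<And>i. i \<in> X \<Longrightarrow> \<alpha> (unit_vec R i) = ta i"
    using free_module_lift[OF Ym, of X ta] ta(1) by auto
  obtain \<beta> where \<beta>: "\<beta> \<in> mod_hom R ?Y ?X" "\<And>i. i \<in> Y \<Longrightarrow> \<beta> (unit_vec R i) = tb i"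
    using free_module_lift[OF X, of Y tb] tb(1) by auto
  have \<chi>\<alpha>: "\<chi> (\<alpha> x) = \<psi> x" if "x \<in> carrier ?X" for x
    by (rule free_module_hom_eq[OF r I mod_hom_compose[OF \<alpha>(1) \<chi>(1)] \<psi>(1) _ that]) (simp add: \<alpha>(2) ta(2))
  have \<psi>\<beta>: "\<psi> (\<beta> x) = \<chi> x" if "x \<in> carrier ?Y" for x
    by (rule free_module_hom_eq[OF r I mod_hom_compose[OF \<beta>(1) \<psi>(1)] \<chi>(1) _ that]) (simp add: \<beta>(2) tb(2))
  let ?\<delta> = "\<lambda>x. x \<ominus>\<^bsub>?Y\<^esub> \<alpha> (\<beta> x)"
  have \<delta>: "?\<delta> \<in> mod_hom R ?Y ?Y"
    by (intro mod_hom_sub Ym mod_hom_id mod_hom_compose[OF \<beta>(1) \<alpha>(1)])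
  have cl: "\<alpha> x \<in> carrier ?Y" if "x \<in> carrier ?X" for x by (rule mod_homD(1)[OF \<alpha>(1) that])
  have cl': "\<beta> x \<in> carrier ?X" if "x \<in> carrier ?Y" for x by (rule mod_homD(1)[OF \<beta>(1) that])
  have cl'': "\<chi> x \<in> carrier I" if "x \<in> carrier ?Y" for x by (rule mod_homD(1)[OF \<chi>(1) that])
  have "a_kernel ?Y I \<chi> = \<alpha> ` a_kernel ?X I \<psi> <+>\<^bsub>?Y\<^esub> ?\<delta> ` carrier ?Y"
  proof (intro equalityI subsetI)
    fix x assume "x \<in> a_kernel ?Y I \<chi>"
    then have x: "x \<in> carrier ?Y" "\<chi> x = \<zero>\<^bsub>I\<^esub>" by (auto simp: a_kernel_eq)
    then have "\<beta> x \<in> a_kernel ?X I \<psi>" by (simp add: a_kernel_eq \<psi>\<beta> cl')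
    moreover have "x = \<alpha> (\<beta> x) \<oplus>\<^bsub>?Y\<^esub> ?\<delta> x"
      using x(1) cl cl' by (simp add: a_minus_def Y.M.a_lcomm Y.M.r_neg)
    ultimately show "x \<in> \<alpha> ` a_kernel ?X I \<psi> <+>\<^bsub>?Y\<^esub> ?\<delta> ` carrier ?Y"
      using x(1) by (intro set_addI[OF imageI imageI])
  next
    fix z assume "z \<in> \<alpha> ` a_kernel ?X I \<psi> <+>\<^bsub>?Y\<^esub> ?\<delta> ` carrier ?Y"
    then obtain x y where x: "x \<in> carrier ?X" "\<psi> x = \<zero>\<^bsub>I\<^esub>" and y: "y \<in> carrier ?Y"
      and z: "z = \<alpha> x \<oplus>\<^bsub>?Y\<^esub> ?\<delta> y" by (auto simp: mem_set_add a_kernel_eq)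
    have "\<chi> z = \<zero>\<^bsub>I\<^esub>"
      using x y unfolding z
      by (simp add: mod_homD(2)[OF \<chi>(1)] cl cl' mod_hom_diff[OF Ym I \<chi>(1)] \<chi>\<alpha> \<psi>\<beta> cl'')
         (simp add: a_minus_def I.M.r_neg cl'')
    moreover have "z \<in> carrier ?Y" unfolding z using x y by (simp add: cl cl')
    ultimately show "z \<in> a_kernel ?Y I \<chi>" by (simp add: a_kernel_eq)
  qed
  \<comment> \<open>Finiteness of \<open>Y\<close> enters through the second summand, the image of a
    free module of finite rank.\<close>
  then show ?thesis
    using Y.fg_sub_set_add[OF fg_sub_image[OF X Ym \<alpha>(1) fg]
        fg_sub_image[OF Ym Ym \<delta> fg_sub_free_module[OF r subset_refl Y]]] by simp
qed

text \<open>Cover \<open>K\<close> by some \<psi> from \<open>R^n\<close>. Then \<theta> after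
  \<psi> maps \<open>R^n\<close> onto a finitely generated left ideal \<open>I\<close>, which
  coherence makes finitely presented. Schanuel's lemma moves finite generation of relations from the
  presentation so obtained to this particular cover, and \<psi> maps the kernel of the composite
  onto the kernel of \<theta> in \<open>K\<close>.\<close>

lemma left_coherent_functional:
  assumes coh: "left_coherent R" and M: "left_module R M" and fg: "fg_sub R M K"
    and \<theta>: "\<theta> \<in> mod_hom R M (regular_module R)"
  shows "fg_sub R M {x \<in> K. \<theta> x = \<zero>\<^bsub>R\<^esub>}"
proof -
  interpret M: left_module R M by fact
  note r = M.R.ring_axioms
  have RR: "left_module R (regular_module R)" by (rule left_module_regular[OF r])
  interpret RR: left_module R "regular_module R" by (rule RR)
  obtain n :: nat and \<psi> where \<psi>: "\<psi> \<in> mod_hom R (free_module R {..<n}) M" "\<psi> ` carrier (free_module R {..<n}) = K"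
    using fg unfolding fg_sub_iff_image[OF M] by (elim exE bexE)
  let ?F = "free_module R {..<n}"
  have F: "left_module R ?F" by (rule left_module_free_module[OF r])
  let ?\<chi> = "\<lambda>c. \<theta> (\<psi> c)"
  have \<chi>: "?\<chi> \<in> mod_hom R ?F (regular_module R)" by (rule mod_hom_compose[OF \<psi>(1) \<theta>])
  define I where "I = ?\<chi> ` carrier ?F"
  let ?I = "(regular_module R)\<lparr>carrier := I\<rparr>"
  have I: "submodule I R (regular_module R)"
    unfolding I_def by (rule submodule_image[OF F RR \<chi> left_module.submodule_carrier[OF F]])
  have Im: "left_module R ?I" by (rule RR.left_module_submodule[OF I])
  have \<chi>': "?\<chi> \<in> mod_hom R ?F ?I"
    using mod_hom_subset[OF \<chi> subset_refl, of I] by (simp add: I_def)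
  have "finitely_generated R ?I"
    unfolding finitely_generated_def using Im \<chi>' by (auto simp: I_def intro!: exI[of _ n] bexI[of _ ?\<chi>])
  then have "finitely_presented R ?I" using coh I by (simp add: left_coherent_def)
  then obtain m k :: nat and \<phi> \<psi>' where *:
    "\<phi> \<in> mod_hom R (free_module R {..<m}) (free_module R {..<k})"
    "\<psi>' \<in> mod_hom R (free_module R {..<k}) ?I"
    "\<phi> ` carrier (free_module R {..<m}) = a_kernel (free_module R {..<k}) ?I \<psi>'"
    "\<psi>' ` carrier (free_module R {..<k}) = carrier ?I"
    unfolding finitely_presented_def by (elim conjE exE bexE) (rule that)
  have "fg_sub R (free_module R {..<k}) (a_kernel (free_module R {..<k}) ?I \<psi>')"
    using *(1,3) fg_sub_iff_image[OF left_module_free_module[OF r]] by blast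
  then have "fg_sub R ?F (a_kernel ?F ?I ?\<chi>)"
    by (intro schanuel_fg[OF Im _ *(2,4) \<chi>']) (auto simp: I_def)
  then have "fg_sub R M (\<psi> ` a_kernel ?F ?I ?\<chi>)" by (rule fg_sub_image[OF F M \<psi>(1)])
  moreover have "\<psi> ` a_kernel ?F ?I ?\<chi> = {x \<in> K. \<theta> x = \<zero>\<^bsub>R\<^esub>}"
    using \<psi>(2) by (auto simp: a_kernel_eq regular_module_def)
  ultimately show ?thesis by simp
qed

text \<open>Cutting by one functional leaves a finitely generated submodule, so the next one can be
  applied to the result.\<close>

lemma left_coherent_functionals:
  assumes coh: "left_coherent R" and M: "left_module R M" and fg: "fg_sub R M K" and "finite \<Theta>"
    and "\<And>\<theta>. \<theta> \<in> \<Theta> \<Longrightarrow> \<theta> \<in> mod_hom R M (regular_module R)"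
  shows "fg_sub R M {x \<in> K. \<forall>\<theta>\<in>\<Theta>. \<theta> x = \<zero>\<^bsub>R\<^esub>}"
  using assms(4,5)
proof (induction \<Theta> rule: finite_induct)
  case empty
  then show ?case using fg by simp
next
  case (insert \<theta> \<Theta>)
  have "{x \<in> K. \<forall>\<theta>'\<in>insert \<theta> \<Theta>. \<theta>' x = \<zero>\<^bsub>R\<^esub>} = {x \<in> {x \<in> K. \<forall>\<theta>\<in>\<Theta>. \<theta> x = \<zero>\<^bsub>R\<^esub>}. \<theta> x = \<zero>\<^bsub>R\<^esub>}" by auto
  then show ?case using left_coherent_functional[OF coh M insert.IH] insert.prems by simp
qed


section \<open>Finitely presented steps\<close>

text \<open>The quotient \<open>D' / D\<close> is finitely presented.\<close>

definition fp_over :: "('r, 'x) ring_scheme \<Rightarrow> ('r, 'm) module \<Rightarrow> 'm set \<Rightarrow> 'm set \<Rightarrow> bool" where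
  "fp_over R M D D' \<longleftrightarrow>
     (\<exists>n::nat. \<exists>\<psi> \<in> mod_hom R (free_module R {..<n}) M.
        D' = D <+>\<^bsub>M\<^esub> \<psi> ` carrier (free_module R {..<n}) \<and>
        fg_sub R (free_module R {..<n}) {c \<in> carrier (free_module R {..<n}). \<psi> c \<in> D})"

lemma fp_over_subset:
  assumes "left_module R M" "submodule D R M" "fp_over R M D D'"
  shows "D \<subseteq> D'"
proof
  interpret M: left_module R M by fact
  fix x assume x: "x \<in> D"
  obtain n :: nat and \<psi> where \<psi>: "\<psi> \<in> mod_hom R (free_module R {..<n}) M"
    "D' = D <+>\<^bsub>M\<^esub> \<psi> ` carrier (free_module R {..<n})" using assms(3) by (auto simp: fp_over_def)
  have F: "left_module R (free_module R {..<n})" by (rule left_module_free_module[OF M.R.ring_axioms])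
  have "\<zero>\<^bsub>M\<^esub> \<in> \<psi> ` carrier (free_module R {..<n})"
    using mod_hom_zero[OF F assms(1) \<psi>(1)] left_module.submoduleD(3)[OF F left_module.submodule_carrier[OF F]]
    by (metis imageI)
  then show "x \<in> D'" unfolding \<psi>(2) mem_set_add using x M.submoduleD(2)[OF assms(2)]
    by (intro bexI[of _ x] bexI[of _ "\<zero>\<^bsub>M\<^esub>"]) auto
qed

text \<open>A quotient of a finitely presented module by a finitely generated one is finitely presented.\<close>

lemma fp_over_intermediate:
  assumes M: "left_module R M" and D: "submodule D R M"
    and fp1: "fp_over R M D D1" and fp2: "fp_over R M D D2" and sub: "D1 \<subseteq> D2"
  shows "fp_over R M D1 D2"
proof -
  interpret M: left_module R M by fact
  note r = M.R.ring_axioms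
  obtain n :: nat and \<psi> where \<psi>: "\<psi> \<in> mod_hom R (free_module R {..<n}) M"
    "D2 = D <+>\<^bsub>M\<^esub> \<psi> ` carrier (free_module R {..<n})"
    "fg_sub R (free_module R {..<n}) {c \<in> carrier (free_module R {..<n}). \<psi> c \<in> D}"
    using fp2 by (auto simp: fp_over_def)
  obtain m :: nat and \<chi> where \<chi>: "\<chi> \<in> mod_hom R (free_module R {..<m}) M"
    "D1 = D <+>\<^bsub>M\<^esub> \<chi> ` carrier (free_module R {..<m})"
    using fp1 by (auto simp: fp_over_def)
  let ?F = "free_module R {..<n}" and ?G = "free_module R {..<m}"
  have F: "left_module R ?F" and G: "left_module R ?G" by (rule left_module_free_module[OF r])+
  interpret F: left_module R ?F by (rule F)
  interpret G: left_module R ?G by (rule G)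
  note d = M.submoduleD[OF D] and \<psi>c = mod_homD(1)[OF \<psi>(1)] and \<chi>c = mod_homD(1)[OF \<chi>(1)]
  have im: "submodule (\<chi> ` carrier ?G) R M" by (rule submodule_image[OF G M \<chi>(1) G.submodule_carrier])
  have D1: "submodule D1 R M" unfolding \<chi>(2) by (rule M.submodule_set_add[OF D im])
  note d1 = M.submoduleD[OF D1]
  have DD1: "D \<subseteq> D1" by (rule fp_over_subset[OF M D fp1])
  have \<chi>1: "\<chi> a \<in> D1" if "a \<in> carrier ?G" for a
    unfolding \<chi>(2) mem_set_add using that \<chi>c d(3) by (intro bexI[of _ "\<zero>\<^bsub>M\<^esub>"] bexI[of _ "\<chi> a"]) auto
  \<comment> \<open>Since \<open>D1\<close> lies in \<open>D2\<close>, each generator of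
    \<open>D1\<close> modulo \<open>D\<close> agrees modulo \<open>D\<close> with some \<psi> value.
    The choices define \<tau>, through which \<chi> factors modulo \<open>D\<close>.\<close>
  have "\<forall>i\<in>{..<m}. \<exists>c\<in>carrier ?F. \<chi> (unit_vec R i) \<ominus>\<^bsub>M\<^esub> \<psi> c \<in> D"
  proof
    fix i assume "i \<in> {..<m}"
    then have u: "unit_vec R i \<in> carrier ?G" by (rule unit_vec_closed[OF r])
    then have "\<chi> (unit_vec R i) \<in> D2" using \<chi>1 sub by auto
    then obtain x c where "x \<in> D" "c \<in> carrier ?F" "\<chi> (unit_vec R i) = x \<oplus>\<^bsub>M\<^esub> \<psi> c"
      by (auto simp: \<psi>(2) mem_set_add)
    then show "\<exists>c\<in>carrier ?F. \<chi> (unit_vec R i) \<ominus>\<^bsub>M\<^esub> \<psi> c \<in> D"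
      using \<psi>c d(2) by (intro bexI[of _ c]) (auto simp: a_minus_def M.M.a_assoc M.M.r_neg)
  qed
  then obtain t where t: "\<And>i. i \<in> {..<m} \<Longrightarrow> t i \<in> carrier ?F"
    "\<And>i. i \<in> {..<m} \<Longrightarrow> \<chi> (unit_vec R i) \<ominus>\<^bsub>M\<^esub> \<psi> (t i) \<in> D" by metis
  obtain \<tau> where \<tau>: "\<tau> \<in> mod_hom R ?G ?F" "\<And>i. i \<in> {..<m} \<Longrightarrow> \<tau> (unit_vec R i) = t i"
    using free_module_lift[OF F, of "{..<m}" t] t(1) by auto
  note \<tau>c = mod_homD(1)[OF \<tau>(1)]
  have \<tau>D: "\<chi> a \<ominus>\<^bsub>M\<^esub> \<psi> (\<tau> a) \<in> D" if "a \<in> carrier ?G" for a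
    by (rule free_module_hom_in[OF M mod_hom_sub[OF M \<chi>(1) mod_hom_compose[OF \<tau>(1) \<psi>(1)]] D _ that])
      (simp add: \<tau>(2) t(2))
  \<comment> \<open>The relations modulo \<open>D1\<close> are the old relations modulo
    \<open>D\<close> together with the vectors that express the generators of \<open>D1\<close>;
    both parts are finitely generated.\<close>
  have "{c \<in> carrier ?F. \<psi> c \<in> D1} = {c \<in> carrier ?F. \<psi> c \<in> D} <+>\<^bsub>?F\<^esub> \<tau> ` carrier ?G"
  proof (intro equalityI subsetI)
    fix c assume "c \<in> {c \<in> carrier ?F. \<psi> c \<in> D1}"
    then obtain x a where c: "c \<in> carrier ?F" "x \<in> D" "a \<in> carrier ?G" "\<psi> c = x \<oplus>\<^bsub>M\<^esub> \<chi> a"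
      by (auto simp: \<chi>(2) mem_set_add)
    have "\<psi> (c \<ominus>\<^bsub>?F\<^esub> \<tau> a) = \<psi> c \<ominus>\<^bsub>M\<^esub> \<psi> (\<tau> a)" by (rule mod_hom_diff[OF F M \<psi>(1) c(1) \<tau>c[OF c(3)]])
    also have "\<dots> = x \<oplus>\<^bsub>M\<^esub> (\<chi> a \<ominus>\<^bsub>M\<^esub> \<psi> (\<tau> a))"
      using c d(2) \<psi>c \<chi>c \<tau>c by (simp add: a_minus_def M.M.a_assoc)
    also have "\<dots> \<in> D" using \<tau>D[OF c(3)] c(2) d(4) by simp
    finally have "c \<ominus>\<^bsub>?F\<^esub> \<tau> a \<in> {c \<in> carrier ?F. \<psi> c \<in> D}" using c \<tau>c by simp
    moreover have "c = (c \<ominus>\<^bsub>?F\<^esub> \<tau> a) \<oplus>\<^bsub>?F\<^esub> \<tau> a"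
      using c \<tau>c by (simp add: a_minus_def F.M.a_assoc F.M.l_neg)
    ultimately show "c \<in> {c \<in> carrier ?F. \<psi> c \<in> D} <+>\<^bsub>?F\<^esub> \<tau> ` carrier ?G"
      by (rule set_addI[OF _ imageI[OF c(3)]])
  next
    fix z assume "z \<in> {c \<in> carrier ?F. \<psi> c \<in> D} <+>\<^bsub>?F\<^esub> \<tau> ` carrier ?G"
    then obtain c a where z: "c \<in> carrier ?F" "\<psi> c \<in> D" "a \<in> carrier ?G" "z = c \<oplus>\<^bsub>?F\<^esub> \<tau> a"
      by (auto simp: mem_set_add)
    have "\<psi> (\<tau> a) = \<chi> a \<ominus>\<^bsub>M\<^esub> (\<chi> a \<ominus>\<^bsub>M\<^esub> \<psi> (\<tau> a))"
      using z \<psi>c \<chi>c \<tau>c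
      by (simp add: a_minus_def M.M.minus_add M.M.r_neg M.M.a_assoc[symmetric])
    also have "\<dots> \<in> D1" using \<chi>1[OF z(3)] \<tau>D[OF z(3)] DD1 d1(7) by auto
    finally show "z \<in> {c \<in> carrier ?F. \<psi> c \<in> D1}"
      using z \<tau>c DD1 d1(4) by (auto simp: mod_homD(2)[OF \<psi>(1)])
  qed
  moreover have "fg_sub R ?F (\<tau> ` carrier ?G)"
    by (rule fg_sub_image[OF G F \<tau>(1) fg_sub_free_module[OF r subset_refl]]) simp
  ultimately have fg: "fg_sub R ?F {c \<in> carrier ?F. \<psi> c \<in> D1}"
    using F.fg_sub_set_add[OF \<psi>(3)] by simp
  have "D2 = D1 <+>\<^bsub>M\<^esub> \<psi> ` carrier ?F"
  proof
    show "D2 \<subseteq> D1 <+>\<^bsub>M\<^esub> \<psi> ` carrier ?F" unfolding \<psi>(2) using DD1 unfolding mem_set_add subset_iff by blast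
    have "submodule D2 R M"
      unfolding \<psi>(2) by (intro M.submodule_set_add D submodule_image[OF F M \<psi>(1) F.submodule_carrier])
    note d2 = M.submoduleD[OF this]
    have "\<psi> c \<in> D2" if "c \<in> carrier ?F" for c
      unfolding \<psi>(2) mem_set_add using that \<psi>c d(3) by (intro bexI[of _ "\<zero>\<^bsub>M\<^esub>"] bexI[of _ "\<psi> c"]) auto
    then show "D1 <+>\<^bsub>M\<^esub> \<psi> ` carrier ?F \<subseteq> D2" using sub d2(4) by (auto simp: mem_set_add subset_iff)
  qed
  then show ?thesis unfolding fp_over_def using \<psi>(1) fg by blast
qed

text \<open>The same generators work after composition with \<open>e\<close>; injectivity ensures
  that no new relations arise.\<close>

lemma fp_over_image:
  assumes M: "left_module R M" and N: "left_module R N" and e: "e \<in> mod_hom R M N"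
    and inj: "inj_on e (carrier M)" and D: "submodule D R M" and fp: "fp_over R M D D'"
  shows "fp_over R N (e ` D) (e ` D')"
proof -
  interpret M: left_module R M by fact
  obtain n :: nat and \<psi> where \<psi>: "\<psi> \<in> mod_hom R (free_module R {..<n}) M"
    "D' = D <+>\<^bsub>M\<^esub> \<psi> ` carrier (free_module R {..<n})"
    "fg_sub R (free_module R {..<n}) {c \<in> carrier (free_module R {..<n}). \<psi> c \<in> D}"
    using fp by (auto simp: fp_over_def)
  let ?F = "free_module R {..<n}"
  note \<psi>c = mod_homD(1)[OF \<psi>(1)]
  have "e (x \<oplus>\<^bsub>M\<^esub> \<psi> c) = e x \<oplus>\<^bsub>N\<^esub> e (\<psi> c)" if "x \<in> D" "c \<in> carrier ?F" for x c
    using mod_homD(2)[OF e M.submoduleD(2)[OF D that(1)] \<psi>c[OF that(2)]] .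
  then have "e ` D' = e ` D <+>\<^bsub>N\<^esub> (\<lambda>c. e (\<psi> c)) ` carrier ?F"
    unfolding \<psi>(2) set_add_def' by (auto simp: image_iff) metis+
  moreover have "{c \<in> carrier ?F. e (\<psi> c) \<in> e ` D} = {c \<in> carrier ?F. \<psi> c \<in> D}"
    using inj_on_image_mem_iff[OF inj \<psi>c M.submoduleD(1)[OF D]] by auto
  ultimately show ?thesis unfolding fp_over_def
    using \<psi>(3) mod_hom_compose[OF \<psi>(1) e] by (intro exI[of _ n] bexI[of _ "\<lambda>c. e (\<psi> c)"]) auto
qed

lemma fp_over_subcarrier:
  assumes M: "left_module R M" and H: "submodule H R M" and D: "submodule D R M"
    and fp: "fp_over R M D D'" and sub: "D' \<subseteq> H"
  shows "fp_over R (M\<lparr>carrier := H\<rparr>) D D'"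
proof -
  interpret M: left_module R M by fact
  obtain n :: nat and \<psi> where \<psi>: "\<psi> \<in> mod_hom R (free_module R {..<n}) M"
    "D' = D <+>\<^bsub>M\<^esub> \<psi> ` carrier (free_module R {..<n})"
    "fg_sub R (free_module R {..<n}) {c \<in> carrier (free_module R {..<n}). \<psi> c \<in> D}"
    using fp by (auto simp: fp_over_def)
  let ?F = "free_module R {..<n}"
  note \<psi>c = mod_homD(1)[OF \<psi>(1)]
  have "\<psi> c \<in> D'" if "c \<in> carrier ?F" for c
    unfolding \<psi>(2) mem_set_add using that \<psi>c M.submoduleD(3)[OF D] by (intro bexI[of _ "\<zero>\<^bsub>M\<^esub>"] bexI[of _ "\<psi> c"]) auto
  then have "\<psi> \<in> mod_hom R ?F (M\<lparr>carrier := H\<rparr>)"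
    using mod_hom_subset[OF \<psi>(1) subset_refl, of H] sub by auto
  then show ?thesis unfolding fp_over_def using \<psi>(2,3) by (auto simp: set_add_def')
qed

text \<open>As \<open>g\<close> is onto, it induces an isomorphism between the quotient of the
  preimages and \<open>D' / D\<close>. Concretely, the generators are lifted through
  \<open>g\<close> and keep their relations. This pulls a filtration of a module back to any module
  covering it.\<close>

lemma fp_over_vimage:
  assumes E: "left_module R E" and M: "left_module R M" and g: "g \<in> mod_hom R E M"
    and surj: "g ` carrier E = carrier M" and D: "submodule D R M" and fp: "fp_over R M D D'"
  shows "fp_over R E {x \<in> carrier E. g x \<in> D} {x \<in> carrier E. g x \<in> D'}"
proof -
  interpret M: left_module R M by fact
  interpret E: left_module R E by fact
  note r = M.R.ring_axioms
  obtain n :: nat and \<psi> where \<psi>: "\<psi> \<in> mod_hom R (free_module R {..<n}) M"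
    "D' = D <+>\<^bsub>M\<^esub> \<psi> ` carrier (free_module R {..<n})"
    "fg_sub R (free_module R {..<n}) {c \<in> carrier (free_module R {..<n}). \<psi> c \<in> D}"
    using fp by (auto simp: fp_over_def)
  let ?F = "free_module R {..<n}"
  note \<psi>c = mod_homD(1)[OF \<psi>(1)]
  have F: "left_module R ?F" by (rule left_module_free_module[OF r])
  have "\<forall>i\<in>{..<n}. \<exists>y\<in>carrier E. g y = \<psi> (unit_vec R i)"
    using surj \<psi>c[OF unit_vec_closed[OF r]] by (metis imageE)
  then obtain t where t: "\<And>i. i \<in> {..<n} \<Longrightarrow> t i \<in> carrier E" "\<And>i. i \<in> {..<n} \<Longrightarrow> g (t i) = \<psi> (unit_vec R i)"
    by metis
  obtain \<tau> where \<tau>: "\<tau> \<in> mod_hom R ?F E" "\<And>i. i \<in> {..<n} \<Longrightarrow> \<tau> (unit_vec R i) = t i"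
    using free_module_lift[OF E, of "{..<n}" t] t(1) by auto
  note \<tau>c = mod_homD(1)[OF \<tau>(1)]
  have g\<tau>: "g (\<tau> c) = \<psi> c" if "c \<in> carrier ?F" for c
    by (rule free_module_hom_eq[OF r M mod_hom_compose[OF \<tau>(1) g] \<psi>(1) _ that]) (simp add: \<tau>(2) t(2))
  have "{c \<in> carrier ?F. \<tau> c \<in> {x \<in> carrier E. g x \<in> D}} = {c \<in> carrier ?F. \<psi> c \<in> D}"
    using g\<tau> \<tau>c by auto
  moreover have "{x \<in> carrier E. g x \<in> D'} = {x \<in> carrier E. g x \<in> D} <+>\<^bsub>E\<^esub> \<tau> ` carrier ?F"
  proof (intro equalityI subsetI)
    fix x assume "x \<in> {x \<in> carrier E. g x \<in> D'}"
    then obtain y c where x: "x \<in> carrier E" "y \<in> D" "c \<in> carrier ?F" "g x = y \<oplus>\<^bsub>M\<^esub> \<psi> c"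
      by (auto simp: \<psi>(2) mem_set_add)
    have "g (x \<ominus>\<^bsub>E\<^esub> \<tau> c) = (y \<oplus>\<^bsub>M\<^esub> \<psi> c) \<ominus>\<^bsub>M\<^esub> \<psi> c"
      using mod_hom_diff[OF E M g x(1) \<tau>c[OF x(3)]] x(4) g\<tau>[OF x(3)] by simp
    also have "\<dots> = y"
      using M.submoduleD(2)[OF D x(2)] \<psi>c[OF x(3)] by (simp add: a_minus_def M.M.a_assoc M.M.r_neg)
    finally have "g (x \<ominus>\<^bsub>E\<^esub> \<tau> c) = y" .
    then have "x \<ominus>\<^bsub>E\<^esub> \<tau> c \<in> {x \<in> carrier E. g x \<in> D}" using x \<tau>c by simp
    moreover have "x = (x \<ominus>\<^bsub>E\<^esub> \<tau> c) \<oplus>\<^bsub>E\<^esub> \<tau> c"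
      using x \<tau>c by (simp add: a_minus_def E.M.a_assoc E.M.l_neg)
    ultimately show "x \<in> {x \<in> carrier E. g x \<in> D} <+>\<^bsub>E\<^esub> \<tau> ` carrier ?F"
      by (rule set_addI[OF _ imageI[OF x(3)]])
  next
    fix z assume "z \<in> {x \<in> carrier E. g x \<in> D} <+>\<^bsub>E\<^esub> \<tau> ` carrier ?F"
    then obtain x c where "x \<in> carrier E" "g x \<in> D" "c \<in> carrier ?F" "z = x \<oplus>\<^bsub>E\<^esub> \<tau> c"
      by (auto simp: mem_set_add)
    then show "z \<in> {x \<in> carrier E. g x \<in> D'}"
      by (auto simp: mod_homD(2)[OF g] \<tau>c g\<tau> \<psi>(2) mem_set_add)
  qed
  ultimately show ?thesis unfolding fp_over_def using \<psi>(3) \<tau>(1) by (intro exI[of _ n] bexI[of _ \<tau>]) auto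
qed

section \<open>Filtrations by chains of submodules\<close>

text \<open>A filtration of \<open>D\<close> is represented by the set of its members. Closure under unions of
  nonempty subsets and the existence of immediate successors force the set to be well-ordered
  by inclusion.\<close>

definition fp_chain :: "('r, 'x) ring_scheme \<Rightarrow> ('r, 'm) module \<Rightarrow> 'm set set \<Rightarrow> 'm set \<Rightarrow> bool" where
  "fp_chain R M \<T> D \<longleftrightarrow>
     {\<zero>\<^bsub>M\<^esub>} \<in> \<T> \<and> D \<in> \<T> \<and> (\<forall>X\<in>\<T>. submodule X R M \<and> X \<subseteq> D) \<and>
     (\<forall>X\<in>\<T>. \<forall>Y\<in>\<T>. X \<subseteq> Y \<or> Y \<subseteq> X) \<and>
     (\<forall>\<U>. \<U> \<subseteq> \<T> \<longrightarrow> \<U> \<noteq> {} \<longrightarrow> \<Union>\<U> \<in> \<T>) \<and>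
     (\<forall>X\<in>\<T>. X \<noteq> D \<longrightarrow>
        (\<exists>X'\<in>\<T>. X \<subset> X' \<and> fp_over R M X X' \<and> (\<forall>Y\<in>\<T>. X \<subset> Y \<longrightarrow> X' \<subseteq> Y)))"

lemma fp_chainD:
  assumes "fp_chain R M \<T> D"
  shows "{\<zero>\<^bsub>M\<^esub>} \<in> \<T>" "D \<in> \<T>" "\<And>X. X \<in> \<T> \<Longrightarrow> submodule X R M" "\<And>X. X \<in> \<T> \<Longrightarrow> X \<subseteq> D"
    "\<And>X Y. X \<in> \<T> \<Longrightarrow> Y \<in> \<T> \<Longrightarrow> X \<subseteq> Y \<or> Y \<subseteq> X"
    "\<And>\<U>. \<U> \<subseteq> \<T> \<Longrightarrow> \<U> \<noteq> {} \<Longrightarrow> \<Union>\<U> \<in> \<T>"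
    "\<And>X. X \<in> \<T> \<Longrightarrow> X \<noteq> D \<Longrightarrow>
       \<exists>X'\<in>\<T>. X \<subset> X' \<and> fp_over R M X X' \<and> (\<forall>Y\<in>\<T>. X \<subset> Y \<longrightarrow> X' \<subseteq> Y)"
proof -
  note a = assms[unfolded fp_chain_def]
  show "{\<zero>\<^bsub>M\<^esub>} \<in> \<T>" "D \<in> \<T>" using a by simp_all
  note b = a[THEN conjunct2, THEN conjunct2]
  show "\<And>X. X \<in> \<T> \<Longrightarrow> submodule X R M" "\<And>X. X \<in> \<T> \<Longrightarrow> X \<subseteq> D" using b[THEN conjunct1] by simp_all
  note c = b[THEN conjunct2]
  show "\<And>X Y. X \<in> \<T> \<Longrightarrow> Y \<in> \<T> \<Longrightarrow> X \<subseteq> Y \<or> Y \<subseteq> X" using c[THEN conjunct1] by simp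
  note d = c[THEN conjunct2]
  show "\<And>\<U>. \<U> \<subseteq> \<T> \<Longrightarrow> \<U> \<noteq> {} \<Longrightarrow> \<Union>\<U> \<in> \<T>" using d[THEN conjunct1] by simp
  show "\<And>X. X \<in> \<T> \<Longrightarrow> X \<noteq> D \<Longrightarrow>
       \<exists>X'\<in>\<T>. X \<subset> X' \<and> fp_over R M X X' \<and> (\<forall>Y\<in>\<T>. X \<subset> Y \<longrightarrow> X' \<subseteq> Y)"
    using d[THEN conjunct2] by simp
qed

lemma fp_chain_trivial:
  assumes "left_module R M"
  shows "fp_chain R M {{\<zero>\<^bsub>M\<^esub>}} {\<zero>\<^bsub>M\<^esub>}"
  using left_module.submodule_zero[OF assms] by (auto simp: fp_chain_def subset_singleton_iff)

text \<open>Let \<open>U\<close> be the union of all strict lower bounds of \<open>\<S>\<close>;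
  there is at least one, the zero submodule. Without a least element \<open>U\<close> is itself a
  strict lower bound, and so is its immediate successor, which would then be contained in
  \<open>U\<close>.\<close>

lemma fp_chain_least:
  assumes T: "fp_chain R M \<T> D" and S: "\<S> \<subseteq> \<T>" "\<S> \<noteq> {}"
  shows "\<exists>X\<in>\<S>. \<forall>Y\<in>\<S>. X \<subseteq> Y"
proof (rule ccontr)
  assume no: "\<not> ?thesis"
  note t = fp_chainD[OF T]
  define L where "L = {X \<in> \<T>. \<forall>Y\<in>\<S>. X \<subset> Y}"
  define U where "U = \<Union>L"
  have "\<zero>\<^bsub>M\<^esub> \<in> Y" if "Y \<in> \<T>" for Y
    using t(3)[OF that] subgroup.one_closed[OF submodule.axioms(1)] by fastforce
  then have z: "{\<zero>\<^bsub>M\<^esub>} \<subseteq> Y" if "Y \<in> \<S>" for Y using that S(1) by auto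
  then have "{\<zero>\<^bsub>M\<^esub>} \<notin> \<S>" using no by blast
  then have "{\<zero>\<^bsub>M\<^esub>} \<subset> Y" if "Y \<in> \<S>" for Y using z[OF that] that by (metis psubsetI)
  then have "{\<zero>\<^bsub>M\<^esub>} \<in> L" using t(1) by (simp add: L_def)
  then have U: "U \<in> \<T>" unfolding U_def by (intro t(6)) (auto simp: L_def)
  have le: "U \<subseteq> Y" if "Y \<in> \<S>" for Y using that by (auto simp: U_def L_def)
  then have "U \<notin> \<S>" using no by blast
  then have less: "U \<subset> Y" if "Y \<in> \<S>" for Y using le[OF that] that by auto
  obtain Y where Y: "Y \<in> \<S>" using S by auto
  then have "U \<subset> Y" "Y \<subseteq> D" using less t(4)[of Y] S(1) by auto
  then have ne: "U \<noteq> D" by blast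
  obtain X' where X': "X' \<in> \<T>" "U \<subset> X'" "\<forall>Y\<in>\<T>. U \<subset> Y \<longrightarrow> X' \<subseteq> Y"
    using t(7)[OF U ne] by auto
  then have le': "X' \<subseteq> Y" if "Y \<in> \<S>" for Y using less[OF that] that S(1) by auto
  then have "X' \<notin> \<S>" using no by blast
  then have "X' \<in> L" using le' X'(1) by (auto simp: L_def)
  then have "X' \<subseteq> U" by (auto simp: U_def)
  then show False using X'(2) by blast
qed

text \<open>The stages are only known to be finitely presented over \<open>D\<close>;
  \<open>fp_over_intermediate\<close> turns this into finitely presented steps between stages. That
  all new members contain \<open>D\<close> makes the result an end extension, which is what survives
  unions of chains.\<close>

lemma fp_chain_extend_omega:
  fixes E :: "nat \<Rightarrow> 'm set"
  assumes T: "fp_chain R M \<T> D" and M: "left_module R M"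
    and E0: "E 0 = D" and mono: "mono E" and E: "\<And>k. submodule (E k) R M"
    and fp: "\<And>k. fp_over R M D (E k)"
  shows "\<exists>\<T>'. \<T> \<subseteq> \<T>' \<and> fp_chain R M \<T>' (\<Union>(range E)) \<and> (\<forall>X\<in>\<T>' - \<T>. D \<subseteq> X)"
proof (intro exI conjI ballI)
  interpret M: left_module R M by fact
  let ?D' = "\<Union>(range E)" and ?T = "\<T> \<union> range E \<union> {\<Union>(range E)}"
  note t = fp_chainD[OF T]
  have Emono: "j \<le> k \<Longrightarrow> E j \<subseteq> E k" for j k using mono by (auto simp: mono_def)
  have DE: "D \<subseteq> E k" for k using Emono[of 0 k] E0 by simp
  have sD': "submodule ?D' R M"
  proof (rule M.submodule_Union_chain)
    show "X \<subseteq> Y \<or> Y \<subseteq> X" if XY: "X \<in> range E" "Y \<in> range E" for X Y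
    proof -
      obtain j k where "X = E j" "Y = E k" using XY by auto
      then show ?thesis using Emono[of j k] Emono[of k j] nat_le_linear[of j k] by auto
    qed
  qed (use E in auto)
  show "\<T> \<subseteq> ?T" by auto
  show "D \<subseteq> X" if "X \<in> ?T - \<T>" for X using that DE by blast
  show "fp_chain R M ?T ?D'"
    unfolding fp_chain_def
  proof (intro conjI ballI allI impI)
    show "{\<zero>\<^bsub>M\<^esub>} \<in> ?T" "?D' \<in> ?T" using t(1) by auto
    show "submodule X R M" if "X \<in> ?T" for X using that t(3) E sD' by auto
    show "X \<subseteq> ?D'" if "X \<in> ?T" for X using that t(4) E0 by blast
  next
    fix X Y assume XY: "X \<in> ?T" "Y \<in> ?T"
    have lin: "E j \<subseteq> E k \<or> E k \<subseteq> E j" for j k using Emono[of j k] Emono[of k j] by linarith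
    have le: "Z \<subseteq> ?D'" if "Z \<in> ?T" for Z using that t(4) E0 by blast
    show "X \<subseteq> Y \<or> Y \<subseteq> X"
    proof (cases "X = ?D' \<or> Y = ?D'")
      case True
      then show ?thesis using le XY by blast
    next
      case False
      then consider "X \<in> \<T>" "Y \<in> \<T>" | j where "X \<in> \<T>" "Y = E j" | j where "X = E j" "Y \<in> \<T>"
        | j k where "X = E j" "Y = E k" using XY by blast
      then show ?thesis
      proof cases
        case 2
        then show ?thesis using t(4) DE by blast
      next
        case 3
        then show ?thesis using t(4) DE by blast
      qed (use t(5) lin in auto)
    qed
  next
    fix \<U> assume U: "\<U> \<subseteq> ?T" "\<U> \<noteq> {}"
    show "\<Union>\<U> \<in> ?T"
    proof (cases "\<U> \<subseteq> \<T>")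
      case True
      then show ?thesis using t(6) U by auto
    next
      case nT: False
      show ?thesis
      proof (cases "?D' \<in> \<U>")
        case True
        then have "\<Union>\<U> = ?D'" using U t(4) E0 by blast
        then show ?thesis by simp
      next
        case False
        \<comment> \<open>Members of the old chain lie below every \<open>E k\<close> and can be
          ignored. A finite set of indices has a maximum, an infinite one is cofinal and yields the
          whole union.\<close>
        let ?K = "{k. E k \<in> \<U>}"
        have "?K \<noteq> {}" using nT False U by blast
        have eq: "\<Union>\<U> = (\<Union>k\<in>?K. E k)"
        proof (intro equalityI subsetI)
          fix x assume "x \<in> \<Union>\<U>"
          then obtain X where X: "X \<in> \<U>" "x \<in> X" by auto
          show "x \<in> (\<Union>k\<in>?K. E k)"
          proof (cases "X \<in> range E")
            case True
            then show ?thesis using X by auto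
          next
            case False
            then have "X \<subseteq> D" using X U \<open>?D' \<notin> \<U>\<close> t(4) by blast
            then show ?thesis using X(2) DE \<open>?K \<noteq> {}\<close> by blast
          qed
        qed auto
        show ?thesis
        proof (cases "finite ?K")
          case True
          then have "(\<Union>k\<in>?K. E k) = E (Max ?K)"
            using \<open>?K \<noteq> {}\<close> Max_in[OF True \<open>?K \<noteq> {}\<close>] Emono Max_ge[OF True] by blast
          then show ?thesis unfolding eq by auto
        next
          case False
          have "(\<Union>k\<in>?K. E k) = ?D'"
          proof (intro equalityI subsetI)
            fix x assume "x \<in> ?D'"
            then obtain k where k: "x \<in> E k" by auto
            obtain j where "j \<in> ?K" "k \<le> j" using False by (metis infinite_nat_iff_unbounded_le)
            then show "x \<in> (\<Union>k\<in>?K. E k)" using k Emono by blast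
          qed auto
          then show ?thesis unfolding eq by auto
        qed
      qed
    qed
  next
    fix X assume X: "X \<in> ?T" "X \<noteq> ?D'"
    show "\<exists>X'\<in>?T. X \<subset> X' \<and> fp_over R M X X' \<and> (\<forall>Y\<in>?T. X \<subset> Y \<longrightarrow> X' \<subseteq> Y)"
    proof (cases "X \<in> \<T> \<and> X \<noteq> D")
      case True
      then obtain X' where X': "X' \<in> \<T>" "X \<subset> X'" "fp_over R M X X'" "\<forall>Y\<in>\<T>. X \<subset> Y \<longrightarrow> X' \<subseteq> Y"
        using t(7)[of X] by auto
      have "X' \<subseteq> Y" if "Y \<in> ?T" "X \<subset> Y" for Y
      proof (cases "Y \<in> \<T>")
        case False
        then have "D \<subseteq> Y" using that(1) DE by auto
        then show ?thesis using t(4)[OF X'(1)] by auto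
      qed (use X'(4) that in auto)
      then show ?thesis using X'(1-3) by (intro bexI[of _ X']) auto
    next
      case False
      then obtain k where k: "X = E k" using X E0 by blast
      have ex: "\<exists>j. \<not> E j \<subseteq> E k" using X(2) k by blast
      \<comment> \<open>The sequence \<open>E\<close> may repeat, so the successor of
        \<open>E k\<close> is the first stage that is really larger, not
        \<open>E (Suc k)\<close>.\<close>
      define j where "j = (LEAST j. \<not> E j \<subseteq> E k)"
      have j: "\<not> E j \<subseteq> E k" unfolding j_def by (rule LeastI_ex[OF ex])
      then have kj: "k \<le> j" using Emono[of j k] by (meson nat_le_linear)
      have small: "E i \<subseteq> E k" if "i < j" for i using not_less_Least[of i] that unfolding j_def by blast
      have "E j \<subseteq> Y" if "Y \<in> ?T" "X \<subset> Y" for Y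
      proof -
        have "Y \<notin> \<T>" using that(2) t(4)[of Y] DE[of k] k by auto
        then have "Y \<in> range E \<or> Y = ?D'" using that(1) by auto
        then consider i where "Y = E i" | "Y = ?D'" by (elim disjE rangeE) blast+
        then show ?thesis
        proof cases
          case 1
          then have "\<not> i < j" using small[of i] that(2) k by auto
          then show ?thesis using Emono[of j i] 1 by simp
        qed auto
      qed
      moreover have "fp_over R M (E k) (E j)"
        by (rule fp_over_intermediate[OF M t(3)[OF t(2)] fp fp Emono[OF kj]])
      moreover have "E k \<subset> E j" using j Emono[OF kj] by auto
      ultimately show ?thesis unfolding k by (intro bexI[of _ "E j"]) auto
    qed
  qed
qed

text \<open>The pairs are linearly ordered by end extension, so an immediate successor in one chain
  stays one in the union. The union of the tops is inserted because it may belong to none of the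
  chains.\<close>

lemma fp_chain_Union:
  assumes M: "left_module R M" and C: "C \<noteq> {}"
    and T: "\<And>\<T> D. (\<T>, D) \<in> C \<Longrightarrow> fp_chain R M \<T> D"
    and tot: "\<And>\<T> D \<T>' D'. (\<T>, D) \<in> C \<Longrightarrow> (\<T>', D') \<in> C \<Longrightarrow>
       \<T> \<subseteq> \<T>' \<and> D \<subseteq> D' \<and> (\<forall>X\<in>\<T>' - \<T>. D \<subseteq> X) \<or> \<T>' \<subseteq> \<T> \<and> D' \<subseteq> D \<and> (\<forall>X\<in>\<T> - \<T>'. D' \<subseteq> X)"
  shows "fp_chain R M (insert (\<Union>(snd ` C)) (\<Union>(fst ` C))) (\<Union>(snd ` C))"
proof -
  interpret M: left_module R M by fact
  let ?D = "\<Union>(snd ` C)" and ?T = "insert (\<Union>(snd ` C)) (\<Union>(fst ` C))"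
  \<comment> \<open>The whole use of end extension: whatever a chain lacks lies above its
    top.\<close>
  have mem: "X \<in> \<T> \<or> D \<subseteq> X" if TD: "(\<T>, D) \<in> C" "X \<in> ?T" for X \<T> D
  proof (cases "X = ?D")
    case True
    then show ?thesis using TD(1) by force
  next
    case False
    then have "X \<in> \<Union>(fst ` C)" using TD(2) by simp
    then obtain \<T>' D' where "(\<T>', D') \<in> C" "X \<in> \<T>'" by auto
    then show ?thesis using tot[OF TD(1), of \<T>' D'] by blast
  qed
  have sub: "X \<subseteq> ?D" if "X \<in> ?T" for X using that fp_chainD(4)[OF T] by fastforce
  have inT: "\<exists>\<T> D. (\<T>, D) \<in> C \<and> X \<in> \<T>" if "X \<in> ?T" "X \<noteq> ?D" for X using that by auto
  show ?thesis unfolding fp_chain_def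
  proof (intro conjI ballI allI impI)
    obtain \<T> D where "(\<T>, D) \<in> C" using C by auto
    then show "{\<zero>\<^bsub>M\<^esub>} \<in> ?T" using fp_chainD(1)[OF T] by (auto intro: bexI[of _ "(\<T>, D)"])
    show "?D \<in> ?T" by simp
    show "X \<subseteq> ?D" if "X \<in> ?T" for X by (rule sub[OF that])
    have "submodule ?D R M"
    proof (rule M.submodule_Union_chain)
      show "snd ` C \<noteq> {}" using C by simp
      show "submodule X R M" if "X \<in> snd ` C" for X using that fp_chainD(2,3)[OF T] by force
      show "X \<subseteq> Y \<or> Y \<subseteq> X" if XY: "X \<in> snd ` C" "Y \<in> snd ` C" for X Y
      proof -
        obtain \<T> \<T>' where "(\<T>, X) \<in> C" "(\<T>', Y) \<in> C" using XY by auto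
        then show ?thesis using tot[of \<T> X \<T>' Y] by auto
      qed
    qed
    then show "submodule X R M" if "X \<in> ?T" for X using that fp_chainD(3)[OF T] by auto
  next
    fix X Y assume XY: "X \<in> ?T" "Y \<in> ?T"
    show "X \<subseteq> Y \<or> Y \<subseteq> X"
    proof (cases "X = ?D")
      case True
      then show ?thesis using sub[OF XY(2)] by simp
    next
      case False
      then obtain \<T> D where TD: "(\<T>, D) \<in> C" "X \<in> \<T>" using inT[OF XY(1)] by auto
      show ?thesis
        using mem[OF TD(1) XY(2)] fp_chainD(4)[OF T[OF TD(1)], of X] fp_chainD(5)[OF T[OF TD(1)], of X Y] TD(2)
        by auto
    qed
  next
    fix \<U> assume U: "\<U> \<subseteq> ?T" "\<U> \<noteq> {}"
    show "\<Union>\<U> \<in> ?T"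
    proof (cases "\<exists>\<T> D. (\<T>, D) \<in> C \<and> \<U> \<subseteq> \<T>")
      case True
      then obtain \<T> D where TD: "(\<T>, D) \<in> C" "\<U> \<subseteq> \<T>" by blast
      then have "\<Union>\<U> \<in> \<T>" using fp_chainD(6)[OF T[OF TD(1)]] U(2) by blast
      then show ?thesis using TD(1) by force
    next
      case False
      \<comment> \<open>If no single chain contains all of \<open>\<U>\<close>, some member of
        \<open>\<U>\<close> lies outside the given chain and hence above its top. So the union of
        \<open>\<U>\<close> exceeds every top.\<close>
      have "D \<subseteq> \<Union>\<U>" if TD: "(\<T>, D) \<in> C" for \<T> D
      proof -
        obtain X where "X \<in> \<U>" "X \<notin> \<T>" using False TD by auto
        then have "D \<subseteq> X" using mem[OF TD subsetD[OF U(1)], of X] by auto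
        then show ?thesis using \<open>X \<in> \<U>\<close> by auto
      qed
      then have "?D \<subseteq> \<Union>\<U>" by fastforce
      moreover have "\<Union>\<U> \<subseteq> ?D" by (rule Union_least[OF sub[OF subsetD[OF U(1)]]])
      ultimately have "\<Union>\<U> = ?D" by blast
      then show ?thesis by simp
    qed
  next
    fix X assume X: "X \<in> ?T" "X \<noteq> ?D"
    have "\<exists>\<T> D. (\<T>, D) \<in> C \<and> X \<in> \<T> \<and> X \<noteq> D"
    proof -
      obtain \<T> D where TD: "(\<T>, D) \<in> C" "X \<in> \<T>" using inT[OF X] by auto
      show ?thesis
      proof (cases "X = D")
        case True
        \<comment> \<open>The top of a chain has no successor inside that chain. Since
          \<open>X\<close> is not the overall union, some other pair has a top not contained in
          \<open>X\<close>; its chain must be the longer one, so it contains \<open>X\<close> below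
          its own top.\<close>
        have "\<not> ?D \<subseteq> X" using X(2) sub[OF X(1)] by auto
        then have "\<exists>p\<in>C. \<not> snd p \<subseteq> X" by (auto simp: Sup_le_iff)
        then obtain \<T>' D' where TD': "(\<T>', D') \<in> C" "\<not> D' \<subseteq> X" by (elim bexE) (metis prod.collapse)
        then have "X \<in> \<T>'" using tot[OF TD(1) TD'(1)] TD(2) True by auto
        moreover have "X \<noteq> D'" using TD'(2) by auto
        ultimately show ?thesis using TD'(1) by auto
      qed (use TD in blast)
    qed
    then obtain \<T> D where TD: "(\<T>, D) \<in> C" "X \<in> \<T>" "X \<noteq> D" by blast
    then obtain X' where X': "X' \<in> \<T>" "X \<subset> X'" "fp_over R M X X'" "\<forall>Y\<in>\<T>. X \<subset> Y \<longrightarrow> X' \<subseteq> Y"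
      using fp_chainD(7)[OF T[OF TD(1)] TD(2,3)] by (elim bexE conjE) (rule that)
    have "X' \<subseteq> Y" if "Y \<in> ?T" "X \<subset> Y" for Y
      using mem[OF TD(1) that(1)] X'(4) that(2) fp_chainD(4)[OF T[OF TD(1)] X'(1)] by auto
    moreover have "X' \<in> ?T" using X'(1) TD(1) by force
    ultimately show "\<exists>X'\<in>?T. X \<subset> X' \<and> fp_over R M X X' \<and> (\<forall>Y\<in>?T. X \<subset> Y \<longrightarrow> X' \<subseteq> Y)"
      using X'(2,3) by (intro bexI[of _ X']) auto
  qed
qed

text \<open>An injective homomorphism preserves and reflects inclusions of members, so immediate
  successors go to immediate successors.\<close>

lemma fp_chain_image:
  assumes M: "left_module R M" and N: "left_module R N" and e: "e \<in> mod_hom R M N"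
    and inj: "inj_on e (carrier M)" and T: "fp_chain R M \<T> D"
  shows "fp_chain R N ((`) e ` \<T>) (e ` D)"
proof -
  interpret M: left_module R M by fact
  note t = fp_chainD[OF T]
  have c: "X \<subseteq> carrier M" if "X \<in> \<T>" for X using M.submoduleD(1)[OF t(3)[OF that]] .
  have sub: "e ` X \<subseteq> e ` Y \<longleftrightarrow> X \<subseteq> Y" if "X \<in> \<T>" "Y \<in> \<T>" for X Y
    using inv_into_image_cancel[OF inj c[OF that(1)]] inv_into_image_cancel[OF inj c[OF that(2)]]
    by (metis image_mono)
  then have psub: "e ` X \<subset> e ` Y \<longleftrightarrow> X \<subset> Y" if "X \<in> \<T>" "Y \<in> \<T>" for X Y using that by blast
  show ?thesis unfolding fp_chain_def
  proof (intro conjI ballI allI impI)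
    show "{\<zero>\<^bsub>N\<^esub>} \<in> (`) e ` \<T>" using t(1) mod_hom_zero[OF M N e] by force
    show "e ` D \<in> (`) e ` \<T>" using t(2) by simp
    show "submodule X R N" if "X \<in> (`) e ` \<T>" for X using that submodule_image[OF M N e t(3)] by auto
    show "X \<subseteq> e ` D" if "X \<in> (`) e ` \<T>" for X using that t(4) by auto
    show "X \<subseteq> Y \<or> Y \<subseteq> X" if XY: "X \<in> (`) e ` \<T>" "Y \<in> (`) e ` \<T>" for X Y
    proof -
      obtain X' Y' where "X' \<in> \<T>" "X = e ` X'" "Y' \<in> \<T>" "Y = e ` Y'" using XY by auto
      then show ?thesis using t(5)[of X' Y'] by auto
    qed
  next
    fix \<U> assume U: "\<U> \<subseteq> (`) e ` \<T>" "\<U> \<noteq> {}"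
    then obtain \<V> where V: "\<V> \<subseteq> \<T>" "\<U> = (`) e ` \<V>" by (meson subset_imageE)
    then have "\<Union>\<V> \<in> \<T>" using t(6) U(2) by blast
    moreover have "\<Union>\<U> = e ` \<Union>\<V>" unfolding V(2) by blast
    ultimately show "\<Union>\<U> \<in> (`) e ` \<T>" by simp
  next
    fix X assume "X \<in> (`) e ` \<T>" "X \<noteq> e ` D"
    then obtain Y where Y: "Y \<in> \<T>" "X = e ` Y" "Y \<noteq> D" by auto
    obtain Y' where Y': "Y' \<in> \<T>" "Y \<subset> Y'" "fp_over R M Y Y'" "\<forall>Z\<in>\<T>. Y \<subset> Z \<longrightarrow> Y' \<subseteq> Z"
      using t(7)[OF Y(1,3)] by (elim bexE conjE) (rule that)
    have "fp_over R N (e ` Y) (e ` Y')" by (rule fp_over_image[OF M N e inj t(3)[OF Y(1)] Y'(3)])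
    then show "\<exists>X'\<in>(`) e ` \<T>. X \<subset> X' \<and> fp_over R N X X' \<and> (\<forall>Z\<in>(`) e ` \<T>. X \<subset> Z \<longrightarrow> X' \<subseteq> Z)"
      using Y Y' psub sub by (intro bexI[of _ "e ` Y'"]) auto
  qed
qed

lemma fp_chain_subcarrier:
  assumes M: "left_module R M" and T: "fp_chain R M \<T> H"
  shows "fp_chain R (M\<lparr>carrier := H\<rparr>) \<T> H"
proof -
  interpret M: left_module R M by fact
  note t = fp_chainD[OF T]
  interpret H: left_module R "M\<lparr>carrier := H\<rparr>" by (rule M.left_module_submodule[OF t(3)[OF t(2)]])
  have "submodule X R (M\<lparr>carrier := H\<rparr>)" if "X \<in> \<T>" for X
    using M.submoduleD[OF t(3)[OF that]] t(4)[OF that] unfolding H.submodule_iff by simp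
  moreover have fp: "fp_over R (M\<lparr>carrier := H\<rparr>) X X'" if "X \<in> \<T>" "X' \<in> \<T>" "fp_over R M X X'" for X X'
    by (rule fp_over_subcarrier[OF M t(3)[OF t(2)] t(3)[OF that(1)] that(3) t(4)[OF that(2)]])
  ultimately show ?thesis unfolding fp_chain_def
  proof (intro conjI ballI allI impI)
    fix X assume X: "X \<in> \<T>" "X \<noteq> H"
    show "\<exists>X'\<in>\<T>. X \<subset> X' \<and> fp_over R (M\<lparr>carrier := H\<rparr>) X X' \<and> (\<forall>Y\<in>\<T>. X \<subset> Y \<longrightarrow> X' \<subseteq> Y)"
      using t(7)[OF X] fp[OF X(1)] by (elim bexE) (rule bexI, auto)
  qed (use t(1-6) in auto)
qed

section \<open>From filtrations to transfinite extensions\<close>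

lemma
  assumes M: "left_module R M" and H: "submodule H R M"
  shows left_module_quot: "left_module R (quot_module M H)"
    and quot_hom: "(\<lambda>x. H +>\<^bsub>M\<^esub> x) \<in> mod_hom R M (quot_module M H)"
    and quot_surj: "(\<lambda>x. H +>\<^bsub>M\<^esub> x) ` carrier M = carrier (quot_module M H)"
    and quot_eq_zero: "x \<in> carrier M \<Longrightarrow> H +>\<^bsub>M\<^esub> x = \<zero>\<^bsub>quot_module M H\<^esub> \<longleftrightarrow> x \<in> H"
proof -
  interpret M: left_module R M by fact
  interpret S: abelian_subgroup H M
    by (intro abelian_subgroupI3 additive_subgroup.intro submodule.axioms(1)[OF H] M.M.abelian_group_axioms)
  let ?Q = "quot_module M H"
  note h = M.submoduleD[OF H]
  have sel: "carrier ?Q = (\<lambda>x. H +>\<^bsub>M\<^esub> x) ` carrier M" "\<zero>\<^bsub>?Q\<^esub> = H"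
    "\<And>X Y. X \<oplus>\<^bsub>?Q\<^esub> Y = X <+>\<^bsub>M\<^esub> Y"
    by (auto simp: quot_module_def A_RCOSETS_def')
  have add: "(H +>\<^bsub>M\<^esub> x) \<oplus>\<^bsub>?Q\<^esub> (H +>\<^bsub>M\<^esub> y) = H +>\<^bsub>M\<^esub> (x \<oplus>\<^bsub>M\<^esub> y)"
    if "x \<in> carrier M" "y \<in> carrier M" for x y
    unfolding sel by (rule S.a_rcos_sum[OF that])
  have smult: "a \<odot>\<^bsub>?Q\<^esub> (H +>\<^bsub>M\<^esub> x) = H +>\<^bsub>M\<^esub> (a \<odot>\<^bsub>M\<^esub> x)"
    if a: "a \<in> carrier R" and x: "x \<in> carrier M" for a x
  proof -
    \<comment> \<open>Scalar multiplication on the quotient is defined as a union over all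
      representatives; each of them contributes the same coset.\<close>
    have "H +>\<^bsub>M\<^esub> (a \<odot>\<^bsub>M\<^esub> y) = H +>\<^bsub>M\<^esub> (a \<odot>\<^bsub>M\<^esub> x)" if y: "y \<in> H +>\<^bsub>M\<^esub> x" for y
    proof -
      obtain u where u: "u \<in> H" "y = u \<oplus>\<^bsub>M\<^esub> x" using y by (auto simp: a_r_coset_def')
      have "a \<odot>\<^bsub>M\<^esub> y = a \<odot>\<^bsub>M\<^esub> u \<oplus>\<^bsub>M\<^esub> a \<odot>\<^bsub>M\<^esub> x" using a x u h(2) by (simp add: M.smult_r_distr)
      then have "a \<odot>\<^bsub>M\<^esub> y \<in> H +>\<^bsub>M\<^esub> (a \<odot>\<^bsub>M\<^esub> x)" using h(5)[OF a u(1)] by (auto simp: a_r_coset_def')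
      then show ?thesis using S.a_repr_independence'[of "a \<odot>\<^bsub>M\<^esub> y" "a \<odot>\<^bsub>M\<^esub> x"] a x by simp
    qed
    then have "(\<Union>y\<in>H +>\<^bsub>M\<^esub> x. H +>\<^bsub>M\<^esub> (a \<odot>\<^bsub>M\<^esub> y)) = (\<Union>y\<in>H +>\<^bsub>M\<^esub> x. H +>\<^bsub>M\<^esub> (a \<odot>\<^bsub>M\<^esub> x))"
      by (intro SUP_cong refl)
    then show ?thesis using S.a_rcos_self[OF x] by (auto simp: quot_module_def)
  qed
  have z: "H = H +>\<^bsub>M\<^esub> \<zero>\<^bsub>M\<^esub>" using M.M.a_coset_add_zero[OF h(1)] by simp
  show "left_module R ?Q"
  proof (intro left_module.intro left_module_axioms.intro M.R.ring_axioms abelian_groupI)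
    fix X assume "X \<in> carrier ?Q"
    then obtain x where x: "x \<in> carrier M" "X = H +>\<^bsub>M\<^esub> x" by (auto simp: sel)
    show "\<exists>Y\<in>carrier ?Q. Y \<oplus>\<^bsub>?Q\<^esub> X = \<zero>\<^bsub>?Q\<^esub>"
      by (rule bexI[of _ "H +>\<^bsub>M\<^esub> (\<ominus>\<^bsub>M\<^esub> x)"]) (use x z in \<open>simp_all add: add M.M.l_neg sel(1,2)\<close>)
  next
    show "\<zero>\<^bsub>?Q\<^esub> \<in> carrier ?Q" unfolding sel by (rule image_eqI[where x = "\<zero>\<^bsub>M\<^esub>"]) (simp_all add: z[symmetric])
  next
    fix X assume "X \<in> carrier ?Q"
    then obtain x where x: "x \<in> carrier M" "X = H +>\<^bsub>M\<^esub> x" by (auto simp: sel)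
    then show "\<zero>\<^bsub>?Q\<^esub> \<oplus>\<^bsub>?Q\<^esub> X = X" using add[of "\<zero>\<^bsub>M\<^esub>" x] z by (simp add: sel(2))
  next
    fix X Y assume "X \<in> carrier ?Q" "Y \<in> carrier ?Q"
    then obtain x y where "x \<in> carrier M" "X = H +>\<^bsub>M\<^esub> x" "y \<in> carrier M" "Y = H +>\<^bsub>M\<^esub> y" by (auto simp: sel)
    then show "X \<oplus>\<^bsub>?Q\<^esub> Y \<in> carrier ?Q" "X \<oplus>\<^bsub>?Q\<^esub> Y = Y \<oplus>\<^bsub>?Q\<^esub> X"
      by (auto simp: add M.M.a_comm sel(1))
  qed (auto simp: sel(1) add smult M.M.a_assoc M.smult_l_distr M.smult_r_distr M.smult_assoc)
  show "(\<lambda>x. H +>\<^bsub>M\<^esub> x) \<in> mod_hom R M ?Q"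
    by (rule mod_homI) (simp_all add: add smult sel(1))
  show "(\<lambda>x. H +>\<^bsub>M\<^esub> x) ` carrier M = carrier ?Q" by (simp add: sel(1))
  show "H +>\<^bsub>M\<^esub> x = \<zero>\<^bsub>?Q\<^esub> \<longleftrightarrow> x \<in> H" if "x \<in> carrier M" for x
    unfolding sel using S.a_rcos_self[OF that] S.a_rcos_const[of x] by auto
qed

text \<open>The kernel of the composite from \<open>R^n\<close> to the quotient is the preimage of
  \<open>D\<close> under \<psi>. It is finitely generated, hence the image of some
  \<open>R^m\<close>.\<close>

lemma fp_over_quot:
  assumes M: "left_module R M" and D: "submodule D R M" and fp: "fp_over R M D (carrier M)"
  shows "finitely_presented R (quot_module M D)"
proof -
  interpret M: left_module R M by fact
  note r = M.R.ring_axioms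
  obtain n :: nat and \<psi> where \<psi>: "\<psi> \<in> mod_hom R (free_module R {..<n}) M"
    "carrier M = D <+>\<^bsub>M\<^esub> \<psi> ` carrier (free_module R {..<n})"
    "fg_sub R (free_module R {..<n}) {c \<in> carrier (free_module R {..<n}). \<psi> c \<in> D}"
    using fp by (auto simp: fp_over_def)
  let ?F = "free_module R {..<n}" and ?Q = "quot_module M D"
  interpret Q: left_module R ?Q by (rule left_module_quot[OF M D])
  let ?\<pi> = "\<lambda>x. D +>\<^bsub>M\<^esub> x"
  note \<pi> = quot_hom[OF M D] and \<psi>c = mod_homD(1)[OF \<psi>(1)]
  have \<chi>: "(\<lambda>c. ?\<pi> (\<psi> c)) \<in> mod_hom R ?F ?Q" by (rule mod_hom_compose[OF \<psi>(1) \<pi>])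
  have ker: "a_kernel ?F ?Q (\<lambda>c. ?\<pi> (\<psi> c)) = {c \<in> carrier ?F. \<psi> c \<in> D}"
    using quot_eq_zero[OF M D \<psi>c] by (auto simp: a_kernel_eq)
  obtain m :: nat and \<phi> where \<phi>: "\<phi> \<in> mod_hom R (free_module R {..<m}) ?F"
    "\<phi> ` carrier (free_module R {..<m}) = {c \<in> carrier ?F. \<psi> c \<in> D}"
    using \<psi>(3) unfolding fg_sub_iff_image[OF left_module_free_module[OF r]] by (elim exE bexE)
  have "(\<lambda>c. ?\<pi> (\<psi> c)) ` carrier ?F = carrier ?Q"
  proof
    show "(\<lambda>c. ?\<pi> (\<psi> c)) ` carrier ?F \<subseteq> carrier ?Q" using mod_homD(1)[OF \<chi>] by auto
    show "carrier ?Q \<subseteq> (\<lambda>c. ?\<pi> (\<psi> c)) ` carrier ?F"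
    proof
      fix X assume "X \<in> carrier ?Q"
      then obtain x where x: "x \<in> carrier M" "X = ?\<pi> x" unfolding quot_surj[OF M D, symmetric] by auto
      then obtain y c where c: "y \<in> D" "c \<in> carrier ?F" "x = y \<oplus>\<^bsub>M\<^esub> \<psi> c"
        using \<psi>(2) by (auto simp: mem_set_add)
      have "?\<pi> x = ?\<pi> y \<oplus>\<^bsub>?Q\<^esub> ?\<pi> (\<psi> c)"
        unfolding c(3) by (rule mod_homD(2)[OF \<pi> M.submoduleD(2)[OF D c(1)] \<psi>c[OF c(2)]])
      also have "?\<pi> y = \<zero>\<^bsub>?Q\<^esub>" using quot_eq_zero[OF M D M.submoduleD(2)[OF D c(1)]] c(1) by simp
      finally have "X = ?\<pi> (\<psi> c)" using x(2) mod_homD(1)[OF \<pi> \<psi>c[OF c(2)]] by simp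
      then show "X \<in> (\<lambda>c. ?\<pi> (\<psi> c)) ` carrier ?F" using c(2) by auto
    qed
  qed
  then show ?thesis
    unfolding finitely_presented_def using Q.left_module_axioms \<chi> \<phi> ker
    by (intro conjI exI[of _ m] exI[of _ n] bexI[of _ \<phi>] bexI[of _ "\<lambda>c. ?\<pi> (\<psi> c)"]) auto
qed

text \<open>Needed because a transfinite extension also imposes a condition on its bottom member,
  which is the zero submodule here.\<close>

lemma finitely_presented_zero:
  assumes M: "left_module R M"
  shows "finitely_presented R (M\<lparr>carrier := {\<zero>\<^bsub>M\<^esub>}\<rparr>)"
proof -
  interpret M: left_module R M by fact
  let ?Z = "M\<lparr>carrier := {\<zero>\<^bsub>M\<^esub>}\<rparr>" and ?F = "free_module R {..<0::nat}"
  have Z: "left_module R ?Z" by (rule M.left_module_submodule[OF M.submodule_zero])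
  have c: "carrier (free_module R ({} :: nat set)) = {\<lambda>_. \<zero>\<^bsub>R\<^esub>}" by (auto simp: free_module_def)
  have "(\<lambda>_. \<zero>\<^bsub>M\<^esub>) \<in> mod_hom R ?F ?Z" by (rule mod_homI) auto
  moreover have "(\<lambda>_. \<zero>\<^bsub>M\<^esub>) ` carrier ?F = carrier ?Z" by (simp add: c)
  moreover have "(\<lambda>x. x) ` carrier ?F = a_kernel ?F ?Z (\<lambda>_. \<zero>\<^bsub>M\<^esub>)" by (simp add: a_kernel_eq)
  ultimately show ?thesis unfolding finitely_presented_def
    by (intro conjI Z exI[of _ 0] bexI[of _ "\<lambda>x. x"] bexI[of _ "\<lambda>_. \<zero>\<^bsub>M\<^esub>"] mod_hom_id)
qed

text \<open>The index order has to live on the elements of \<open>M\<close>, so each member of the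
  chain is named by one element of \<open>M\<close>, and the inclusion order is carried over to the
  names.\<close>

lemma transfinite_extension_fp_chain:
  fixes M :: "('r, 'm) module"
  assumes M: "left_module R M" and T: "fp_chain R M \<T> (carrier M)"
  shows "transfinite_extension R (finitely_presented R :: ('r, 'r coset_seq) module \<Rightarrow> bool) M"
proof -
  interpret M: left_module R M by fact
  note t = fp_chainD[OF T]
  \<comment> \<open>A proper member is named by an element of its successor outside itself. The name
    then lies in all larger members, which makes names distinct. The top has no successor and gets
    zero, which lies in every member and so names no other.\<close>
  have "\<forall>X\<in>\<T>. \<exists>x. if X = carrier M then x = \<zero>\<^bsub>M\<^esub> else x \<notin> X \<and> (\<forall>Y\<in>\<T>. X \<subset> Y \<longrightarrow> x \<in> Y)"
  proof
    fix X assume X: "X \<in> \<T>"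
    show "\<exists>x. if X = carrier M then x = \<zero>\<^bsub>M\<^esub> else x \<notin> X \<and> (\<forall>Y\<in>\<T>. X \<subset> Y \<longrightarrow> x \<in> Y)"
    proof (cases "X = carrier M")
      case False
      then obtain X' where X': "X \<subset> X'" "\<forall>Y\<in>\<T>. X \<subset> Y \<longrightarrow> X' \<subseteq> Y" using t(7)[OF X] by auto
      then obtain x where "x \<in> X'" "x \<notin> X" by auto
      then have "x \<notin> X \<and> (\<forall>Y\<in>\<T>. X \<subset> Y \<longrightarrow> x \<in> Y)" using X'(2) by auto
      then show ?thesis unfolding if_not_P[OF False] by (rule exI)
    qed simp
  qed
  then obtain idx where "\<forall>X\<in>\<T>.
      if X = carrier M then idx X = \<zero>\<^bsub>M\<^esub> else idx X \<notin> X \<and> (\<forall>Y\<in>\<T>. X \<subset> Y \<longrightarrow> idx X \<in> Y)"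
    by (rule bchoice[THEN exE])
  note idx = this[rule_format]
  have zero: "\<zero>\<^bsub>M\<^esub> \<in> X" if "X \<in> \<T>" for X by (rule M.submoduleD(3)[OF t(3)[OF that]])
  have ne: "idx X \<noteq> idx Y" if XY: "X \<in> \<T>" "Y \<in> \<T>" "X \<subset> Y" for X Y
  proof -
    have "X \<noteq> carrier M" using XY t(4)[OF XY(2)] by auto
    then have 1: "idx X \<notin> X" "idx X \<in> Y" using idx[OF XY(1)] XY(2,3) by simp_all
    show ?thesis
    proof (cases "Y = carrier M")
      case True
      then show ?thesis using idx[OF XY(2)] 1(1) zero[OF XY(1)] by auto
    next
      case False
      then have "idx Y \<notin> Y" using idx[OF XY(2)] by simp
      then show ?thesis using 1(2) by auto
    qed
  qed
  have inj: "inj_on idx \<T>"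
  proof (rule inj_onI)
    fix X Y assume XY: "X \<in> \<T>" "Y \<in> \<T>" "idx X = idx Y"
    then show "X = Y" using t(5)[OF XY(1,2)] ne[of X Y] ne[of Y X] by auto
  qed
  have idx_eq: "idx X = idx Y \<longleftrightarrow> X = Y" if "X \<in> \<T>" "Y \<in> \<T>" for X Y
    using inj_on_eq_iff[OF inj that] .
  define r where "r = {(idx X, idx Y) |X Y. X \<in> \<T> \<and> Y \<in> \<T> \<and> X \<subseteq> Y}"
  define C where "C = inv_into \<T> idx"
  have C: "C (idx X) = X" if "X \<in> \<T>" for X unfolding C_def by (rule inv_into_f_f[OF inj that])
  have r: "(idx X, idx Y) \<in> r \<longleftrightarrow> X \<subseteq> Y" if "X \<in> \<T>" "Y \<in> \<T>" for X Y
    using that idx_eq unfolding r_def by auto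
  have rD: "\<exists>X Y. X \<in> \<T> \<and> Y \<in> \<T> \<and> \<alpha> = idx X \<and> \<beta> = idx Y \<and> X \<subseteq> Y" if "(\<alpha>, \<beta>) \<in> r" for \<alpha> \<beta>
    using that unfolding r_def by auto
  have F: "Field r = idx ` \<T>" unfolding Field_def Domain_iff Range_iff r_def by auto
  have under: "underS r (idx X) = idx ` {Y \<in> \<T>. Y \<subset> X}" if "X \<in> \<T>" for X
    using that idx_eq unfolding underS_def r_def by auto
  have above: "aboveS r (idx X) = idx ` {Y \<in> \<T>. X \<subset> Y}" if "X \<in> \<T>" for X
    using that idx_eq unfolding aboveS_def r_def by auto
  have "Well_order r"
    unfolding well_order_on_def linear_order_on_def partial_order_on_def preorder_on_def
  proof (intro conjI)
    show "r \<subseteq> Field r \<times> Field r" by (auto simp: Field_def Domain_iff Range_iff)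
    show "refl_on (Field r) r" using r unfolding F by (auto simp: refl_on_def)
    show "trans r"
    proof (rule transI)
      fix a b c assume ab: "(a, b) \<in> r" and bc: "(b, c) \<in> r"
      obtain X Y where X: "X \<in> \<T>" "Y \<in> \<T>" "a = idx X" "b = idx Y" "X \<subseteq> Y" using rD[OF ab] by auto
      obtain Y' Z where Z: "Y' \<in> \<T>" "Z \<in> \<T>" "b = idx Y'" "c = idx Z" "Y' \<subseteq> Z" using rD[OF bc] by auto
      have "Y = Y'" using X Z idx_eq by auto
      then show "(a, c) \<in> r" using X Z r by auto
    qed
    show "antisym r"
    proof (rule antisymI)
      fix a b assume ab: "(a, b) \<in> r" and ba: "(b, a) \<in> r"
      obtain X Y where X: "X \<in> \<T>" "Y \<in> \<T>" "a = idx X" "b = idx Y" "X \<subseteq> Y" using rD[OF ab] by auto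
      then show "a = b" using ba r by auto
    qed
    show "total_on (Field r) r"
      unfolding total_on_def F using t(5) r by auto
    show "wf (r - Id)"
      unfolding wf_eq_minimal
    proof (intro allI impI)
      fix Q :: "'m set" and a assume a: "a \<in> Q"
      show "\<exists>z\<in>Q. \<forall>y. (y, z) \<in> r - Id \<longrightarrow> y \<notin> Q"
      proof (cases "{X \<in> \<T>. idx X \<in> Q} = {}")
        case True
        have "y \<notin> Q" if "(y, a) \<in> r" for y using rD[OF that] True by auto
        then show ?thesis using a by auto
      next
        case False
        then obtain X where X: "X \<in> \<T>" "idx X \<in> Q" "\<forall>Y\<in>{X \<in> \<T>. idx X \<in> Q}. X \<subseteq> Y"
          using fp_chain_least[OF T, of "{X \<in> \<T>. idx X \<in> Q}"] by auto
        have "y \<notin> Q" if y: "(y, idx X) \<in> r - Id" for y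
        proof
          assume "y \<in> Q"
          obtain Y where Y: "Y \<in> \<T>" "y = idx Y" using rD[of y "idx X"] y by auto
          then have "X \<subseteq> Y" using X(3) \<open>y \<in> Q\<close> by auto
          moreover have "Y \<subseteq> X" using y Y X(1) r by auto
          ultimately show False using y Y by auto
        qed
        then show ?thesis using X(2) by auto
      qed
    qed
  qed
  moreover have "\<forall>\<alpha>\<in>Field r. submodule (C \<alpha>) R M" unfolding F using C t(3) by auto
  moreover have "\<forall>\<alpha> \<beta>. (\<alpha>, \<beta>) \<in> r \<longrightarrow> C \<alpha> \<subseteq> C \<beta>"
  proof (intro allI impI)
    fix \<alpha> \<beta> assume "(\<alpha>, \<beta>) \<in> r"
    from rD[OF this] show "C \<alpha> \<subseteq> C \<beta>" using C by auto
  qed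
  moreover have "\<forall>\<gamma>. is_limit r \<gamma> \<longrightarrow> C \<gamma> = (\<Union>\<alpha>\<in>underS r \<gamma>. C \<alpha>)"
  proof (intro allI impI)
    fix \<gamma> assume lim: "is_limit r \<gamma>"
    then obtain X where X: "X \<in> \<T>" "\<gamma> = idx X" by (auto simp: is_limit_def F)
    have ne: "{Y \<in> \<T>. Y \<subset> X} \<noteq> {}" using lim under[OF X(1)] by (simp add: is_limit_def is_zero_def X(2) F)
    define U where "U = \<Union>{Y \<in> \<T>. Y \<subset> X}"
    have U: "U \<in> \<T>" unfolding U_def by (rule t(6)[OF _ ne]) auto
    have UX: "U \<subseteq> X" unfolding U_def by auto
    \<comment> \<open>If the union of the smaller members were strictly below \<open>X\<close>, then
      \<open>X\<close> would be its immediate successor, contrary to being a limit.\<close>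
    have "U = X"
    proof (rule ccontr)
      assume "U \<noteq> X"
      then have "U \<subset> X" using UX by auto
      moreover have "X \<subseteq> Z" if Z: "Z \<in> \<T>" "U \<subset> Z" for Z
      proof (rule ccontr)
        assume "\<not> X \<subseteq> Z"
        then have "Z \<subset> X" using t(5)[OF X(1) Z(1)] by auto
        then have "Z \<subseteq> U" using Z(1) by (auto simp: U_def)
        then show False using Z(2) by auto
      qed
      ultimately have "is_succ r (idx U) (idx X)"
        unfolding is_succ_def above[OF U] using X(1) r by auto
      then show False using lim X(2) by (auto simp: is_limit_def)
    qed
    moreover have "(\<Union>\<alpha>\<in>underS r \<gamma>. C \<alpha>) = U" unfolding X(2) under[OF X(1)] U_def using C by auto
    ultimately show "C \<gamma> = (\<Union>\<alpha>\<in>underS r \<gamma>. C \<alpha>)" using C[OF X(1)] X(2) by simp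
  qed
  moreover have "carrier M = (\<Union>\<alpha>\<in>Field r. C \<alpha>)"
    unfolding F using C t(2,4) by auto
  moreover have "\<forall>\<alpha>. is_zero r \<alpha> \<longrightarrow>
      (\<exists>N :: ('r, 'r coset_seq) module. finitely_presented R N \<and> mod_iso R (M\<lparr>carrier := C \<alpha>\<rparr>) N)"
  proof (intro allI impI)
    fix \<alpha> assume z: "is_zero r \<alpha>"
    then obtain X where X: "X \<in> \<T>" "\<alpha> = idx X" by (auto simp: is_zero_def F)
    have "{Y \<in> \<T>. Y \<subset> X} = {}" using z under[OF X(1)] by (auto simp: is_zero_def X(2))
    \<comment> \<open>The zero submodule belongs to the chain and is contained in every member, so
      the least index names it.\<close>
    then have "\<not> {\<zero>\<^bsub>M\<^esub>} \<subset> X" using t(1) by auto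
    then have "X = {\<zero>\<^bsub>M\<^esub>}" using zero[OF X(1)] by auto
    then show "\<exists>N :: ('r, 'r coset_seq) module. finitely_presented R N \<and> mod_iso R (M\<lparr>carrier := C \<alpha>\<rparr>) N"
      using finitely_presented_representative[OF finitely_presented_zero[OF M]] C[OF X(1)] X(2) by simp
  qed
  moreover have "\<forall>\<alpha> \<beta>. is_succ r \<alpha> \<beta> \<longrightarrow>
      (\<exists>N :: ('r, 'r coset_seq) module. finitely_presented R N \<and> mod_iso R (quot_module (M\<lparr>carrier := C \<beta>\<rparr>) (C \<alpha>)) N)"
  proof (intro allI impI)
    fix \<alpha> \<beta> assume s: "is_succ r \<alpha> \<beta>"
    then have "(\<alpha>, \<beta>) \<in> r" by (auto simp: is_succ_def aboveS_def)
    then obtain X Y where X: "X \<in> \<T>" "\<alpha> = idx X" and Y: "Y \<in> \<T>" "\<beta> = idx Y" using rD by blast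
    have XY: "X \<subset> Y" and least: "\<And>Z. Z \<in> \<T> \<Longrightarrow> X \<subset> Z \<Longrightarrow> Y \<subseteq> Z"
      using s above[OF X(1)] idx_eq Y(1) r unfolding is_succ_def X(2) Y(2) by auto
    have "X \<noteq> carrier M" using XY t(4)[OF Y(1)] by auto
    then obtain X' where X': "X' \<in> \<T>" "X \<subset> X'" "fp_over R M X X'" "\<forall>Z\<in>\<T>. X \<subset> Z \<longrightarrow> X' \<subseteq> Z"
      using t(7)[OF X(1)] by auto
    have "X' = Y" using least[OF X'(1,2)] X'(4) Y(1) XY by auto
    then have fp: "fp_over R M X Y" using X'(3) by simp
    have "fp_over R (M\<lparr>carrier := Y\<rparr>) X (carrier (M\<lparr>carrier := Y\<rparr>))"
      using fp_over_subcarrier[OF M t(3)[OF Y(1)] t(3)[OF X(1)] fp] by simp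
    moreover have YM: "left_module R (M\<lparr>carrier := Y\<rparr>)" by (rule M.left_module_submodule[OF t(3)[OF Y(1)]])
    moreover have "submodule X R (M\<lparr>carrier := Y\<rparr>)"
      using M.submoduleD[OF t(3)[OF X(1)]] XY unfolding left_module.submodule_iff[OF YM] by auto
    ultimately have "finitely_presented R (quot_module (M\<lparr>carrier := Y\<rparr>) X)" by (intro fp_over_quot)
    then show "\<exists>N :: ('r, 'r coset_seq) module. finitely_presented R N \<and>
        mod_iso R (quot_module (M\<lparr>carrier := C \<beta>\<rparr>) (C \<alpha>)) N"
      using finitely_presented_representative C[OF X(1)] C[OF Y(1)] X(2) Y(2) by simp
  qed
  ultimately show ?thesis unfolding transfinite_extension_def using M by blast
qed

section \<open>Extension of homomorphisms and \<open>Ext\<^sup>1\<close>\<close>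

lemma cover_map_eq: "cover_map R M = lin_comb R M (\<lambda>x. x)"
  by (rule ext) (simp add: cover_map_def lin_comb_def)

lemma
  assumes M: "left_module R M"
  shows left_module_free_cover: "left_module R (free_cover R M)"
    and cover_map_hom: "cover_map R M \<in> mod_hom R (free_cover R M) M"
    and cover_map_surj: "cover_map R M ` carrier (free_cover R M) = carrier M"
    and carrier_syzygy: "carrier (syzygy R M) = {c \<in> carrier (free_cover R M). cover_map R M c = \<zero>\<^bsub>M\<^esub>}"
    and submodule_syzygy: "submodule (carrier (syzygy R M)) R (free_cover R M)"
    and left_module_syzygy: "left_module R (syzygy R M)"
    and syzygy_eq: "syzygy R M = (free_cover R M)\<lparr>carrier := carrier (syzygy R M)\<rparr>"
proof -
  interpret M: left_module R M by fact
  note r = M.R.ring_axioms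
  show F: "left_module R (free_cover R M)" unfolding free_cover_def by (rule left_module_free_module[OF r])
  show c: "cover_map R M \<in> mod_hom R (free_cover R M) M"
    unfolding free_cover_def cover_map_eq by (rule lin_comb_hom[OF M]) auto
  have "cover_map R M ` carrier (free_cover R M) = span R M (carrier M)"
    unfolding free_cover_def cover_map_eq using lin_comb_image[OF M, of "\<lambda>x. x" "carrier M"] by simp
  also have "\<dots> = carrier M"
    using span_superset[of "carrier M" R M] span_least[OF M.submodule_carrier] by auto
  finally show "cover_map R M ` carrier (free_cover R M) = carrier M" .
  show e: "syzygy R M = (free_cover R M)\<lparr>carrier := carrier (syzygy R M)\<rparr>" by (simp add: syzygy_def)
  show "carrier (syzygy R M) = {c \<in> carrier (free_cover R M). cover_map R M c = \<zero>\<^bsub>M\<^esub>}"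
    by (simp add: syzygy_def a_kernel_eq)
  show s: "submodule (carrier (syzygy R M)) R (free_cover R M)"
    using submodule_kernel[OF F M c] by (simp add: syzygy_def)
  show "left_module R (syzygy R M)" by (subst e) (rule left_module.left_module_submodule[OF F s])
qed

section \<open>The first Ext group as an obstruction to extending homomorphisms from the
  syzygy\<close>

lemma mod_hom_restrict:
  assumes "left_module R M" "f \<in> mod_hom R M N"
  shows "restrict f (carrier M) \<in> mod_hom R M N"
proof -
  interpret M: left_module R M by fact
  show ?thesis by (rule mod_homI) (simp_all add: mod_homD[OF assms(2)])
qed

lemma comm_group_Hom:
  assumes M: "left_module R M" and N: "left_module R N"
  shows "comm_group (Hom R M N)"
proof -
  interpret M: left_module R M by fact
  interpret N: left_module R N by fact
  have cl: "f x \<in> carrier N" if "f \<in> mod_hom R M N" "x \<in> carrier M" for f x using mod_homD(1)[OF that] .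
  show ?thesis
  proof (rule comm_groupI)
    fix f g assume "f \<in> carrier (Hom R M N)" "g \<in> carrier (Hom R M N)"
    then show "f \<otimes>\<^bsub>Hom R M N\<^esub> g \<in> carrier (Hom R M N)" "f \<otimes>\<^bsub>Hom R M N\<^esub> g = g \<otimes>\<^bsub>Hom R M N\<^esub> f"
      using mod_hom_restrict[OF M mod_hom_add[OF N, of f M g]]
      by (auto simp: Hom_def cl intro!: restrict_ext N.M.a_comm)
  next
    have "(\<lambda>_. \<zero>\<^bsub>N\<^esub>) \<in> mod_hom R M N" by (rule mod_homI) auto
    then show "\<one>\<^bsub>Hom R M N\<^esub> \<in> carrier (Hom R M N)"
      using mod_hom_restrict[OF M] by (simp add: Hom_def)
  next
    fix f g h assume "f \<in> carrier (Hom R M N)" "g \<in> carrier (Hom R M N)" "h \<in> carrier (Hom R M N)"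
    then show "f \<otimes>\<^bsub>Hom R M N\<^esub> g \<otimes>\<^bsub>Hom R M N\<^esub> h = f \<otimes>\<^bsub>Hom R M N\<^esub> (g \<otimes>\<^bsub>Hom R M N\<^esub> h)"
      by (auto simp: Hom_def cl intro!: restrict_ext N.M.a_assoc)
  next
    fix f assume f: "f \<in> carrier (Hom R M N)"
    then show "\<one>\<^bsub>Hom R M N\<^esub> \<otimes>\<^bsub>Hom R M N\<^esub> f = f"
      by (auto simp: Hom_def cl extensional_def fun_eq_iff)
    have "restrict (\<lambda>x. \<ominus>\<^bsub>N\<^esub> f x) (carrier M) \<in> carrier (Hom R M N)"
      using f mod_hom_restrict[OF M mod_hom_uminus[OF N, of f]] by (simp add: Hom_def)
    moreover have "restrict (\<lambda>x. \<ominus>\<^bsub>N\<^esub> f x) (carrier M) \<otimes>\<^bsub>Hom R M N\<^esub> f = \<one>\<^bsub>Hom R M N\<^esub>"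
      using f by (auto simp: Hom_def cl N.M.l_neg intro!: restrict_ext)
    ultimately show "\<exists>g\<in>carrier (Hom R M N). g \<otimes>\<^bsub>Hom R M N\<^esub> f = \<one>\<^bsub>Hom R M N\<^esub>" by blast
  qed
qed

lemma trivial_FactGroup_iff:
  assumes "comm_group G" "subgroup K G" "H \<subseteq> K" "\<one>\<^bsub>G\<^esub> \<in> H"
  shows "trivial_group (G\<lparr>carrier := K\<rparr> Mod H) \<longleftrightarrow> K \<subseteq> H"
proof -
  interpret G: comm_group G by fact
  let ?K = "G\<lparr>carrier := K\<rparr>"
  interpret K: group ?K by (rule G.subgroup_imp_group[OF assms(2)])
  have k: "x \<in> carrier G" if "x \<in> K" for x by (rule subgroup.mem_carrier[OF assms(2) that])
  have sel: "carrier (?K Mod H) = (\<lambda>x. H #>\<^bsub>?K\<^esub> x) ` K" "\<one>\<^bsub>?K Mod H\<^esub> = H"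
    by (auto simp: FactGroup_def RCOSETS_def)
  show ?thesis
  proof
    assume "trivial_group (?K Mod H)"
    then have eq: "H #>\<^bsub>?K\<^esub> x = H" if "x \<in> K" for x
      using that unfolding trivial_group_def sel by blast
    show "K \<subseteq> H"
    proof
      fix x assume x: "x \<in> K"
      have "x = \<one>\<^bsub>G\<^esub> \<otimes>\<^bsub>?K\<^esub> x" using k[OF x] by simp
      then have "x \<in> H #>\<^bsub>?K\<^esub> x" using assms(4) unfolding r_coset_def by blast
      then show "x \<in> H" using eq[OF x] by simp
    qed
  next
    assume "K \<subseteq> H"
    then have KH: "K = H" using assms(3) by auto
    have n: "H \<lhd> ?K" using K.normal_self KH by simp
    interpret Q: group "?K Mod H" by (rule normal.factorgroup_is_group[OF n])
    have "H #>\<^bsub>?K\<^esub> x = H" if "x \<in> K" for x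
      using that KH by (intro K.coset_join2 normal_imp_subgroup[OF n]) auto
    then show "trivial_group (?K Mod H)" unfolding Q.trivial_group_subset sel by auto
  qed
qed

text \<open>A cocycle vanishes on the kernel of \<open>d1\<close> and hence is a homomorphism out of
  the syzygy \<open>K0\<close> composed with \<open>d1\<close>. It is a coboundary exactly when that
  homomorphism extends to \<open>P0\<close>.\<close>

lemma trivial_Ext1_iff:
  fixes R :: "('r, 'x) ring_scheme" and M :: "('r, 'm) module" and A :: "('r, 'a) module"
  assumes M: "left_module R M" and A: "left_module R A"
  shows "trivial_group (Ext1 R M A) \<longleftrightarrow>
     (\<forall>g \<in> mod_hom R (syzygy R M) A. \<exists>\<phi> \<in> mod_hom R (free_cover R M) A.
        \<forall>x\<in>carrier (syzygy R M). \<phi> x = g x)"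
proof -
  interpret M: left_module R M by fact
  interpret A: left_module R A by fact
  define P0 K0 P1 K1 P2 where "P0 = free_cover R M" and "K0 = syzygy R M" and "P1 = free_cover R K0"
    and "K1 = syzygy R K0" and "P2 = free_cover R K1"
  note defs = this
  define d1 d2 where "d1 = cover_map R K0" and "d2 = cover_map R K1"
  have P0: "left_module R P0" unfolding P0_def by (rule left_module_free_cover[OF M])
  have K0: "left_module R K0" unfolding K0_def by (rule left_module_syzygy[OF M])
  have P1: "left_module R P1" unfolding P1_def by (rule left_module_free_cover[OF K0])
  have K1: "left_module R K1" unfolding K1_def by (rule left_module_syzygy[OF K0])
  have P2: "left_module R P2" unfolding P2_def by (rule left_module_free_cover[OF K1])
  interpret P0: left_module R P0 by (rule P0)
  interpret P1: left_module R P1 by (rule P1)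
  have K0P0: "carrier K0 \<subseteq> carrier P0" and K0sel: "K0 = P0\<lparr>carrier := carrier K0\<rparr>"
    using P0.submoduleD(1)[OF submodule_syzygy[OF M, folded P0_def K0_def]] syzygy_eq[OF M]
    by (simp_all add: P0_def K0_def)
  have K0zero: "\<zero>\<^bsub>K0\<^esub> = \<zero>\<^bsub>P0\<^esub>" by (subst K0sel) simp
  have d1: "d1 \<in> mod_hom R P1 K0" "d1 ` carrier P1 = carrier K0"
    unfolding d1_def P1_def by (rule cover_map_hom[OF K0], rule cover_map_surj[OF K0])
  have incl: "(\<lambda>x. x) \<in> mod_hom R K0 P0"
    using K0P0 by (subst K0sel) (auto simp: mod_hom_def)
  have d2: "d2 \<in> mod_hom R P2 K1" "d2 ` carrier P2 = carrier K1"
    unfolding d2_def P2_def by (rule cover_map_hom[OF K1], rule cover_map_surj[OF K1])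
  have K1c: "carrier K1 = {x \<in> carrier P1. d1 x = \<zero>\<^bsub>K0\<^esub>}"
    unfolding K1_def P1_def d1_def by (rule carrier_syzygy[OF K0])
  have K1P1: "K1 = P1\<lparr>carrier := carrier K1\<rparr>"
    using syzygy_eq[OF K0] by (simp add: P1_def K1_def)
  have incl1: "(\<lambda>x. x) \<in> mod_hom R K1 P1"
    by (subst K1P1) (auto simp: mod_hom_def K1c)
  have d2': "d2 \<in> mod_hom R P2 P1" by (rule mod_hom_compose[OF d2(1) incl1])
  let ?G = "Hom R P1 A" and ?G2 = "Hom R P2 A"
  interpret G: comm_group ?G by (rule comm_group_Hom[OF P1 A])
  interpret G2: comm_group ?G2 by (rule comm_group_Hom[OF P2 A])
  define \<delta> where "\<delta> = (\<lambda>f :: (('m \<Rightarrow> 'r) \<Rightarrow> 'r) \<Rightarrow> 'a. compose (carrier P2) f d2)"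
  have d2c: "d2 x \<in> carrier P1" if "x \<in> carrier P2" for x by (rule mod_homD(1)[OF d2' that])
  have \<delta>_apply: "\<delta> f = restrict (\<lambda>x. f (d2 x)) (carrier P2)" for f by (simp add: \<delta>_def compose_def)
  have "group_hom ?G ?G2 \<delta>"
  proof (intro group_hom.intro group_hom_axioms.intro G.group_axioms G2.group_axioms homI)
    fix f assume "f \<in> carrier ?G"
    then show "\<delta> f \<in> carrier ?G2"
      unfolding \<delta>_apply using mod_hom_restrict[OF P2 mod_hom_compose[OF d2', of f A]] by (simp add: Hom_def)
  next
    fix f g assume "f \<in> carrier ?G" "g \<in> carrier ?G"
    then show "\<delta> (f \<otimes>\<^bsub>?G\<^esub> g) = \<delta> f \<otimes>\<^bsub>?G2\<^esub> \<delta> g"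
      unfolding \<delta>_apply by (auto simp: Hom_def d2c intro!: restrict_ext)
  qed
  then interpret \<delta>: group_hom ?G ?G2 \<delta> .
  define Z where "Z = kernel ?G ?G2 \<delta>"
  define B where "B = (\<lambda>f. compose (carrier P1) f d1) ` carrier (Hom R P0 A)"
  have Ext: "Ext1 R M A = ?G\<lparr>carrier := Z\<rparr> Mod B"
    by (simp add: Ext1_def Let_def Z_def B_def \<delta>_def d1_def d2_def defs)
  \<comment> \<open>Since \<open>d2\<close> maps onto \<open>K1\<close>, the cocycle condition says
    that \<open>f\<close> vanishes on \<open>K1\<close>, the kernel of \<open>d1\<close>.\<close>
  have Z_iff: "f \<in> Z \<longleftrightarrow> f \<in> carrier ?G \<and> (\<forall>x\<in>carrier K1. f x = \<zero>\<^bsub>A\<^esub>)" for f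
  proof -
    have "\<delta> f = \<one>\<^bsub>?G2\<^esub> \<longleftrightarrow> (\<forall>x\<in>carrier P2. f (d2 x) = \<zero>\<^bsub>A\<^esub>)"
      by (auto simp: \<delta>_apply Hom_def restrict_def fun_eq_iff)
    also have "\<dots> \<longleftrightarrow> (\<forall>x\<in>carrier K1. f x = \<zero>\<^bsub>A\<^esub>)" unfolding d2(2)[symmetric] by auto
    finally show ?thesis unfolding Z_def kernel_def by auto
  qed
  have d1c: "d1 x \<in> carrier K0" if "x \<in> carrier P1" for x by (rule mod_homD(1)[OF d1(1) that])
  have restr: "restrict (\<lambda>x. g (d1 x)) (carrier P1) \<in> Z" if "g \<in> mod_hom R K0 A" for g
  proof -
    have "restrict (\<lambda>x. g (d1 x)) (carrier P1) \<in> carrier ?G"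
      using mod_hom_restrict[OF P1 mod_hom_compose[OF d1(1) that]] by (simp add: Hom_def)
    then show ?thesis unfolding Z_iff using mod_hom_zero[OF K0 A that] by (auto simp: K1c)
  qed
  have B_iff: "f \<in> B \<longleftrightarrow> (\<exists>\<phi>\<in>mod_hom R P0 A. f = restrict (\<lambda>x. \<phi> (d1 x)) (carrier P1))" for f
  proof
    assume "f \<in> B"
    then show "\<exists>\<phi>\<in>mod_hom R P0 A. f = restrict (\<lambda>x. \<phi> (d1 x)) (carrier P1)"
      unfolding B_def compose_def by (auto simp: Hom_def)
  next
    assume "\<exists>\<phi>\<in>mod_hom R P0 A. f = restrict (\<lambda>x. \<phi> (d1 x)) (carrier P1)"
    then obtain \<phi> where \<phi>: "\<phi> \<in> mod_hom R P0 A" "f = restrict (\<lambda>x. \<phi> (d1 x)) (carrier P1)" by auto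
    have "restrict \<phi> (carrier P0) \<in> carrier (Hom R P0 A)"
      using mod_hom_restrict[OF P0 \<phi>(1)] by (simp add: Hom_def)
    moreover have "f = compose (carrier P1) (restrict \<phi> (carrier P0)) d1"
      unfolding \<phi>(2) compose_def using d1c K0P0 by (intro restrict_ext) auto
    ultimately show "f \<in> B" unfolding B_def by auto
  qed
  have BZ: "B \<subseteq> Z"
    using restr[OF mod_hom_compose[OF incl]] by (auto simp: B_iff)
  have "(\<lambda>_. \<zero>\<^bsub>A\<^esub>) \<in> mod_hom R P0 A" by (rule mod_homI) auto
  then have one: "\<one>\<^bsub>?G\<^esub> \<in> B" unfolding B_iff by (intro bexI) (simp_all add: Hom_def)
  have "trivial_group (Ext1 R M A) \<longleftrightarrow> Z \<subseteq> B"
    unfolding Ext using \<delta>.subgroup_kernel by (intro trivial_FactGroup_iff G.comm_group_axioms BZ one) (simp add: Z_def)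
  also have "\<dots> \<longleftrightarrow> (\<forall>g\<in>mod_hom R K0 A. \<exists>\<phi>\<in>mod_hom R P0 A. \<forall>x\<in>carrier K0. \<phi> x = g x)"
  proof
    assume ZB: "Z \<subseteq> B"
    show "\<forall>g\<in>mod_hom R K0 A. \<exists>\<phi>\<in>mod_hom R P0 A. \<forall>x\<in>carrier K0. \<phi> x = g x"
    proof
      fix g assume g: "g \<in> mod_hom R K0 A"
      obtain \<phi> where \<phi>: "\<phi> \<in> mod_hom R P0 A"
        "restrict (\<lambda>x. g (d1 x)) (carrier P1) = restrict (\<lambda>x. \<phi> (d1 x)) (carrier P1)"
        using ZB restr[OF g] B_iff by auto
      have "\<phi> (d1 x) = g (d1 x)" if "x \<in> carrier P1" for x
        using fun_cong[OF \<phi>(2), of x] that by simp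
      then have "\<forall>x\<in>carrier K0. \<phi> x = g x" unfolding d1(2)[symmetric] by auto
      then show "\<exists>\<phi>\<in>mod_hom R P0 A. \<forall>x\<in>carrier K0. \<phi> x = g x" using \<phi>(1) by auto
    qed
  next
    assume ext: "\<forall>g\<in>mod_hom R K0 A. \<exists>\<phi>\<in>mod_hom R P0 A. \<forall>x\<in>carrier K0. \<phi> x = g x"
    show "Z \<subseteq> B"
    proof
      fix f assume fZ: "f \<in> Z"
      then have f: "f \<in> mod_hom R P1 A" "f \<in> extensional (carrier P1)" by (auto simp: Z_iff Hom_def)
      have f0: "f x = \<zero>\<^bsub>A\<^esub>" if "x \<in> carrier P1" "d1 x = \<zero>\<^bsub>K0\<^esub>" for x
        using fZ that by (auto simp: Z_iff K1c)
      interpret K0: left_module R K0 by (rule K0)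
      have feq: "f x = f y" if "x \<in> carrier P1" "y \<in> carrier P1" "d1 x = d1 y" for x y
      proof -
        have "d1 (x \<ominus>\<^bsub>P1\<^esub> y) = d1 x \<ominus>\<^bsub>K0\<^esub> d1 y" by (rule mod_hom_diff[OF P1 K0 d1(1) that(1,2)])
        also have "\<dots> = \<zero>\<^bsub>K0\<^esub>" using that(3) d1c[OF that(2)] by (simp add: a_minus_def K0.M.r_neg)
        finally have "f (x \<ominus>\<^bsub>P1\<^esub> y) = \<zero>\<^bsub>A\<^esub>" using that by (intro f0) simp_all
        then have "f x \<ominus>\<^bsub>A\<^esub> f y = \<zero>\<^bsub>A\<^esub>" using mod_hom_diff[OF P1 A f(1) that(1,2)] by simp
        then show ?thesis using A.minus_eq_zero_iff mod_homD(1)[OF f(1)] that(1,2) by simp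
      qed
      \<comment> \<open>Only a section of sets. Because \<open>f\<close> is constant on the fibres
        of \<open>d1\<close>, the composite of \<open>f\<close> with \<open>s\<close> is
        nevertheless linear; it is the factorisation of \<open>f\<close> through
        \<open>d1\<close>.\<close>
      define s where "s = inv_into (carrier P1) d1"
      have s: "s y \<in> carrier P1" "d1 (s y) = y" if "y \<in> carrier K0" for y
        using that unfolding d1(2)[symmetric] s_def by (rule inv_into_into, rule f_inv_into_f[where f = d1])
      have fs: "f (s (d1 x)) = f x" if "x \<in> carrier P1" for x
        using that s d1c by (intro feq) auto
      have fs_hom: "(\<lambda>y. f (s y)) \<in> mod_hom R K0 A"
      proof (rule mod_homI)
        fix y assume "y \<in> carrier K0"
        then show "f (s y) \<in> carrier A" using mod_homD(1)[OF f(1)] s by auto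
      next
        fix y z assume yz: "y \<in> carrier K0" "z \<in> carrier K0"
        have "f (s (y \<oplus>\<^bsub>K0\<^esub> z)) = f (s (d1 (s y \<oplus>\<^bsub>P1\<^esub> s z)))" using yz s by (simp add: mod_homD(2)[OF d1(1)])
        also have "\<dots> = f (s y) \<oplus>\<^bsub>A\<^esub> f (s z)" using yz s by (simp add: fs mod_homD(2)[OF f(1)])
        finally show "f (s (y \<oplus>\<^bsub>K0\<^esub> z)) = f (s y) \<oplus>\<^bsub>A\<^esub> f (s z)" .
      next
        fix a y assume a: "a \<in> carrier R" and y: "y \<in> carrier K0"
        have "f (s (a \<odot>\<^bsub>K0\<^esub> y)) = f (s (d1 (a \<odot>\<^bsub>P1\<^esub> s y)))" using a y s by (simp add: mod_homD(3)[OF d1(1)])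
        also have "\<dots> = a \<odot>\<^bsub>A\<^esub> f (s y)" using a y s by (simp add: fs mod_homD(3)[OF f(1)])
        finally show "f (s (a \<odot>\<^bsub>K0\<^esub> y)) = a \<odot>\<^bsub>A\<^esub> f (s y)" .
      qed
      obtain \<phi> where \<phi>: "\<phi> \<in> mod_hom R P0 A" "\<forall>y\<in>carrier K0. \<phi> y = f (s y)"
        using bspec[OF ext fs_hom] by (elim bexE) (rule that)
      have "f = restrict (\<lambda>x. \<phi> (d1 x)) (carrier P1)"
        using \<phi>(2) d1c fs f(2) by (auto simp: fun_eq_iff restrict_def extensional_def)
      then show "f \<in> B" unfolding B_iff using \<phi>(1) by auto
    qed
  qed
  finally show ?thesis unfolding P0_def K0_def .
qed

section \<open>Extending homomorphisms into absolutely pure modules along a filtration\<close>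

text \<open>\<open>D'\<close> is the pushout of \<open>D\<close> and \<open>R^n\<close> along
  \<open>K\<close>, the preimage of \<open>D\<close> under \<psi>. So it suffices to extend
  \<open>h\<close> after \<psi> from \<open>K\<close> to \<open>R^n\<close>, where the obstruction
  lies in Ext of the finitely presented module \<open>R^n / K\<close>. The work lies in passing from
  the canonical free cover of that quotient, used by \<open>Ext1\<close>, to the cover
  \<open>R^n\<close>.\<close>

lemma absolutely_pure_extend:
  assumes A: "absolutely_pure R A" and M: "left_module R M" and D: "submodule D R M"
    and fp: "fp_over R M D D'" and h: "h \<in> mod_hom R (M\<lparr>carrier := D\<rparr>) A"
  shows "\<exists>h' \<in> mod_hom R (M\<lparr>carrier := D'\<rparr>) A. \<forall>x\<in>D. h' x = h x"
proof -
  interpret M: left_module R M by fact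
  note r = M.R.ring_axioms and d = M.submoduleD[OF D]
  have Am: "left_module R A" using A by (simp add: absolutely_pure_def)
  interpret A: left_module R A by (rule Am)
  obtain n :: nat and \<psi> where \<psi>: "\<psi> \<in> mod_hom R (free_module R {..<n}) M"
    "D' = D <+>\<^bsub>M\<^esub> \<psi> ` carrier (free_module R {..<n})"
    "fg_sub R (free_module R {..<n}) {c \<in> carrier (free_module R {..<n}). \<psi> c \<in> D}"
    using fp by (auto simp: fp_over_def)
  let ?F = "free_module R {..<n}"
  define K where "K = {c \<in> carrier ?F. \<psi> c \<in> D}"
  have F: "left_module R ?F" by (rule left_module_free_module[OF r])
  interpret F: left_module R ?F by (rule F)
  have K: "submodule K R ?F" unfolding K_def by (rule submodule_vimage[OF F M \<psi>(1) D])
  have KF: "left_module R (?F\<lparr>carrier := K\<rparr>)" by (rule F.left_module_submodule[OF K])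
  note k = F.submoduleD[OF K] and \<psi>c = mod_homD(1)[OF \<psi>(1)]
  let ?N = "quot_module ?F K" and ?\<pi> = "\<lambda>x. K +>\<^bsub>?F\<^esub> x"
  have N: "left_module R ?N" by (rule left_module_quot[OF F K])
  note \<pi> = quot_hom[OF F K]
  have "fp_over R ?F K (carrier ?F)"
  proof -
    have "carrier ?F = K <+>\<^bsub>?F\<^esub> (\<lambda>c. c) ` carrier ?F"
    proof
      show "carrier ?F \<subseteq> K <+>\<^bsub>?F\<^esub> (\<lambda>c. c) ` carrier ?F"
        using k(3) by (auto intro!: set_addI[of "\<zero>\<^bsub>?F\<^esub>"])
      show "K <+>\<^bsub>?F\<^esub> (\<lambda>c. c) ` carrier ?F \<subseteq> carrier ?F" using k(2) by (auto simp: mem_set_add)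
    qed
    moreover have "{c \<in> carrier ?F. c \<in> K} = K" using k(1) by auto
    ultimately show ?thesis unfolding fp_over_def using \<psi>(3) mod_hom_id unfolding K_def
      by (intro exI[of _ n] bexI[of _ "\<lambda>c. c"]) auto
  qed
  then have "finitely_presented R ?N" by (rule fp_over_quot[OF F K])
  \<comment> \<open>The cosets of \<open>K\<close> in \<open>R^n\<close> have exactly the type over
    which \<open>absolutely_pure\<close> quantifies, so no representative is required.\<close>
  then have triv: "trivial_group (Ext1 R ?N A)" using A by (simp add: absolutely_pure_def)
  let ?P = "free_cover R ?N" and ?K0 = "carrier (syzygy R ?N)" and ?c = "cover_map R ?N"
  have P: "left_module R ?P" by (rule left_module_free_cover[OF N])
  interpret P: left_module R ?P by (rule P)
  note c = cover_map_hom[OF N]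
  \<comment> \<open>The two free covers of \<open>?N\<close> are compared by lifts \<rho> and
    \<sigma> in both directions, each commuting with the projections to \<open>?N\<close>. Hence
    they map the two kernels into each other.\<close>
  have "unit_vec R (?\<pi> (unit_vec R i)) \<in> carrier ?P" if "i \<in> {..<n}" for i
    unfolding free_cover_def by (intro unit_vec_closed[OF r] mod_homD(1)[OF \<pi>] that)
  then obtain \<rho> where \<rho>: "\<rho> \<in> mod_hom R ?F ?P" "\<forall>i\<in>{..<n}. \<rho> (unit_vec R i) = unit_vec R (?\<pi> (unit_vec R i))"
    using free_module_lift[OF P, of "{..<n}" "\<lambda>i. unit_vec R (?\<pi> (unit_vec R i))"] by auto
  define rep where "rep = inv_into (carrier ?F) ?\<pi>"
  have rep: "rep X \<in> carrier ?F" "?\<pi> (rep X) = X" if "X \<in> carrier ?N" for X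
    using that unfolding quot_surj[OF F K, symmetric] rep_def
    by (rule inv_into_into, rule f_inv_into_f[where f = ?\<pi>])
  obtain \<sigma> where \<sigma>: "\<sigma> \<in> mod_hom R ?P ?F" "\<forall>X\<in>carrier ?N. \<sigma> (unit_vec R X) = rep X"
    using free_module_lift[OF F, of "carrier ?N" rep] rep by (auto simp: free_cover_def)
  have unit: "?c (unit_vec R X) = X" if "X \<in> carrier ?N" for X
    unfolding cover_map_eq using lin_comb_unit_vec[OF N, of "\<lambda>x. x" "carrier ?N" X] that by simp
  have c\<rho>: "?c (\<rho> x) = ?\<pi> x" if "x \<in> carrier ?F" for x
    by (rule free_module_hom_eq[OF r N mod_hom_compose[OF \<rho>(1) c] \<pi> _ that])
      (use \<rho>(2) unit mod_homD(1)[OF \<pi> unit_vec_closed[OF r]] in auto)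
  have \<pi>\<sigma>: "?\<pi> (\<sigma> x) = ?c x" if "x \<in> carrier ?P" for x
    by (rule free_module_hom_eq[OF r N _ _ _ that[unfolded free_cover_def]])
      (use \<sigma> mod_hom_compose[OF \<sigma>(1) \<pi>] c rep unit in \<open>auto simp: free_cover_def\<close>)
  note \<rho>c = mod_homD(1)[OF \<rho>(1)] and \<sigma>c = mod_homD(1)[OF \<sigma>(1)]
  have K0: "x \<in> ?K0 \<longleftrightarrow> x \<in> carrier ?P \<and> ?c x = \<zero>\<^bsub>?N\<^esub>" for x unfolding carrier_syzygy[OF N] by auto
  have K_iff: "x \<in> K \<longleftrightarrow> ?\<pi> x = \<zero>\<^bsub>?N\<^esub>" if "x \<in> carrier ?F" for x using quot_eq_zero[OF F K that] by simp
  define f where "f = (\<lambda>c. h (\<psi> c))"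
  have f: "f \<in> mod_hom R (?F\<lparr>carrier := K\<rparr>) A"
    unfolding f_def by (rule mod_hom_compose[OF mod_hom_subset[OF \<psi>(1) k(1)] h]) (simp add: K_def)
  have \<sigma>K: "\<sigma> x \<in> K" if "x \<in> ?K0" for x using that K0 K_iff \<sigma>c \<pi>\<sigma> by auto
  have "(\<lambda>x. f (\<sigma> x)) \<in> mod_hom R (syzygy R ?N) A"
    by (subst syzygy_eq[OF N])
      (rule mod_hom_compose[OF mod_hom_subset[OF \<sigma>(1) P.submoduleD(1)[OF submodule_syzygy[OF N]] \<sigma>K] f])
  then obtain \<phi> where \<phi>: "\<phi> \<in> mod_hom R ?P A" "\<forall>x\<in>?K0. \<phi> x = f (\<sigma> x)"
    using triv[unfolded trivial_Ext1_iff[OF N Am]] by auto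
  have \<rho>K: "\<rho> x \<in> ?K0" if "x \<in> K" for x
    using that k(2) K0 K_iff[of x] c\<rho>[of x] \<rho>c[of x] by auto
  have \<delta>hom: "(\<lambda>x. \<sigma> (\<rho> x) \<ominus>\<^bsub>?F\<^esub> x) \<in> mod_hom R ?F ?F"
    by (intro mod_hom_sub F mod_hom_id mod_hom_compose[OF \<rho>(1) \<sigma>(1)])
  have \<delta>K: "\<sigma> (\<rho> x) \<ominus>\<^bsub>?F\<^esub> x \<in> K" if x: "x \<in> carrier ?F" for x
  proof -
    interpret N: left_module R ?N by (rule N)
    have "?\<pi> (\<sigma> (\<rho> x) \<ominus>\<^bsub>?F\<^esub> x) = ?\<pi> (\<sigma> (\<rho> x)) \<ominus>\<^bsub>?N\<^esub> ?\<pi> x"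
      by (rule mod_hom_diff[OF F N \<pi> \<sigma>c[OF \<rho>c[OF x]] x])
    also have "\<dots> = \<zero>\<^bsub>?N\<^esub>"
      using \<pi>\<sigma>[OF \<rho>c[OF x]] c\<rho>[OF x] mod_homD(1)[OF \<pi> x] by (simp add: a_minus_def N.M.r_neg)
    finally show ?thesis using K_iff mod_homD(1)[OF \<delta>hom x] by simp
  qed
  \<comment> \<open>The natural candidate, \<phi> after \<rho>, restricts on \<open>K\<close> to
    \<open>f\<close> after \<sigma>\<rho> instead of \<open>f\<close>. The subtracted term corrects
    this and is defined on all of \<open>?F\<close>, because \<sigma>\<rho> and the identity differ
    by a map into \<open>K\<close>.\<close>
  define kk where "kk = (\<lambda>x. \<phi> (\<rho> x) \<ominus>\<^bsub>A\<^esub> f (\<sigma> (\<rho> x) \<ominus>\<^bsub>?F\<^esub> x))"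
  have "(\<lambda>x. \<sigma> (\<rho> x) \<ominus>\<^bsub>?F\<^esub> x) \<in> mod_hom R ?F (?F\<lparr>carrier := K\<rparr>)"
    using mod_hom_subset[OF \<delta>hom subset_refl \<delta>K] by simp
  then have kk: "kk \<in> mod_hom R ?F A"
    unfolding kk_def by (intro mod_hom_sub Am mod_hom_compose[OF \<rho>(1) \<phi>(1)] mod_hom_compose[OF _ f])
  have kkf: "kk x = f x" if x: "x \<in> K" for x
  proof -
    have \<sigma>\<rho>: "\<sigma> (\<rho> x) \<in> K" by (rule \<sigma>K[OF \<rho>K[OF x]])
    have fc: "f y \<in> carrier A" if "y \<in> K" for y using mod_homD(1)[OF f] that by simp
    have "f (\<sigma> (\<rho> x) \<oplus>\<^bsub>?F\<^esub> \<ominus>\<^bsub>?F\<^esub> x) = f (\<sigma> (\<rho> x)) \<oplus>\<^bsub>A\<^esub> f (\<ominus>\<^bsub>?F\<^esub> x)"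
      using mod_homD(2)[OF f, of "\<sigma> (\<rho> x)" "\<ominus>\<^bsub>?F\<^esub> x"] \<sigma>\<rho> k(6)[OF x] by simp
    moreover have "f x \<oplus>\<^bsub>A\<^esub> f (\<ominus>\<^bsub>?F\<^esub> x) = \<zero>\<^bsub>A\<^esub>"
    proof -
      have "f (x \<oplus>\<^bsub>?F\<^esub> \<ominus>\<^bsub>?F\<^esub> x) = f x \<oplus>\<^bsub>A\<^esub> f (\<ominus>\<^bsub>?F\<^esub> x)"
        using mod_homD(2)[OF f, of x "\<ominus>\<^bsub>?F\<^esub> x"] x k(6)[OF x] by simp
      moreover have "f \<zero>\<^bsub>?F\<^esub> = \<zero>\<^bsub>A\<^esub>" using mod_hom_zero[OF KF Am f] by simp
      ultimately show ?thesis using F.M.r_neg[OF k(2)[OF x]] by simp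
    qed
    then have "\<ominus>\<^bsub>A\<^esub> f (\<ominus>\<^bsub>?F\<^esub> x) = f x" by (rule A.M.minus_equality[OF _ fc[OF k(6)[OF x]] fc[OF x]])
    ultimately show ?thesis
      using \<phi>(2) \<rho>K[OF x] fc[OF x] fc[OF \<sigma>\<rho>] fc[OF k(6)[OF x]]
      by (simp add: kk_def a_minus_def A.M.minus_add A.M.a_assoc[symmetric] A.M.r_neg)
  qed
  note hc = mod_homD(1)[OF h, simplified] and kkc = mod_homD(1)[OF kk]
  have hadd: "h (x \<oplus>\<^bsub>M\<^esub> y) = h x \<oplus>\<^bsub>A\<^esub> h y" if "x \<in> D" "y \<in> D" for x y
    using mod_homD(2)[OF h, of x y] that by simp
  \<comment> \<open>Two decompositions of one element differ by a vector of \<open>K\<close>, on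
    which \<open>kk\<close> agrees with \<open>h\<close> after \<psi>. This justifies the choice in
    the definition of \<open>h'\<close> below.\<close>
  have wd: "h x \<oplus>\<^bsub>A\<^esub> kk c = h x' \<oplus>\<^bsub>A\<^esub> kk c'"
    if x: "x \<in> D" "x' \<in> D" and c: "c \<in> carrier ?F" "c' \<in> carrier ?F"
      and eq: "x \<oplus>\<^bsub>M\<^esub> \<psi> c = x' \<oplus>\<^bsub>M\<^esub> \<psi> c'" for x x' c c'
  proof -
    note cl = d(2)[OF x(1)] d(2)[OF x(2)] \<psi>c[OF c(1)] \<psi>c[OF c(2)]
    have "\<psi> (c \<ominus>\<^bsub>?F\<^esub> c') = \<psi> c \<ominus>\<^bsub>M\<^esub> \<psi> c'" by (rule mod_hom_diff[OF F M \<psi>(1) c])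
    then have eq': "x \<oplus>\<^bsub>M\<^esub> \<psi> (c \<ominus>\<^bsub>?F\<^esub> c') = x'"
      using eq cl by (simp add: a_minus_def M.M.a_assoc[symmetric]) (simp add: M.M.a_assoc M.M.r_neg)
    have "\<psi> (c \<ominus>\<^bsub>?F\<^esub> c') = x' \<ominus>\<^bsub>M\<^esub> x"
      unfolding eq'[symmetric] using cl \<psi>c[OF F.M.minus_closed[OF c]]
      by (simp add: a_minus_def M.M.a_ac M.M.r_neg M.M.r_neg2)
    then have D: "\<psi> (c \<ominus>\<^bsub>?F\<^esub> c') \<in> D" using d(7)[OF x(2,1)] by simp
    then have "c \<ominus>\<^bsub>?F\<^esub> c' \<in> K" using c by (simp add: K_def)
    then have "h (\<psi> (c \<ominus>\<^bsub>?F\<^esub> c')) = kk c \<ominus>\<^bsub>A\<^esub> kk c'"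
      using kkf mod_hom_diff[OF F Am kk c] by (simp add: f_def)
    then have "h x' = h x \<oplus>\<^bsub>A\<^esub> (kk c \<ominus>\<^bsub>A\<^esub> kk c')" using hadd[OF x(1) D] eq' by simp
    then show ?thesis
      using hc x kkc c by (simp add: a_minus_def A.M.a_assoc A.M.l_neg)
  qed
  define h' where "h' z = (SOME v. \<exists>x\<in>D. \<exists>c\<in>carrier ?F. z = x \<oplus>\<^bsub>M\<^esub> \<psi> c \<and> v = h x \<oplus>\<^bsub>A\<^esub> kk c)" for z
  have h': "h' (x \<oplus>\<^bsub>M\<^esub> \<psi> c) = h x \<oplus>\<^bsub>A\<^esub> kk c" if "x \<in> D" "c \<in> carrier ?F" for x c
    unfolding h'_def
  proof (rule some_equality)
    show "\<exists>x'\<in>D. \<exists>c'\<in>carrier ?F. x \<oplus>\<^bsub>M\<^esub> \<psi> c = x' \<oplus>\<^bsub>M\<^esub> \<psi> c' \<and> h x \<oplus>\<^bsub>A\<^esub> kk c = h x' \<oplus>\<^bsub>A\<^esub> kk c'"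
      by (intro bexI[of _ x] bexI[of _ c] conjI refl that)
    fix v assume "\<exists>x'\<in>D. \<exists>c'\<in>carrier ?F. x \<oplus>\<^bsub>M\<^esub> \<psi> c = x' \<oplus>\<^bsub>M\<^esub> \<psi> c' \<and> v = h x' \<oplus>\<^bsub>A\<^esub> kk c'"
    then obtain x' c' where "x' \<in> D" "c' \<in> carrier ?F" "x \<oplus>\<^bsub>M\<^esub> \<psi> c = x' \<oplus>\<^bsub>M\<^esub> \<psi> c'"
      "v = h x' \<oplus>\<^bsub>A\<^esub> kk c'" by auto
    then show "v = h x \<oplus>\<^bsub>A\<^esub> kk c" using wd[OF that(1) _ that(2)] by metis
  qed
  have dec: "\<exists>x\<in>D. \<exists>c\<in>carrier ?F. z = x \<oplus>\<^bsub>M\<^esub> \<psi> c" if "z \<in> D'" for z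
    using that by (auto simp: \<psi>(2) mem_set_add)
  have "h' \<in> mod_hom R (M\<lparr>carrier := D'\<rparr>) A"
  proof (rule mod_homI)
    fix z assume "z \<in> carrier (M\<lparr>carrier := D'\<rparr>)"
    then obtain x c where "x \<in> D" "c \<in> carrier ?F" "z = x \<oplus>\<^bsub>M\<^esub> \<psi> c" using dec[of z] by auto
    then show "h' z \<in> carrier A" using h' hc kkc by simp
  next
    fix z w assume "z \<in> carrier (M\<lparr>carrier := D'\<rparr>)" "w \<in> carrier (M\<lparr>carrier := D'\<rparr>)"
    then obtain x c y e where x: "x \<in> D" "c \<in> carrier ?F" "z = x \<oplus>\<^bsub>M\<^esub> \<psi> c"
      and y: "y \<in> D" "e \<in> carrier ?F" "w = y \<oplus>\<^bsub>M\<^esub> \<psi> e" using dec[of z] dec[of w] by auto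
    have "z \<oplus>\<^bsub>M\<^esub> w = (x \<oplus>\<^bsub>M\<^esub> y) \<oplus>\<^bsub>M\<^esub> \<psi> (c \<oplus>\<^bsub>?F\<^esub> e)"
      using x y d(2) \<psi>c by (simp add: mod_homD(2)[OF \<psi>(1)] M.M.a_ac)
    then have "h' (z \<oplus>\<^bsub>M\<^esub> w) = h (x \<oplus>\<^bsub>M\<^esub> y) \<oplus>\<^bsub>A\<^esub> kk (c \<oplus>\<^bsub>?F\<^esub> e)"
      using h'[OF d(4)[OF x(1) y(1)] F.M.a_closed[OF x(2) y(2)]] by simp
    then show "h' (z \<oplus>\<^bsub>M\<lparr>carrier := D'\<rparr>\<^esub> w) = h' z \<oplus>\<^bsub>A\<^esub> h' w"
      using x y hadd h' mod_homD(2)[OF kk] hc kkc by (simp add: A.M.a_ac)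
  next
    fix a z assume a: "a \<in> carrier R" and "z \<in> carrier (M\<lparr>carrier := D'\<rparr>)"
    then obtain x c where x: "x \<in> D" "c \<in> carrier ?F" "z = x \<oplus>\<^bsub>M\<^esub> \<psi> c" using dec[of z] by auto
    have "a \<odot>\<^bsub>M\<^esub> z = a \<odot>\<^bsub>M\<^esub> x \<oplus>\<^bsub>M\<^esub> \<psi> (a \<odot>\<^bsub>?F\<^esub> c)"
      using a x d(2) \<psi>c by (simp add: mod_homD(3)[OF \<psi>(1)] M.smult_r_distr)
    then have "h' (a \<odot>\<^bsub>M\<^esub> z) = h (a \<odot>\<^bsub>M\<^esub> x) \<oplus>\<^bsub>A\<^esub> kk (a \<odot>\<^bsub>?F\<^esub> c)"
      using h'[OF d(5)[OF a x(1)] F.smult_closed[OF a x(2)]] by simp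
    moreover have "h (a \<odot>\<^bsub>M\<^esub> x) = a \<odot>\<^bsub>A\<^esub> h x" using mod_homD(3)[OF h a, of x] x by simp
    ultimately show "h' (a \<odot>\<^bsub>M\<lparr>carrier := D'\<rparr>\<^esub> z) = a \<odot>\<^bsub>A\<^esub> h' z"
      using a x h' mod_homD(3)[OF kk a] hc kkc by (simp add: A.smult_r_distr)
  qed
  moreover have "h' x = h x" if x: "x \<in> D" for x
    using h'[OF x F.M.zero_closed] mod_hom_zero[OF F M \<psi>(1)] mod_hom_zero[OF F Am kk] d(2)[OF x] hc[OF x] by simp
  ultimately show ?thesis by blast
qed

text \<open>Eklof's lemma, proved by Zorn's lemma on the partial extensions defined over a member of
  the filtration.\<close>

lemma absolutely_pure_extend_chain:
  fixes R :: "('r, 'x) ring_scheme" and M :: "('r, 'm) module" and E :: "('r, 'e) module"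
    and A :: "('r, 'a) module"
  assumes A: "absolutely_pure R A" and M: "left_module R M" and T: "fp_chain R M \<T> (carrier M)"
    and E: "left_module R E" and g: "g \<in> mod_hom R E M" "g ` carrier E = carrier M"
    and h0: "h0 \<in> mod_hom R (E\<lparr>carrier := a_kernel E M g\<rparr>) A"
  shows "\<exists>h \<in> mod_hom R E A. \<forall>x\<in>a_kernel E M g. h x = h0 x"
proof -
  interpret M: left_module R M by (rule M)
  interpret E: left_module R E by (rule E)
  have Am: "left_module R A" using A by (simp add: absolutely_pure_def)
  note t = fp_chainD[OF T]
  \<comment> \<open>The filtration of \<open>M\<close> is pulled back to \<open>E\<close>, where it
    begins at the kernel of \<open>g\<close>, on which \<open>h0\<close> is given, and ends at all
    of \<open>E\<close>.\<close>
  define V where "V X = {x \<in> carrier E. g x \<in> X}" for X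
  have V0: "V {\<zero>\<^bsub>M\<^esub>} = a_kernel E M g" by (auto simp: V_def a_kernel_eq)
  have Vc: "V (carrier M) = carrier E" using mod_homD(1)[OF g(1)] by (auto simp: V_def)
  have V: "submodule (V X) R E" if "X \<in> \<T>" for X
    unfolding V_def by (rule submodule_vimage[OF E M g(1) t(3)[OF that]])
  have Vmono: "V X \<subseteq> V Y" if "X \<subseteq> Y" for X Y using that by (auto simp: V_def)
  have VE: "V X \<subseteq> carrier E" for X by (auto simp: V_def)
  \<comment> \<open>Extensionality makes a partial extension determined by its values on its domain;
    the order on \<A> would not be antisymmetric otherwise.\<close>
  define \<A> where "\<A> = {(X, h). X \<in> \<T> \<and> h \<in> mod_hom R (E\<lparr>carrier := V X\<rparr>) A \<and> h \<in> extensional (V X) \<and>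
    (\<forall>x\<in>V {\<zero>\<^bsub>M\<^esub>}. h x = h0 x)}"
  define P where "P p q \<longleftrightarrow> fst p \<subseteq> fst q \<and> (\<forall>x\<in>V (fst p). snd q x = snd p x)"
    for p q :: "'m set \<times> ('e \<Rightarrow> 'a)"
  have mem: "(X, restrict h (V X)) \<in> \<A>"
    if "X \<in> \<T>" "h \<in> mod_hom R (E\<lparr>carrier := V X\<rparr>) A" "\<forall>x\<in>V {\<zero>\<^bsub>M\<^esub>}. h x = h0 x" for X h
  proof -
    have "\<zero>\<^bsub>M\<^esub> \<in> X" by (rule M.submoduleD(3)[OF t(3)[OF that(1)]])
    then have "V {\<zero>\<^bsub>M\<^esub>} \<subseteq> V X" by (intro Vmono) auto
    then show ?thesis
      using that mod_hom_restrict[OF E.left_module_submodule[OF V[OF that(1)]] that(2)]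
      by (auto simp: \<A>_def)
  qed
  have A_fst: "fst p \<in> \<T>" if "p \<in> \<A>" for p using that by (auto simp: \<A>_def)
  have A_hom: "snd p \<in> mod_hom R (E\<lparr>carrier := V (fst p)\<rparr>) A" if "p \<in> \<A>" for p using that by (auto simp: \<A>_def)
  have A_ext: "snd p \<in> extensional (V (fst p))" if "p \<in> \<A>" for p using that by (auto simp: \<A>_def)
  have A_0: "snd p x = h0 x" if "p \<in> \<A>" "x \<in> V {\<zero>\<^bsub>M\<^esub>}" for p x using that by (auto simp: \<A>_def)
  have base: "({\<zero>\<^bsub>M\<^esub>}, restrict h0 (V {\<zero>\<^bsub>M\<^esub>})) \<in> \<A>"
    using mem[OF t(1)] h0 V0 by simp
  have "\<exists>m\<in>\<A>. \<forall>a\<in>\<A>. P m a \<longrightarrow> a = m"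
  proof (rule predicate_Zorn)
    show "partial_order_on \<A> (relation_of P \<A>)"
    proof (rule partial_order_on_relation_ofI)
      show "P a a" for a by (simp add: P_def)
      show "P a c" if "P a b" "P b c" for a b c
      proof -
        have "V (fst a) \<subseteq> V (fst b)" using that(1) by (intro Vmono) (simp add: P_def)
        then show ?thesis using that by (auto simp: P_def)
      qed
      show "a = b" if ab: "a \<in> \<A>" "b \<in> \<A>" "P a b" "P b a" for a b
      proof -
        have eq: "fst a = fst b" using ab(3,4) by (auto simp: P_def)
        have "snd a = snd b"
        proof (rule extensionalityI[OF A_ext[OF ab(1)]])
          show "snd b \<in> extensional (V (fst a))" using A_ext[OF ab(2)] eq by simp
          show "snd a x = snd b x" if "x \<in> V (fst a)" for x using ab(3) that by (simp add: P_def)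
        qed
        then show ?thesis using eq by (simp add: prod_eq_iff)
      qed
    qed
  next
    fix C assume C: "C \<in> Chains (relation_of P \<A>)"
    have CA: "C \<subseteq> \<A>" by (rule Chains_relation_of[OF C])
    have lin: "P p q \<or> P q p" if "p \<in> C" "q \<in> C" for p q
      using C that unfolding Chains_def relation_of_def by auto
    show "\<exists>u\<in>\<A>. \<forall>a\<in>C. P a u"
    proof (cases "C = {}")
      case True
      then show ?thesis using base by auto
    next
      case False
      define X where "X = \<Union>(fst ` C)"
      have X: "X \<in> \<T>" unfolding X_def using False CA A_fst by (intro t(6)) auto
      \<comment> \<open>Gluing along the chain: \<open>h\<close> evaluates any member defined at
        \<open>x\<close>, and comparability makes the choice irrelevant.\<close>
      define h where "h x = snd (SOME p. p \<in> C \<and> x \<in> V (fst p)) x" for x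
      have h: "h x = snd p x" if p: "p \<in> C" "x \<in> V (fst p)" for x p
      proof -
        have "\<exists>q. q \<in> C \<and> x \<in> V (fst q)" using p by (intro exI[of _ p] conjI)
        from someI_ex[OF this] have q: "(SOME p. p \<in> C \<and> x \<in> V (fst p)) \<in> C"
          "x \<in> V (fst (SOME p. p \<in> C \<and> x \<in> V (fst p)))" by auto
        show ?thesis unfolding h_def using lin[OF q(1) p(1)] p(2) q(2) by (auto simp: P_def)
      qed
      have VX: "\<exists>p\<in>C. x \<in> V (fst p)" if "x \<in> V X" for x using that by (auto simp: V_def X_def)
      have VX2: "\<exists>p\<in>C. x \<in> V (fst p) \<and> y \<in> V (fst p)" if xy: "x \<in> V X" "y \<in> V X" for x y
      proof -
        obtain p q where pq: "p \<in> C" "x \<in> V (fst p)" "q \<in> C" "y \<in> V (fst q)" using VX xy by meson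
        show ?thesis using lin[OF pq(1,3)]
        proof
          assume "P p q"
          then have "V (fst p) \<subseteq> V (fst q)" by (intro Vmono) (simp add: P_def)
          then show ?thesis using pq by auto
        next
          assume "P q p"
          then have "V (fst q) \<subseteq> V (fst p)" by (intro Vmono) (simp add: P_def)
          then show ?thesis using pq by auto
        qed
      qed
      have "h \<in> mod_hom R (E\<lparr>carrier := V X\<rparr>) A"
      proof (rule mod_homI)
        fix x assume "x \<in> carrier (E\<lparr>carrier := V X\<rparr>)"
        then have "\<exists>p\<in>C. x \<in> V (fst p)" by (intro VX) simp
        then obtain p where p: "p \<in> C" "x \<in> V (fst p)" by (elim bexE)
        then show "h x \<in> carrier A" using h[OF p] mod_homD(1)[OF A_hom[of p], of x] CA by auto
      next
        fix x y assume "x \<in> carrier (E\<lparr>carrier := V X\<rparr>)" "y \<in> carrier (E\<lparr>carrier := V X\<rparr>)"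
        then have "\<exists>p\<in>C. x \<in> V (fst p) \<and> y \<in> V (fst p)" by (intro VX2) simp_all
        then obtain p where p: "p \<in> C" "x \<in> V (fst p)" "y \<in> V (fst p)" by (elim bexE conjE)
        have pA: "p \<in> \<A>" using p(1) CA by auto
        have "x \<oplus>\<^bsub>E\<^esub> y \<in> V (fst p)" by (rule E.submoduleD(4)[OF V[OF A_fst[OF pA]] p(2,3)])
        then show "h (x \<oplus>\<^bsub>E\<lparr>carrier := V X\<rparr>\<^esub> y) = h x \<oplus>\<^bsub>A\<^esub> h y"
          using h[OF p(1)] p(2,3) mod_homD(2)[OF A_hom[OF pA], of x y] by simp
      next
        fix a x assume a: "a \<in> carrier R" and "x \<in> carrier (E\<lparr>carrier := V X\<rparr>)"
        then have "\<exists>p\<in>C. x \<in> V (fst p)" by (intro VX) simp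
        then obtain p where p: "p \<in> C" "x \<in> V (fst p)" by (elim bexE)
        have pA: "p \<in> \<A>" using p(1) CA by auto
        have "a \<odot>\<^bsub>E\<^esub> x \<in> V (fst p)" by (rule E.submoduleD(5)[OF V[OF A_fst[OF pA]] a p(2)])
        then show "h (a \<odot>\<^bsub>E\<lparr>carrier := V X\<rparr>\<^esub> x) = a \<odot>\<^bsub>A\<^esub> h x"
          using h[OF p(1)] p(2) mod_homD(3)[OF A_hom[OF pA] a, of x] by simp
      qed
      moreover have "\<forall>x\<in>V {\<zero>\<^bsub>M\<^esub>}. h x = h0 x"
      proof
        fix x assume x: "x \<in> V {\<zero>\<^bsub>M\<^esub>}"
        obtain p where p: "p \<in> C" using False by auto
        then have pA: "p \<in> \<A>" using CA by auto
        have "V {\<zero>\<^bsub>M\<^esub>} \<subseteq> V (fst p)" using M.submoduleD(3)[OF t(3)[OF A_fst[OF pA]]] by (intro Vmono) auto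
        then show "h x = h0 x" using h[OF p, of x] A_0[OF pA x] x by auto
      qed
      ultimately have u: "(X, restrict h (V X)) \<in> \<A>" by (rule mem[OF X])
      have "P p (X, restrict h (V X))" if p: "p \<in> C" for p
      proof -
        have "fst p \<subseteq> X" using p by (auto simp: X_def)
        then show ?thesis using Vmono[of "fst p" X] h[OF p] by (auto simp: P_def)
      qed
      then show ?thesis using u by blast
    qed
  qed
  then obtain X h where Xh: "(X, h) \<in> \<A>" and max: "\<And>a. a \<in> \<A> \<Longrightarrow> P (X, h) a \<Longrightarrow> a = (X, h)" by auto
  have X: "X \<in> \<T>" and hX: "h \<in> mod_hom R (E\<lparr>carrier := V X\<rparr>) A"
    using A_fst[OF Xh] A_hom[OF Xh] by simp_all
  have h_0: "h x = h0 x" if "x \<in> V {\<zero>\<^bsub>M\<^esub>}" for x using A_0[OF Xh that] by simp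
  have "X = carrier M"
  proof (rule ccontr)
    assume "X \<noteq> carrier M"
    then obtain X' where X': "X' \<in> \<T>" "X \<subset> X'" "fp_over R M X X'" using t(7)[OF X] by auto
    \<comment> \<open>A partial extension with a proper domain extends one more step, because the
      pulled back step is again finitely presented.\<close>
    have "fp_over R E (V X) (V X')"
      unfolding V_def by (rule fp_over_vimage[OF E M g t(3)[OF X] X'(3)])
    then obtain h' where h': "h' \<in> mod_hom R (E\<lparr>carrier := V X'\<rparr>) A" "\<forall>x\<in>V X. h' x = h x"
      using absolutely_pure_extend[OF A E V[OF X] _ hX] by blast
    have "V {\<zero>\<^bsub>M\<^esub>} \<subseteq> V X" using M.submoduleD(3)[OF t(3)[OF X]] by (intro Vmono) auto
    then have a: "(X', restrict h' (V X')) \<in> \<A>" using h'(2) h_0 by (intro mem X'(1) h'(1)) auto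
    have "V X \<subseteq> V X'" using X'(2) by (intro Vmono) auto
    then have "P (X, h) (X', restrict h' (V X'))" using h'(2) X'(2) by (auto simp: P_def)
    from max[OF a this] show False using X'(2) by simp
  qed
  then have "h \<in> mod_hom R E A" using hX Vc by simp
  then show ?thesis using h_0 V0 by auto
qed

text \<open>Eklof's lemma is applied to the canonical free cover of \<open>M\<close>; its kernel is
  the syzygy, and extending from the syzygy is what vanishing of \<open>Ext1\<close> means.\<close>

lemma trivial_Ext1_fp_chain:
  assumes M: "left_module R M" and T: "fp_chain R M \<T> (carrier M)" and A: "absolutely_pure R A"
  shows "trivial_group (Ext1 R M A)"
proof -
  have Am: "left_module R A" using A by (simp add: absolutely_pure_def)
  have ker: "carrier (syzygy R M) = a_kernel (free_cover R M) M (cover_map R M)" by (simp add: syzygy_def)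
  show ?thesis
    unfolding trivial_Ext1_iff[OF M Am]
  proof
    fix g assume "g \<in> mod_hom R (syzygy R M) A"
    then have "g \<in> mod_hom R ((free_cover R M)\<lparr>carrier := a_kernel (free_cover R M) M (cover_map R M)\<rparr>) A"
      by (simp add: syzygy_def)
    then show "\<exists>\<phi>\<in>mod_hom R (free_cover R M) A. \<forall>x\<in>carrier (syzygy R M). \<phi> x = g x"
      unfolding ker
      by (rule absolutely_pure_extend_chain[OF A M T left_module_free_cover[OF M] cover_map_hom[OF M] cover_map_surj[OF M]])
  qed
qed

section \<open>Exact complexes of projective modules\<close>

lemma free_module_coord_hom: "(\<lambda>c. c i) \<in> mod_hom R (free_module R X) (regular_module R)"
  by (rule mod_homI) (auto simp: free_module_def regular_module_def)

lemma mod_hom_free_mono: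
  assumes "f \<in> mod_hom R (free_module R Y) N" "X \<subseteq> Y"
  shows "f \<in> mod_hom R (free_module R X) N"
  using assms(1) free_module_mono[OF assms(2), of R] mod_homD[OF assms(1)]
  by (intro mod_homI) (auto simp: free_module_sel subset_iff)

text \<open>The maps \<open>s n\<close> are sections of the canonical free covers; their coordinates form a dual basis
  of \<open>P n\<close> with respect to the generating set \<open>carrier (P n)\<close>.\<close>

locale projective_complex =
  fixes R :: "('r, 'x) ring_scheme" and P :: "int \<Rightarrow> ('r, 'm) module" and d :: "int \<Rightarrow> 'm \<Rightarrow> 'm"
    and s :: "int \<Rightarrow> 'm \<Rightarrow> 'm \<Rightarrow> 'r"
  assumes coherent: "left_coherent R"
    and left_module: "left_module R (P n)"
    and d: "d n \<in> mod_hom R (P n) (P (n - 1))"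
    and exact: "d (n + 1) ` carrier (P (n + 1)) = a_kernel (P n) (P (n - 1)) (d n)"
    and s: "s n \<in> mod_hom R (P n) (free_cover R (P n))"
    and cover_s: "x \<in> carrier (P n) \<Longrightarrow> cover_map R (P n) (s n x) = x"
begin

definition Z :: "int \<Rightarrow> 'm set" where
  "Z n = a_kernel (P n) (P (n - 1)) (d n)"

text \<open>The condition is on dual basis coordinates. Every element of \<open>W n S\<close> is a
  combination of the elements indexed by \<open>S\<close>, but such a combination may have further
  coordinates, as \<open>s n b\<close> need not be a unit vector. For closed \<open>S\<close> the
  two notions agree.\<close>

definition W :: "int \<Rightarrow> (int \<times> 'm) set \<Rightarrow> 'm set" where
  "W n S = {x \<in> carrier (P n). \<forall>b. s n x b \<noteq> \<zero>\<^bsub>R\<^esub> \<longrightarrow> (n, b) \<in> S}"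

definition B :: "(int \<times> 'm) set" where
  "B = {(n, b). b \<in> carrier (P n)}"

text \<open>If \<open>S\<close> is closed, then the \<open>W n S\<close> are direct summands of the \<open>P n\<close> and form an exact
  subcomplex.\<close>

definition closed :: "(int \<times> 'm) set \<Rightarrow> bool" where
  "closed S \<longleftrightarrow> S \<subseteq> B \<and> (\<forall>(n, b)\<in>S. b \<in> W n S \<and> d n b \<in> W (n - 1) S) \<and>
     (\<forall>n. \<forall>x\<in>Z n \<inter> W n S. \<exists>y\<in>W (n + 1) S. d (n + 1) y = x)"

lemma ring: "ring R"
  using coherent by (simp add: left_coherent_def)

lemma regular: "left_module R (regular_module R)"
  by (rule left_module_regular[OF ring])

lemma Z_iff: "x \<in> Z n \<longleftrightarrow> x \<in> carrier (P n) \<and> d n x = \<zero>\<^bsub>P (n - 1)\<^esub>"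
  by (auto simp: Z_def a_kernel_eq)

lemma submodule_Z: "submodule (Z n) R (P n)"
  unfolding Z_def by (rule submodule_kernel[OF left_module left_module d])

lemma d_Z:
  assumes "x \<in> carrier (P n)"
  shows "d n x \<in> Z (n - 1)"
  using exact[of "n - 1"] assms by (auto simp: Z_def)

lemma coord_hom: "(\<lambda>x. s n x b) \<in> mod_hom R (P n) (regular_module R)"
  by (rule mod_hom_compose[OF s[unfolded free_cover_def] free_module_coord_hom])

lemma s_in: "x \<in> carrier (P n) \<Longrightarrow> s n x \<in> carrier (free_module R (carrier (P n)))"
  using mod_homD(1)[OF s] by (simp add: free_cover_def)

lemma supp:
  assumes "x \<in> carrier (P n)"
  shows "finite {b. s n x b \<noteq> \<zero>\<^bsub>R\<^esub>}" "\<And>b. s n x b \<noteq> \<zero>\<^bsub>R\<^esub> \<Longrightarrow> (n, b) \<in> B"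
  using free_moduleD(2,3)[OF s_in[OF assms]] by (auto simp: B_def)

text \<open>An intersection of kernels of coordinate functionals. The final
  \<open>carrier (P n)\<close> catches an empty index set, for which the intersection would be
  \<open>UNIV\<close>.\<close>

lemma W_eq: "W n S = (\<Inter>b\<in>{b. (n, b) \<notin> S}. {x \<in> carrier (P n). s n x b \<in> {\<zero>\<^bsub>regular_module R\<^esub>}}) \<inter> carrier (P n)"
  by (auto simp: W_def regular_module_def)

lemma submodule_W: "submodule (W n S) R (P n)"
proof -
  interpret P: left_module R "P n" by (rule left_module)
  have "submodule {x \<in> carrier (P n). s n x b \<in> {\<zero>\<^bsub>regular_module R\<^esub>}} R (P n)" for b
    by (rule submodule_vimage[OF left_module regular coord_hom left_module.submodule_zero[OF regular]])
  then show ?thesis unfolding W_eq P.submodule_iff by auto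
qed

lemma W_mono: "S \<subseteq> S' \<Longrightarrow> W n S \<subseteq> W n S'"
  by (auto simp: W_def)

lemma W_coord: "x \<in> W n S \<Longrightarrow> (n, b) \<notin> S \<Longrightarrow> s n x b = \<zero>\<^bsub>R\<^esub>"
  by (auto simp: W_def)

lemma W_B: "W n B = carrier (P n)"
  using supp(2) by (auto simp: W_def)

lemma cover_hom:
  assumes "X \<subseteq> carrier (P n)"
  shows "cover_map R (P n) \<in> mod_hom R (free_module R X) (P n)"
  using mod_hom_free_mono[OF _ assms] cover_map_hom[OF left_module, of n] by (simp add: free_cover_def)

lemma cover_unit: "b \<in> carrier (P n) \<Longrightarrow> cover_map R (P n) (unit_vec R b) = b"
  unfolding cover_map_eq by (rule lin_comb_unit_vec[OF left_module]) auto

text \<open>Closedness asserts both memberships for the basis elements in \<open>S\<close>; they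
  pass to combinations because \<open>W\<close> is a submodule and \<open>d\<close> is
  linear.\<close>

lemma cover_W:
  assumes S: "closed S" and c: "c \<in> carrier (free_module R (carrier (P n)))"
    and supp: "\<And>b. c b \<noteq> \<zero>\<^bsub>R\<^esub> \<Longrightarrow> (n, b) \<in> S"
  shows "cover_map R (P n) c \<in> W n S" "d n (cover_map R (P n) c) \<in> W (n - 1) S"
proof -
  let ?X = "{b. (n, b) \<in> S}"
  have X: "?X \<subseteq> carrier (P n)" using S by (auto simp: closed_def B_def)
  have c': "c \<in> carrier (free_module R ?X)" using c supp by (auto simp: free_module_def)
  have b: "b \<in> W n S" "d n b \<in> W (n - 1) S" if "b \<in> ?X" for b using S that by (auto simp: closed_def)
  show "cover_map R (P n) c \<in> W n S"
    by (rule free_module_hom_in[OF left_module cover_hom[OF X] submodule_W _ c'])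
      (use b(1) cover_unit X in auto)
  show "d n (cover_map R (P n) c) \<in> W (n - 1) S"
    by (rule free_module_hom_in[OF left_module mod_hom_compose[OF cover_hom[OF X] d] submodule_W _ c'])
      (use b(2) cover_unit X in auto)
qed

text \<open>Restriction of \<open>s n x\<close> to the finitely many indices in \<open>T - S\<close> identifies the quotient with a
  submodule of a free module of finite rank, which is cut out by finitely many functionals.\<close>

lemma fp_over_W:
  assumes S: "closed S" and T: "finite T" "T \<subseteq> B"
  shows "fp_over R (P n) (Z n \<inter> W n S) (Z n \<inter> W n (S \<union> T))"
proof -
  interpret P: left_module R "P n" by (rule left_module)
  interpret RR: left_module R "regular_module R" by (rule regular)
  interpret R: ring R by (rule ring)
  have Rsel: "carrier (regular_module R) = carrier R" "\<zero>\<^bsub>regular_module R\<^esub> = \<zero>\<^bsub>R\<^esub>" "add (regular_module R) = add R"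
    by (simp_all add: regular_module_def)
  define X where "X = {b. (n, b) \<in> T \<and> (n, b) \<notin> S}"
  let ?F = "free_module R (carrier (P n))" and ?\<pi> = "cover_map R (P n)"
  have F: "left_module R ?F" by (rule left_module_free_module[OF ring])
  interpret F: left_module R ?F by (rule F)
  have X: "finite X" "X \<subseteq> carrier (P n)"
  proof -
    have "X \<subseteq> snd ` T" by (force simp: X_def)
    then show "finite X" using T(1) by (meson finite_imageI finite_subset)
    show "X \<subseteq> carrier (P n)" using T(2) by (auto simp: X_def B_def)
  qed
  have \<pi>: "?\<pi> \<in> mod_hom R ?F (P n)" by (rule cover_hom) simp
  note \<pi>c = mod_homD(1)[OF \<pi>]
  \<comment> \<open>These functionals express when \<open>c\<close> is the coordinate vector outside
    \<open>S\<close> of a cycle. A combination \<open>e\<close> over \<open>S\<close> changes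
    neither the coordinates outside \<open>S\<close> nor the class of the differential modulo
    \<open>W (n - 1) S\<close>. So \<open>?\<pi> c\<close> must already have coordinates
    \<open>c\<close> outside \<open>S\<close> (\<open>\<theta>1\<close>) and a differential in
    \<open>W (n - 1) S\<close> (\<open>\<theta>2\<close>).\<close>
  define \<theta>1 where "\<theta>1 b c = s n (?\<pi> c) b \<ominus>\<^bsub>regular_module R\<^esub> c b" for b c
  define \<theta>2 where "\<theta>2 b c = s (n - 1) (d n (?\<pi> c)) b" for b c
  have \<theta>1: "\<theta>1 b \<in> mod_hom R ?F (regular_module R)" for b
    unfolding \<theta>1_def by (intro mod_hom_sub regular mod_hom_compose[OF \<pi> coord_hom] free_module_coord_hom)
  have \<theta>2: "\<theta>2 b \<in> mod_hom R ?F (regular_module R)" for b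
    unfolding \<theta>2_def by (rule mod_hom_compose[OF mod_hom_compose[OF \<pi> d] coord_hom])
  have sc: "s m x b \<in> carrier R" if "x \<in> carrier (P m)" for m x b by (rule free_moduleD(1)[OF s_in[OF that]])
  have \<theta>1_iff: "\<theta>1 b c = \<zero>\<^bsub>R\<^esub> \<longleftrightarrow> s n (?\<pi> c) b = c b" if "c \<in> carrier ?F" for b c
    using RR.minus_eq_zero_iff[of "s n (?\<pi> c) b" "c b"] sc[OF \<pi>c[OF that]] free_moduleD(1)[OF that]
    by (simp add: \<theta>1_def Rsel)
  \<comment> \<open>Outside these finite sets the functionals vanish on all unit vectors from
    \<open>X\<close>, so finitely many equations remain.\<close>
  define U1 where "U1 = X \<union> (\<Union>t\<in>X. {b. s n t b \<noteq> \<zero>\<^bsub>R\<^esub>})"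
  define U2 where "U2 = (\<Union>t\<in>X. {b. s (n - 1) (d n t) b \<noteq> \<zero>\<^bsub>R\<^esub>})"
  have dc: "d n x \<in> carrier (P (n - 1))" if "x \<in> carrier (P n)" for x by (rule mod_homD(1)[OF d that])
  have fin: "finite U1" "finite U2"
    unfolding U1_def U2_def using X supp(1) dc by (auto simp: subset_iff)
  define \<Theta> where "\<Theta> = \<theta>1 ` {b \<in> U1. (n, b) \<notin> S} \<union> \<theta>2 ` {b \<in> U2. (n - 1, b) \<notin> S}"
  define I where "I = {c \<in> carrier (free_module R X). \<forall>\<theta>\<in>\<Theta>. \<theta> c = \<zero>\<^bsub>R\<^esub>}"
  have I: "fg_sub R ?F I"
    unfolding I_def
    by (rule left_coherent_functionals[OF coherent F fg_sub_free_module[OF ring X(2,1)]])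
      (use fin \<theta>1 \<theta>2 in \<open>auto simp: \<Theta>_def\<close>)
  have XF: "c \<in> carrier ?F" if "c \<in> carrier (free_module R X)" for c using free_module_mono[OF X(2)] that by auto
  have cX: "c b = \<zero>\<^bsub>R\<^esub>" if "c \<in> carrier (free_module R X)" "b \<notin> X" for c b
    using free_moduleD(2)[OF that(1)] that(2) by auto
  have v1: "\<theta>1 b c = \<zero>\<^bsub>R\<^esub>" if b: "b \<notin> U1" and c: "c \<in> carrier (free_module R X)" for b c
  proof -
    have "\<theta>1 b c \<in> {\<zero>\<^bsub>regular_module R\<^esub>}"
    proof (rule free_module_hom_in[OF regular mod_hom_free_mono[OF \<theta>1 X(2)] RR.submodule_zero _ c])
      fix t assume t: "t \<in> X"
      then have "s n (?\<pi> (unit_vec R t)) b = unit_vec R t b"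
        using b cover_unit[of t n] X(2) by (auto simp: U1_def unit_vec_def)
      then show "\<theta>1 b (unit_vec R t) \<in> {\<zero>\<^bsub>regular_module R\<^esub>}"
        using \<theta>1_iff[OF XF[OF unit_vec_closed[OF ring t]]] by (simp add: Rsel)
    qed
    then show ?thesis by (simp add: Rsel)
  qed
  have v2: "\<theta>2 b c = \<zero>\<^bsub>R\<^esub>" if b: "b \<notin> U2" and c: "c \<in> carrier (free_module R X)" for b c
  proof -
    have "\<theta>2 b c \<in> {\<zero>\<^bsub>regular_module R\<^esub>}"
    proof (rule free_module_hom_in[OF regular mod_hom_free_mono[OF \<theta>2 X(2)] RR.submodule_zero _ c])
      fix t assume t: "t \<in> X"
      then show "\<theta>2 b (unit_vec R t) \<in> {\<zero>\<^bsub>regular_module R\<^esub>}"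
        using b cover_unit[of t n] X(2) by (auto simp: U2_def \<theta>2_def Rsel)
    qed
    then show ?thesis by (simp add: Rsel)
  qed
  have I_iff: "c \<in> I \<longleftrightarrow> c \<in> carrier (free_module R X) \<and> (\<forall>b. (n, b) \<notin> S \<longrightarrow> s n (?\<pi> c) b = c b) \<and>
      (\<forall>b. (n - 1, b) \<notin> S \<longrightarrow> s (n - 1) (d n (?\<pi> c)) b = \<zero>\<^bsub>R\<^esub>)" (is "_ \<longleftrightarrow> ?r c") for c
  proof
    assume c: "c \<in> I"
    then have cc: "c \<in> carrier (free_module R X)" by (simp add: I_def)
    have 1: "\<theta>1 b c = \<zero>\<^bsub>R\<^esub>" if "(n, b) \<notin> S" for b
      using c v1[OF _ cc, of b] that by (cases "b \<in> U1") (auto simp: I_def \<Theta>_def)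
    have 2: "\<theta>2 b c = \<zero>\<^bsub>R\<^esub>" if "(n - 1, b) \<notin> S" for b
      using c v2[OF _ cc, of b] that by (cases "b \<in> U2") (auto simp: I_def \<Theta>_def)
    show "?r c" using cc 1 2 \<theta>1_iff[OF XF[OF cc]] by (simp add: \<theta>2_def)
  next
    assume "?r c"
    then show "c \<in> I" using \<theta>1_iff[OF XF, of c] by (auto simp: I_def \<Theta>_def \<theta>2_def)
  qed
  obtain k :: nat and \<chi> where \<chi>: "\<chi> \<in> mod_hom R (free_module R {..<k}) ?F" "\<chi> ` carrier (free_module R {..<k}) = I"
    using I unfolding fg_sub_iff_image[OF F] by (elim exE bexE)
  let ?K = "free_module R {..<k}"
  have K: "left_module R ?K" by (rule left_module_free_module[OF ring])
  have \<chi>I: "\<chi> a \<in> I" if "a \<in> carrier ?K" for a using \<chi>(2) that by auto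
  \<comment> \<open>The equations suffice: the differential of \<open>?\<pi> c\<close> is a cycle in
    \<open>W (n - 1) S\<close>, hence the image of some \<open>y\<close> in \<open>W n S\<close>.
    The difference of \<open>?\<pi> c\<close> and \<open>y\<close> is a cycle, and \<open>y\<close>
    has no coordinates outside \<open>S\<close>.\<close>
  have lift: "\<exists>x\<in>Z n \<inter> W n (S \<union> T). \<forall>b. (n, b) \<notin> S \<longrightarrow> s n x b = c b" if c: "c \<in> I" for c
  proof -
    have cc: "c \<in> carrier (free_module R X)" using c by (simp add: I_def)
    note \<pi>cc = \<pi>c[OF XF[OF cc]]
    have "d n (?\<pi> c) \<in> Z (n - 1) \<inter> W (n - 1) S"
      using d_Z[OF \<pi>cc] c[unfolded I_iff] dc[OF \<pi>cc] by (auto simp: W_def)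
    then have "\<exists>y\<in>W (n - 1 + 1) S. d (n - 1 + 1) y = d n (?\<pi> c)" using S unfolding closed_def by blast
    then obtain y where y: "y \<in> W n S" "d n y = d n (?\<pi> c)" by auto
    have yc: "y \<in> carrier (P n)" using y(1) by (simp add: W_def)
    interpret P1: left_module R "P (n - 1)" by (rule left_module)
    let ?x = "?\<pi> c \<ominus>\<^bsub>P n\<^esub> y"
    have xc: "?x \<in> carrier (P n)" using \<pi>cc yc by simp
    have "d n ?x = \<zero>\<^bsub>P (n - 1)\<^esub>"
      using mod_hom_diff[OF left_module left_module d \<pi>cc yc] y(2) P1.minus_eq_zero_iff[OF dc[OF \<pi>cc] dc[OF \<pi>cc]] by simp
    moreover have eq: "s n ?x b = c b" if "(n, b) \<notin> S" for b
    proof -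
      have "?\<pi> c = ?x \<oplus>\<^bsub>P n\<^esub> y" using \<pi>cc yc by (simp add: a_minus_def P.M.a_assoc P.M.l_neg)
      then have "s n (?\<pi> c) b = s n ?x b \<oplus>\<^bsub>R\<^esub> s n y b"
        using mod_homD(2)[OF coord_hom xc yc, of b] by (simp add: Rsel)
      then show ?thesis using c[unfolded I_iff] that W_coord[OF y(1) that] sc[OF xc] by simp
    qed
    moreover have "?x \<in> W n (S \<union> T)"
    proof -
      have "(n, b) \<in> S \<union> T" if "s n ?x b \<noteq> \<zero>\<^bsub>R\<^esub>" for b
        using eq[of b] cX[OF cc, of b] that by (cases "(n, b) \<in> S") (auto simp: X_def)
      then show ?thesis using xc by (simp add: W_def)
    qed
    ultimately show ?thesis using xc by (intro bexI[of _ ?x]) (auto simp: Z_iff)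
  qed
  have "\<forall>i\<in>{..<k}. \<exists>x. x \<in> Z n \<inter> W n (S \<union> T) \<and> (\<forall>b. (n, b) \<notin> S \<longrightarrow> s n x b = \<chi> (unit_vec R i) b)"
    using lift[OF \<chi>I[OF unit_vec_closed[OF ring]]] by blast
  then obtain t where t: "\<forall>i\<in>{..<k}. t i \<in> Z n \<inter> W n (S \<union> T) \<and> (\<forall>b. (n, b) \<notin> S \<longrightarrow> s n (t i) b = \<chi> (unit_vec R i) b)"
    by (rule bchoice[THEN exE])
  have ZW: "submodule (Z n \<inter> W n A) R (P n)" for A by (rule P.submodule_Int[OF submodule_Z submodule_W])
  have tc: "t i \<in> carrier (P n)" if "i \<in> {..<k}" for i using t that P.submoduleD(2)[OF ZW] by blast
  obtain \<psi> where \<psi>: "\<psi> \<in> mod_hom R ?K (P n)" "\<forall>i\<in>{..<k}. \<psi> (unit_vec R i) = t i"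
    using free_module_lift[OF left_module, of "{..<k}" t n] tc by auto
  note \<psi>c = mod_homD(1)[OF \<psi>(1)]
  have \<psi>ZW: "\<psi> a \<in> Z n \<inter> W n (S \<union> T)" if "a \<in> carrier ?K" for a
    by (rule free_module_hom_in[OF left_module \<psi>(1) ZW _ that]) (use \<psi>(2) t in auto)
  have s\<psi>: "s n (\<psi> a) b = \<chi> a b" if b: "(n, b) \<notin> S" and a: "a \<in> carrier ?K" for a b
    by (rule free_module_hom_eq[OF ring regular mod_hom_compose[OF \<psi>(1) coord_hom]
          mod_hom_compose[OF \<chi>(1) free_module_coord_hom] _ a]) (use \<psi>(2) t b in auto)
  have "Z n \<inter> W n (S \<union> T) = (Z n \<inter> W n S) <+>\<^bsub>P n\<^esub> \<psi> ` carrier ?K"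
  proof
    have "Z n \<inter> W n S \<subseteq> Z n \<inter> W n (S \<union> T)" using W_mono[of S "S \<union> T"] by auto
    then show "(Z n \<inter> W n S) <+>\<^bsub>P n\<^esub> \<psi> ` carrier ?K \<subseteq> Z n \<inter> W n (S \<union> T)"
      using \<psi>ZW P.submoduleD(4)[OF ZW[of "S \<union> T"]] unfolding mem_set_add subset_iff by blast
    show "Z n \<inter> W n (S \<union> T) \<subseteq> (Z n \<inter> W n S) <+>\<^bsub>P n\<^esub> \<psi> ` carrier ?K"
    proof
      fix x assume x: "x \<in> Z n \<inter> W n (S \<union> T)"
      then have xc: "x \<in> carrier (P n)" by (simp add: W_def)
      \<comment> \<open>The coordinates of \<open>x\<close> are split into the new part
        \<open>c\<close> on \<open>X\<close> and the rest \<open>e\<close>, which is supported in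
        \<open>S\<close>. Thus \<open>c\<close> satisfies the equations, as \<open>x\<close> is a
        cycle.\<close>
      define c where "c = (\<lambda>b. if b \<in> X then s n x b else \<zero>\<^bsub>R\<^esub>)"
      define e where "e = (\<lambda>b. if b \<in> X then \<zero>\<^bsub>R\<^esub> else s n x b)"
      have fe: "finite {b. e b \<noteq> \<zero>\<^bsub>R\<^esub>}"
        by (rule finite_subset[OF _ supp(1)[OF xc]]) (auto simp: e_def)
      have fc: "finite {b. c b \<noteq> \<zero>\<^bsub>R\<^esub>}"
        by (rule finite_subset[OF _ X(1)]) (auto simp: c_def)
      have cc: "c \<in> carrier (free_module R X)"
        using sc[OF xc] fc by (auto simp: free_module_def c_def)
      have ec: "e \<in> carrier ?F"
        using s_in[OF xc] fe by (auto simp: free_module_def e_def)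
      have sx: "s n x = c \<oplus>\<^bsub>?F\<^esub> e"
        using sc[OF xc] by (auto simp: free_module_sel c_def e_def)
      have eS: "(n, b) \<in> S" if "e b \<noteq> \<zero>\<^bsub>R\<^esub>" for b
        using x that by (auto simp: e_def W_def X_def split: if_splits)
      note eW = cover_W[OF S ec eS]
      have \<pi>cc: "?\<pi> c \<in> carrier (P n)" and \<pi>ec: "?\<pi> e \<in> carrier (P n)" using \<pi>c XF[OF cc] ec by auto
      have x_eq: "x = ?\<pi> c \<oplus>\<^bsub>P n\<^esub> ?\<pi> e"
        using cover_s[OF xc] mod_homD(2)[OF \<pi> XF[OF cc] ec] by (simp add: sx)
      have "c \<in> I"
        unfolding I_iff
      proof (intro conjI allI impI cc)
        fix b assume b: "(n, b) \<notin> S"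
        have "s n x b = s n (?\<pi> c) b \<oplus>\<^bsub>R\<^esub> s n (?\<pi> e) b"
          using mod_homD(2)[OF coord_hom \<pi>cc \<pi>ec, of b] x_eq by (simp add: Rsel)
        then have "s n x b = s n (?\<pi> c) b" using W_coord[OF eW(1) b] sc[OF \<pi>cc] by simp
        moreover have "s n x b = c b" using x b by (auto simp: c_def X_def W_def)
        ultimately show "s n (?\<pi> c) b = c b" by simp
      next
        fix b assume b: "(n - 1, b) \<notin> S"
        interpret P1: left_module R "P (n - 1)" by (rule left_module)
        have "d n x = d n (?\<pi> c) \<oplus>\<^bsub>P (n - 1)\<^esub> d n (?\<pi> e)" using mod_homD(2)[OF d \<pi>cc \<pi>ec] x_eq by simp
        then have "d n (?\<pi> c) \<oplus>\<^bsub>P (n - 1)\<^esub> d n (?\<pi> e) = \<zero>\<^bsub>P (n - 1)\<^esub>" using x by (simp add: Z_iff)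
        then have "d n (?\<pi> c) = \<ominus>\<^bsub>P (n - 1)\<^esub> d n (?\<pi> e)"
          using P1.M.minus_equality[OF _ dc[OF \<pi>ec] dc[OF \<pi>cc]] by simp
        then have "d n (?\<pi> c) \<in> W (n - 1) S" using P1.submoduleD(6)[OF submodule_W eW(2)] by simp
        then show "s (n - 1) (d n (?\<pi> c)) b = \<zero>\<^bsub>R\<^esub>" by (rule W_coord[OF _ b])
      qed
      then obtain a where a: "a \<in> carrier ?K" "\<chi> a = c" using \<chi>(2) by auto
      \<comment> \<open>\<open>x\<close> and \<psi> a are cycles with the same coordinates outside
        \<open>S\<close>, so they differ by a cycle in \<open>W n S\<close>.\<close>
      let ?w = "x \<ominus>\<^bsub>P n\<^esub> \<psi> a"
      have "?w \<in> Z n" using P.submoduleD(7)[OF submodule_Z[of n], of x "\<psi> a"] x \<psi>ZW[OF a(1)] by auto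
      moreover have "?w \<in> W n S"
      proof -
        have "s n ?w b = \<zero>\<^bsub>R\<^esub>" if b: "(n, b) \<notin> S" for b
        proof -
          have "s n ?w b = s n x b \<ominus>\<^bsub>regular_module R\<^esub> s n (\<psi> a) b"
            by (rule mod_hom_diff[OF left_module regular coord_hom xc \<psi>c[OF a(1)]])
          moreover have "s n x b = s n (\<psi> a) b"
            using x b s\<psi>[OF b a(1)] a(2) by (auto simp: c_def X_def W_def)
          ultimately show ?thesis
            using RR.minus_eq_zero_iff[of "s n (\<psi> a) b" "s n (\<psi> a) b"] sc[OF \<psi>c[OF a(1)]] by (simp add: Rsel)
        qed
        then show ?thesis using xc \<psi>c[OF a(1)] by (auto simp: W_def)
      qed
      moreover have "x = ?w \<oplus>\<^bsub>P n\<^esub> \<psi> a"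
        using xc \<psi>c[OF a(1)] by (simp add: a_minus_def P.M.a_assoc P.M.l_neg)
      ultimately show "x \<in> (Z n \<inter> W n S) <+>\<^bsub>P n\<^esub> \<psi> ` carrier ?K"
        by (intro set_addI[OF _ imageI[OF a(1)]] IntI)
    qed
  qed
  \<comment> \<open>Coherence is used a second time: the first use gave finitely many generators of
    the image \<open>I\<close>, this one finitely many relations among them, namely the kernel of
    \<chi> read off on the coordinates in \<open>X\<close>.\<close>
  moreover have "{a \<in> carrier ?K. \<psi> a \<in> Z n \<inter> W n S} = {a \<in> carrier ?K. \<forall>\<theta>\<in>(\<lambda>b a. \<chi> a b) ` X. \<theta> a = \<zero>\<^bsub>R\<^esub>}"
  proof -
    have "\<psi> a \<in> Z n \<inter> W n S \<longleftrightarrow> (\<forall>b\<in>X. \<chi> a b = \<zero>\<^bsub>R\<^esub>)" if a: "a \<in> carrier ?K" for a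
    proof
      assume "\<psi> a \<in> Z n \<inter> W n S"
      then show "\<forall>b\<in>X. \<chi> a b = \<zero>\<^bsub>R\<^esub>" using W_coord[of "\<psi> a"] s\<psi>[OF _ a] by (auto simp: X_def)
    next
      assume X0: "\<forall>b\<in>X. \<chi> a b = \<zero>\<^bsub>R\<^esub>"
      have "\<chi> a b = \<zero>\<^bsub>R\<^esub>" for b using X0 cX[of "\<chi> a" b] \<chi>I[OF a] by (auto simp: I_def)
      then have "s n (\<psi> a) b = \<zero>\<^bsub>R\<^esub>" if "(n, b) \<notin> S" for b using s\<psi>[OF that a] by simp
      then show "\<psi> a \<in> Z n \<inter> W n S" using \<psi>ZW[OF a] \<psi>c[OF a] by (auto simp: W_def)
    qed
    then show ?thesis by auto
  qed
  moreover have "fg_sub R ?K {a \<in> carrier ?K. \<forall>\<theta>\<in>(\<lambda>b a. \<chi> a b) ` X. \<theta> a = \<zero>\<^bsub>R\<^esub>}"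
    by (rule left_coherent_functionals[OF coherent K fg_sub_free_module[OF ring subset_refl]])
      (use X(1) mod_hom_compose[OF \<chi>(1) free_module_coord_hom] in auto)
  ultimately show ?thesis unfolding fp_over_def using \<psi>(1) by (intro exI[of _ k] bexI[of _ \<psi>]) auto
qed

text \<open>Modulo the cycles of \<open>W n S\<close>, which are boundaries from
  \<open>W (n + 1) S\<close>, the cycles of \<open>W n (S \<union> T)\<close> have finitely many
  generators. Each of these has a preimage in the full exact complex, and \<open>Y\<close> collects
  the preimages. Any larger \<open>S'\<close> is allowed so that supports of other elements can be
  added as well.\<close>

lemma finite_boundary_lift:
  assumes S: "closed S" and T: "finite T" "T \<subseteq> B"
  shows "\<exists>Y. finite Y \<and> Y \<subseteq> carrier (P (n + 1)) \<and>
    (\<forall>S'. S \<subseteq> S' \<longrightarrow> Y \<subseteq> W (n + 1) S' \<longrightarrow> (\<forall>x\<in>Z n \<inter> W n (S \<union> T). \<exists>y\<in>W (n + 1) S'. d (n + 1) y = x))"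
proof -
  obtain k :: nat and \<psi> where \<psi>: "\<psi> \<in> mod_hom R (free_module R {..<k}) (P n)"
    "Z n \<inter> W n (S \<union> T) = (Z n \<inter> W n S) <+>\<^bsub>P n\<^esub> \<psi> ` carrier (free_module R {..<k})"
    using fp_over_W[OF S T, of n] unfolding fp_over_def by (elim exE bexE conjE)
  let ?K = "free_module R {..<k}"
  interpret P: left_module R "P n" by (rule left_module)
  have ZW: "submodule (Z n \<inter> W n S) R (P n)" by (rule P.submodule_Int[OF submodule_Z submodule_W])
  have d1: "d (n + 1) \<in> mod_hom R (P (n + 1)) (P n)" using d[of "n + 1"] by simp
  have \<psi>Z: "\<psi> a \<in> Z n" if a: "a \<in> carrier ?K" for a
  proof -
    have "\<psi> a \<in> (Z n \<inter> W n S) <+>\<^bsub>P n\<^esub> \<psi> ` carrier ?K"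
      using P.submoduleD(3)[OF ZW] mod_homD(1)[OF \<psi>(1) a] a by (intro set_addI[of "\<zero>\<^bsub>P n\<^esub>" _ "\<psi> a"]) auto
    then show ?thesis using \<psi>(2) by auto
  qed
  have "\<forall>i\<in>{..<k}. \<exists>y. y \<in> carrier (P (n + 1)) \<and> d (n + 1) y = \<psi> (unit_vec R i)"
  proof
    fix i assume "i \<in> {..<k}"
    then have "\<psi> (unit_vec R i) \<in> d (n + 1) ` carrier (P (n + 1))"
      unfolding exact using \<psi>Z[OF unit_vec_closed[OF ring]] by (simp add: Z_def)
    then show "\<exists>y. y \<in> carrier (P (n + 1)) \<and> d (n + 1) y = \<psi> (unit_vec R i)" by auto
  qed
  then obtain t where t: "\<forall>i\<in>{..<k}. t i \<in> carrier (P (n + 1)) \<and> d (n + 1) (t i) = \<psi> (unit_vec R i)"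
    by (rule bchoice[THEN exE])
  obtain \<tau> where \<tau>: "\<tau> \<in> mod_hom R ?K (P (n + 1))" "\<forall>i\<in>{..<k}. \<tau> (unit_vec R i) = t i"
    using free_module_lift[OF left_module, of "{..<k}" t "n + 1"] t by auto
  have d\<tau>: "d (n + 1) (\<tau> a) = \<psi> a" if "a \<in> carrier ?K" for a
    by (rule free_module_hom_eq[OF ring left_module mod_hom_compose[OF \<tau>(1) d1] \<psi>(1) _ that])
      (use \<tau>(2) t in auto)
  show ?thesis
  proof (intro exI[of _ "t ` {..<k}"] conjI allI impI ballI)
    show "t ` {..<k} \<subseteq> carrier (P (n + 1))" using t by auto
  next
    fix S' x assume S': "S \<subseteq> S'" "t ` {..<k} \<subseteq> W (n + 1) S'" and x: "x \<in> Z n \<inter> W n (S \<union> T)"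
    then obtain w a where w: "w \<in> Z n \<inter> W n S" "a \<in> carrier ?K" "x = w \<oplus>\<^bsub>P n\<^esub> \<psi> a"
      unfolding \<psi>(2) by (auto simp: mem_set_add)
    obtain y where y: "y \<in> W (n + 1) S" "d (n + 1) y = w" using S w(1) unfolding closed_def by blast
    have "y \<in> W (n + 1) S'" using y(1) W_mono[OF S'(1)] by auto
    moreover have "\<tau> a \<in> W (n + 1) S'"
      by (rule free_module_hom_in[OF left_module \<tau>(1) submodule_W _ w(2)]) (use \<tau>(2) S'(2) in auto)
    ultimately have "y \<oplus>\<^bsub>P (n + 1)\<^esub> \<tau> a \<in> W (n + 1) S'"
      by (rule left_module.submoduleD(4)[OF left_module submodule_W])
    moreover have "d (n + 1) (y \<oplus>\<^bsub>P (n + 1)\<^esub> \<tau> a) = x"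
      using mod_homD(2)[OF d1, of y "\<tau> a"] y mod_homD(1)[OF \<tau>(1) w(2)] d\<tau>[OF w(2)] w(3) by (auto simp: W_def)
    ultimately show "\<exists>y\<in>W (n + 1) S'. d (n + 1) y = x" by auto
  qed simp
qed

section \<open>Enlarging closed sets and passing to unions\<close>

definition supports :: "int \<Rightarrow> 'm \<Rightarrow> (int \<times> 'm) set" where
  "supports n x = Pair n ` {b. s n x b \<noteq> \<zero>\<^bsub>R\<^esub>}"

lemma supports:
  assumes "x \<in> carrier (P n)"
  shows "finite (supports n x)" "supports n x \<subseteq> B" "supports n x \<subseteq> S \<Longrightarrow> x \<in> W n S"
  using supp[OF assms] assms by (auto simp: supports_def W_def)

text \<open>\<open>T'\<close> repairs all failures of closedness caused by \<open>T\<close>, but its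
  own new elements may fail again, so one step does not suffice.\<close>

lemma finite_closure_step:
  assumes S: "closed S" and T: "finite T" "T \<subseteq> B"
  shows "\<exists>T'. finite T' \<and> T' \<subseteq> B \<and> T \<subseteq> T' \<and> (\<forall>(n, b)\<in>T. b \<in> W n T' \<and> d n b \<in> W (n - 1) T') \<and>
    (\<forall>n. \<forall>x\<in>Z n \<inter> W n (S \<union> T). \<exists>y\<in>W (n + 1) (S \<union> T'). d (n + 1) y = x)"
proof -
  obtain Y where "\<forall>n. finite (Y n) \<and> Y n \<subseteq> carrier (P (n + 1)) \<and>
    (\<forall>S'. S \<subseteq> S' \<longrightarrow> Y n \<subseteq> W (n + 1) S' \<longrightarrow> (\<forall>x\<in>Z n \<inter> W n (S \<union> T). \<exists>y\<in>W (n + 1) S'. d (n + 1) y = x))"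
    using choice[OF allI[OF finite_boundary_lift[OF S T]]] by (rule exE)
  note Y0 = this[THEN spec]
  note Y = Y0[THEN conjunct1] Y0[THEN conjunct2, THEN conjunct1]
    Y0[THEN conjunct2, THEN conjunct2, rule_format]
  \<comment> \<open>Preimages \<open>Y n\<close> are added only for the finitely many degrees that
    occur in \<open>T\<close>, which keeps \<open>T'\<close> finite.\<close>
  define T' where "T' = T \<union> (\<Union>(n, b)\<in>T. supports n b \<union> supports (n - 1) (d n b) \<union> (\<Union>y\<in>Y n. supports (n + 1) y))"
  have Tc: "b \<in> carrier (P n)" "d n b \<in> carrier (P (n - 1))" if "(n, b) \<in> T" for n b
    using that T(2) mod_homD(1)[OF d] by (auto simp: B_def)
  have Yc: "y \<in> carrier (P (n + 1))" if "y \<in> Y n" for n y using Y(2) that by blast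
  show ?thesis
  proof (intro exI[of _ T'] conjI allI ballI)
    show "finite T'" unfolding T'_def using T(1) Tc Yc Y(1) by (auto simp: supports(1))
    show "T' \<subseteq> B" unfolding T'_def
    proof (intro Un_least T(2) UN_least)
      fix p assume p: "p \<in> T"
      obtain n b where nb: "p = (n, b)" by (cases p)
      have "supports n b \<subseteq> B" "supports (n - 1) (d n b) \<subseteq> B" "\<And>y. y \<in> Y n \<Longrightarrow> supports (n + 1) y \<subseteq> B"
        using Tc[of n b] p nb by (simp_all add: supports(2) Yc)
      then show "(case p of (n, b) \<Rightarrow> supports n b \<union> supports (n - 1) (d n b) \<union> (\<Union>y\<in>Y n. supports (n + 1) y)) \<subseteq> B"
        unfolding nb by (simp add: UN_subset_iff)
    qed
    show "T \<subseteq> T'" by (auto simp: T'_def)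
    fix p assume "p \<in> T"
    moreover obtain n b where "p = (n, b)" by (cases p)
    ultimately have p: "(n, b) \<in> T" "p = (n, b)" by auto
    have "supports n b \<subseteq> T'" "supports (n - 1) (d n b) \<subseteq> T'" using p by (auto simp: T'_def)
    then show "case p of (n, b) \<Rightarrow> b \<in> W n T' \<and> d n b \<in> W (n - 1) T'"
      using supports(3) Tc[OF p(1)] p(2) by simp
  next
    fix n x assume x: "x \<in> Z n \<inter> W n (S \<union> T)"
    show "\<exists>y\<in>W (n + 1) (S \<union> T'). d (n + 1) y = x"
    proof (cases "\<exists>b. (n, b) \<in> T")
      case True
      then obtain b where b: "(n, b) \<in> T" by blast
      have "y \<in> W (n + 1) (S \<union> T')" if y: "y \<in> Y n" for y
      proof (rule supports(3)[OF Yc[OF y]])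
        show "supports (n + 1) y \<subseteq> S \<union> T'" using b y by (force simp: T'_def)
      qed
      then show ?thesis by (intro Y(3)[OF _ _ x]) auto
    next
      case False
      \<comment> \<open>In a degree where \<open>T\<close> has no elements nothing has changed, and
        closedness of \<open>S\<close> provides the preimage.\<close>
      then have "x \<in> Z n \<inter> W n S" using x by (auto simp: W_def)
      then obtain y where y: "y \<in> W (n + 1) S" "d (n + 1) y = x" using S unfolding closed_def by blast
      then show ?thesis using W_mono[of S "S \<union> T'" "n + 1"] by blast
    qed
  qed
qed

text \<open>The coordinates of an element have finite support, which already lies in one member of
  the chain.\<close>

lemma W_Union_chain:
  assumes C: "C \<noteq> {}" "\<And>S T. S \<in> C \<Longrightarrow> T \<in> C \<Longrightarrow> S \<subseteq> T \<or> T \<subseteq> S" and x: "x \<in> W n (\<Union>C)"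
  shows "\<exists>S\<in>C. x \<in> W n S"
proof -
  have xc: "x \<in> carrier (P n)" using x by (simp add: W_def)
  have "supports n x \<subseteq> \<Union>C" using x by (auto simp: supports_def W_def)
  then obtain S where "S \<in> C" "supports n x \<subseteq> S"
    using finite_subset_Union_chain[OF supports(1)[OF xc] _ C(1), of UNIV] C(2)
    by (auto simp: subset_chain_def)
  then show ?thesis using supports(3)[OF xc] by auto
qed

lemma closed_Union_chain:
  assumes C: "C \<noteq> {}" "\<And>S. S \<in> C \<Longrightarrow> closed S" "\<And>S T. S \<in> C \<Longrightarrow> T \<in> C \<Longrightarrow> S \<subseteq> T \<or> T \<subseteq> S"
  shows "closed (\<Union>C)"
  unfolding closed_def
proof (intro conjI ballI allI)
  have cl: "S \<subseteq> B" "\<And>n b. (n, b) \<in> S \<Longrightarrow> b \<in> W n S \<and> d n b \<in> W (n - 1) S"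
    "\<And>n x. x \<in> Z n \<inter> W n S \<Longrightarrow> \<exists>y\<in>W (n + 1) S. d (n + 1) y = x" if "S \<in> C" for S
    using C(2)[OF that] unfolding closed_def by auto
  have mono: "W n S \<subseteq> W n (\<Union>C)" if "S \<in> C" for S n using that by (intro W_mono) auto
  show "\<Union>C \<subseteq> B" using cl(1) by auto
  show "case p of (n, b) \<Rightarrow> b \<in> W n (\<Union>C) \<and> d n b \<in> W (n - 1) (\<Union>C)" if p: "p \<in> \<Union>C" for p
  proof -
    obtain S where S: "S \<in> C" "p \<in> S" using p by auto
    obtain n b where nb: "p = (n, b)" by (cases p)
    have "b \<in> W n S" "d n b \<in> W (n - 1) S" using cl(2)[OF S(1)] S(2) nb by auto
    then show ?thesis using nb mono[OF S(1)] by auto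
  qed
  show "\<exists>y\<in>W (n + 1) (\<Union>C). d (n + 1) y = x" if x: "x \<in> Z n \<inter> W n (\<Union>C)" for n x
  proof -
    obtain S where S: "S \<in> C" "x \<in> W n S" using W_Union_chain[OF C(1,3)] x by blast
    then obtain y where "y \<in> W (n + 1) S" "d (n + 1) y = x" using cl(3)[OF S(1), of x n] x by auto
    then show ?thesis using mono[OF S(1)] by blast
  qed
qed

text \<open>A countable iteration catches up with itself: an element of the union involves finitely
  many indices, so it lives at some finite stage, and what it requires is present at the next
  one.\<close>

lemma omega_step:
  assumes S: "closed S" and b0: "b0 \<in> B"
  shows "\<exists>T :: nat \<Rightarrow> (int \<times> 'm) set. T 0 = {} \<and> mono T \<and> (\<forall>k. finite (T k) \<and> T k \<subseteq> B) \<and>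
    closed (S \<union> \<Union>(range T)) \<and> b0 \<in> \<Union>(range T)"
proof -
  define Q where "Q A A' \<longleftrightarrow> A \<subseteq> A' \<and> (\<forall>(n, b)\<in>A. b \<in> W n A' \<and> d n b \<in> W (n - 1) A') \<and>
    (\<forall>n. \<forall>x\<in>Z n \<inter> W n (S \<union> A). \<exists>y\<in>W (n + 1) (S \<union> A'). d (n + 1) y = x)" for A A'
  \<comment> \<open>\<open>T 0\<close> is kept empty so that the sequence of stages begins at the
    old closed set; \<open>b0\<close> is therefore fed into each step and arrives at stage
    1.\<close>
  have "\<exists>T. \<forall>k::nat. (finite (T k) \<and> T k \<subseteq> B \<and> (k = 0 \<longrightarrow> T k = {})) \<and> Q (insert b0 (T k)) (T (Suc k))"
  proof (rule dependent_nat_choice)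
    show "\<exists>A. finite A \<and> A \<subseteq> B \<and> ((0::nat) = 0 \<longrightarrow> A = {})" by auto
    fix A and k :: nat assume A: "finite A \<and> A \<subseteq> B \<and> (k = 0 \<longrightarrow> A = {})"
    then have "finite (insert b0 A)" "insert b0 A \<subseteq> B" using b0 by auto
    from finite_closure_step[OF S this]
    show "\<exists>A'. (finite A' \<and> A' \<subseteq> B \<and> (Suc k = 0 \<longrightarrow> A' = {})) \<and> Q (insert b0 A) A'"
      unfolding Q_def by (elim exE conjE) (intro exI conjI; simp)
  qed
  then obtain T :: "nat \<Rightarrow> (int \<times> 'm) set" where
    T: "\<And>k. finite (T k)" "\<And>k. T k \<subseteq> B" "T 0 = {}" "\<And>k. Q (insert b0 (T k)) (T (Suc k))" by auto
  have sub: "insert b0 (T k) \<subseteq> T (Suc k)" for k using T(4)[of k] by (simp add: Q_def)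
  then have mono: "mono T" by (intro mono_iff_le_Suc[THEN iffD2]) auto
  define U where "U = S \<union> \<Union>(range T)"
  have TU: "W n (T k) \<subseteq> W n U" "W n S \<subseteq> W n U" "W n (S \<union> T k) \<subseteq> W n U" for n k
    by (intro W_mono; auto simp: U_def)+
  have "closed U"
    unfolding closed_def
  proof (intro conjI ballI allI)
    show "U \<subseteq> B" using S T(2) by (auto simp: U_def closed_def)
    show "case p of (n, b) \<Rightarrow> b \<in> W n U \<and> d n b \<in> W (n - 1) U" if p: "p \<in> U" for p
    proof -
      obtain n b where nb: "p = (n, b)" by (cases p)
      consider "(n, b) \<in> S" | k where "(n, b) \<in> T k" using p nb by (auto simp: U_def)
      then have "b \<in> W n U \<and> d n b \<in> W (n - 1) U"
      proof cases
        case 1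
        then have "b \<in> W n S \<and> d n b \<in> W (n - 1) S" using S by (auto simp: closed_def)
        then show ?thesis using TU(2) by blast
      next
        case (2 k)
        then have "b \<in> W n (T (Suc k)) \<and> d n b \<in> W (n - 1) (T (Suc k))" using T(4)[of k] by (auto simp: Q_def)
        then show ?thesis using TU(1) by blast
      qed
      then show ?thesis using nb by simp
    qed
    show "\<exists>y\<in>W (n + 1) U. d (n + 1) y = x" if x: "x \<in> Z n \<inter> W n U" for n x
    proof -
      have "U = \<Union>(range (\<lambda>k. S \<union> T k))" by (auto simp: U_def)
      then have "x \<in> W n (\<Union>(range (\<lambda>k. S \<union> T k)))" using x by simp
      then have "\<exists>A\<in>range (\<lambda>k. S \<union> T k). x \<in> W n A"
      proof (rule W_Union_chain[rotated 2])
        fix A A' assume "A \<in> range (\<lambda>k. S \<union> T k)" "A' \<in> range (\<lambda>k. S \<union> T k)"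
        then obtain j k where jk: "A = S \<union> T j" "A' = S \<union> T k" by auto
        have "T j \<subseteq> T k \<or> T k \<subseteq> T j" using monoD[OF mono, of j k] monoD[OF mono, of k j] by linarith
        then show "A \<subseteq> A' \<or> A' \<subseteq> A" unfolding jk by auto
      qed simp
      then obtain k where k: "x \<in> W n (S \<union> T k)" by auto
      have "W n (S \<union> T k) \<subseteq> W n (S \<union> insert b0 (T k))" by (rule W_mono) auto
      then have "x \<in> Z n \<inter> W n (S \<union> insert b0 (T k))" using k x by auto
      then obtain y where "y \<in> W (n + 1) (S \<union> T (Suc k))" "d (n + 1) y = x"
        using T(4)[of k] unfolding Q_def by blast
      then show ?thesis using TU(3) by blast
    qed
  qed
  moreover have "b0 \<in> \<Union>(range T)" using sub by blast
  ultimately show ?thesis using T(1-3) mono unfolding U_def by blast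
qed

section \<open>The filtration of the cycles by Zorn's lemma\<close>

lemma W_empty: "W n {} = {\<zero>\<^bsub>P n\<^esub>}"
proof
  show "{\<zero>\<^bsub>P n\<^esub>} \<subseteq> W n {}" using left_module.submoduleD(3)[OF left_module submodule_W] by simp
  show "W n {} \<subseteq> {\<zero>\<^bsub>P n\<^esub>}"
  proof
    fix x assume x: "x \<in> W n {}"
    then have "s n x = \<zero>\<^bsub>free_cover R (P n)\<^esub>" by (auto simp: W_def free_cover_def free_module_sel)
    then have "cover_map R (P n) (s n x) = \<zero>\<^bsub>P n\<^esub>"
      using mod_hom_zero[OF left_module_free_cover[OF left_module] left_module cover_map_hom[OF left_module]] by simp
    then show "x \<in> {\<zero>\<^bsub>P n\<^esub>}" using cover_s[of x n] x by (simp add: W_def)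
  qed
qed

lemma closed_empty: "closed {}"
  unfolding closed_def W_empty
proof (intro conjI allI ballI)
  fix n x assume "x \<in> Z n \<inter> {\<zero>\<^bsub>P n\<^esub>}"
  moreover have "d (n + 1) \<zero>\<^bsub>P (n + 1)\<^esub> = \<zero>\<^bsub>P n\<^esub>"
    using mod_hom_zero[OF left_module left_module d, of "n + 1"] by simp
  ultimately show "\<exists>y\<in>{\<zero>\<^bsub>P (n + 1)\<^esub>}. d (n + 1) y = x" by simp
qed auto

lemma fp_chain_cycles: "\<exists>\<T>. fp_chain R (P n) \<T> (Z n)"
proof -
  interpret P: left_module R "P n" by (rule left_module)
  define D where "D S = Z n \<inter> W n S" for S
  have Dmono: "D S \<subseteq> D S'" if "S \<subseteq> S'" for S S' using W_mono[OF that] by (auto simp: D_def)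
  have subD: "submodule (D S) R (P n)" for S unfolding D_def by (rule P.submodule_Int[OF submodule_Z submodule_W])
  define \<A> where "\<A> = {(S, \<T>). closed S \<and> fp_chain R (P n) \<T> (D S)}"
  \<comment> \<open>The last conjunct demands an end extension: new members lie above the old top.
    It supplies the comparability assumption of \<open>fp_chain_Union\<close>.\<close>
  define le where "le p q \<longleftrightarrow> fst p \<subseteq> fst q \<and> snd p \<subseteq> snd q \<and> (\<forall>X\<in>snd q - snd p. D (fst p) \<subseteq> X)"
    for p q :: "(int \<times> 'm) set \<times> 'm set set"
  have A: "closed S" "fp_chain R (P n) \<T> (D S)" if "(S, \<T>) \<in> \<A>" for S \<T> using that by (auto simp: \<A>_def)
  have "\<exists>m\<in>\<A>. \<forall>a\<in>\<A>. le m a \<longrightarrow> a = m"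
  proof (rule predicate_Zorn)
    show "partial_order_on \<A> (relation_of le \<A>)"
    proof (rule partial_order_on_relation_ofI)
      show "le a a" for a by (auto simp: le_def)
      show "le a c" if "le a b" "le b c" for a b c
        using that Dmono[of "fst a" "fst b"] unfolding le_def by blast
      show "a = b" if "le a b" "le b a" for a b using that by (auto simp: le_def prod_eq_iff)
    qed
  next
    fix C assume C: "C \<in> Chains (relation_of le \<A>)"
    have CA: "C \<subseteq> \<A>" by (rule Chains_relation_of[OF C])
    have lin: "le p q \<or> le q p" if "p \<in> C" "q \<in> C" for p q
      using C that unfolding Chains_def relation_of_def by auto
    show "\<exists>u\<in>\<A>. \<forall>a\<in>C. le a u"
    proof (cases "C = {}")
      case True
      \<comment> \<open>An empty chain still needs an upper bound: the empty closed set with the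
        filtration consisting of zero alone.\<close>
      have "D {} = {\<zero>\<^bsub>P n\<^esub>}" using W_empty P.submoduleD(3)[OF submodule_Z] by (auto simp: D_def)
      then have "({}, {{\<zero>\<^bsub>P n\<^esub>}}) \<in> \<A>" using closed_empty fp_chain_trivial[OF left_module] by (simp add: \<A>_def)
      then show ?thesis using True by auto
    next
      case False
      let ?S = "\<Union>(fst ` C)"
      let ?C = "(\<lambda>p. (snd p, D (fst p))) ` C"
      have ch: "S \<subseteq> S' \<or> S' \<subseteq> S" if SS: "S \<in> fst ` C" "S' \<in> fst ` C" for S S'
      proof -
        obtain p q where "p \<in> C" "q \<in> C" "S = fst p" "S' = fst q" using SS by blast
        then show ?thesis using lin[of p q] by (auto simp: le_def)
      qed
      have clS: "closed ?S"
      proof (rule closed_Union_chain)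
        show "closed S" if S: "S \<in> fst ` C" for S
        proof -
          obtain p where "p \<in> C" "S = fst p" using S by blast
          then show ?thesis using CA A(1)[of "fst p" "snd p"] by auto
        qed
      qed (use False ch in auto)
      \<comment> \<open>The tops of the chains exhaust the cycles of the union of the closed sets,
        again by finiteness of supports.\<close>
      have DS: "\<Union>(snd ` ?C) = D ?S"
      proof
        show "\<Union>(snd ` ?C) \<subseteq> D ?S"
        proof
          fix x assume "x \<in> \<Union>(snd ` ?C)"
          then obtain p where "p \<in> C" "x \<in> D (fst p)" by force
          then show "x \<in> D ?S" using Dmono[of "fst p" ?S] by blast
        qed
        show "D ?S \<subseteq> \<Union>(snd ` ?C)"
        proof
          fix x assume x: "x \<in> D ?S"
          have "\<exists>S\<in>fst ` C. x \<in> W n S"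
            by (rule W_Union_chain[OF _ ch]) (use False x in \<open>auto simp: D_def\<close>)
          then show "x \<in> \<Union>(snd ` ?C)" using x by (force simp: D_def)
        qed
      qed
      let ?T = "insert (\<Union>(snd ` ?C)) (\<Union>(fst ` ?C))"
      have "fp_chain R (P n) ?T (\<Union>(snd ` ?C))"
      proof (rule fp_chain_Union[OF left_module])
        show "?C \<noteq> {}" using False by simp
        fix \<T> E assume "(\<T>, E) \<in> ?C"
        then obtain p where p: "p \<in> C" "\<T> = snd p" "E = D (fst p)" by auto
        show "fp_chain R (P n) \<T> E" unfolding p using A(2)[of "fst p" "snd p"] p(1) CA by auto
        fix \<T>' E' assume "(\<T>', E') \<in> ?C"
        then obtain q where q: "q \<in> C" "\<T>' = snd q" "E' = D (fst q)" by auto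
        show "\<T> \<subseteq> \<T>' \<and> E \<subseteq> E' \<and> (\<forall>X\<in>\<T>' - \<T>. E \<subseteq> X) \<or> \<T>' \<subseteq> \<T> \<and> E' \<subseteq> E \<and> (\<forall>X\<in>\<T> - \<T>'. E' \<subseteq> X)"
          using lin[OF p(1) q(1)] unfolding p(2,3) q(2,3) le_def using Dmono by meson
      qed
      then have u: "(?S, ?T) \<in> \<A>" unfolding DS using clS by (simp add: \<A>_def)
      have "le p (?S, ?T)" if p: "p \<in> C" for p
        unfolding le_def fst_conv snd_conv
      proof (intro conjI ballI)
        show S: "fst p \<subseteq> ?S" using p by auto
        show "snd p \<subseteq> ?T" using p by force
        fix X assume X: "X \<in> ?T - snd p"
        show "D (fst p) \<subseteq> X"
        proof (cases "X = \<Union>(snd ` ?C)")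
          case True
          then show ?thesis unfolding DS using Dmono[OF S] by simp
        next
          case False
          then have "X \<in> \<Union>(fst ` ?C)" using X by blast
          then obtain q where q: "q \<in> C" "X \<in> snd q" by force
          show ?thesis using lin[OF p q(1)] X q(2) unfolding le_def by blast
        qed
      qed
      then show ?thesis using u by blast
    qed
  qed
  then obtain S \<T> where ST: "(S, \<T>) \<in> \<A>" and max: "\<And>a. a \<in> \<A> \<Longrightarrow> le (S, \<T>) a \<Longrightarrow> a = (S, \<T>)" by auto
  note S = A(1)[OF ST] and \<T> = A(2)[OF ST]
  have "S = B"
  proof (rule ccontr)
    assume "S \<noteq> B"
    then obtain b0 where b0: "b0 \<in> B" "b0 \<notin> S" using S by (auto simp: closed_def)
    \<comment> \<open>The missing \<open>b0\<close> may sit in any degree; the closed set has to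
      exhaust \<open>B\<close> in all of them although only the cycles in degree \<open>n\<close>
      are filtered.\<close>
    obtain T :: "nat \<Rightarrow> (int \<times> 'm) set" where T: "T 0 = {}" "mono T" "\<forall>k. finite (T k) \<and> T k \<subseteq> B"
      "closed (S \<union> \<Union>(range T))" "b0 \<in> \<Union>(range T)"
      using omega_step[OF S b0(1)] by (elim exE conjE) (rule that)
    let ?S = "S \<union> \<Union>(range T)"
    have ST_eq: "?S = \<Union>(range (\<lambda>k. S \<union> T k))" by auto
    define E where "E k = D (S \<union> T k)" for k
    have lin: "S \<union> T j \<subseteq> S \<union> T k" if "j \<le> k" for j k using monoD[OF T(2) that] by auto
    have fp: "fp_over R (P n) (D S) (E k)" for k
      unfolding E_def D_def using T(3) by (intro fp_over_W[OF S]) auto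
    have "\<exists>\<T>'. \<T> \<subseteq> \<T>' \<and> fp_chain R (P n) \<T>' (\<Union>(range E)) \<and> (\<forall>X\<in>\<T>' - \<T>. D S \<subseteq> X)"
    proof (rule fp_chain_extend_omega[OF \<T> left_module _ _ _ fp])
      show "E 0 = D S" by (simp add: E_def T(1))
      show "mono E" unfolding E_def by (intro monoI Dmono lin)
      show "submodule (E k) R (P n)" for k unfolding E_def by (rule subD)
    qed
    then obtain \<T>' where \<T>': "\<T> \<subseteq> \<T>'" "fp_chain R (P n) \<T>' (\<Union>(range E))" "\<forall>X\<in>\<T>' - \<T>. D S \<subseteq> X" by blast
    have "\<Union>(range E) = D ?S"
    proof
      show "\<Union>(range E) \<subseteq> D ?S"
      proof
        fix x assume "x \<in> \<Union>(range E)"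
        then obtain k where "x \<in> D (S \<union> T k)" by (auto simp: E_def)
        then show "x \<in> D ?S" using Dmono[of "S \<union> T k" ?S] by blast
      qed
      show "D ?S \<subseteq> \<Union>(range E)"
      proof
        fix x assume x: "x \<in> D ?S"
        have "\<exists>A\<in>range (\<lambda>k. S \<union> T k). x \<in> W n A"
        proof (rule W_Union_chain)
          show "x \<in> W n (\<Union>(range (\<lambda>k. S \<union> T k)))" using x unfolding D_def ST_eq by simp
          fix A A' assume "A \<in> range (\<lambda>k. S \<union> T k)" "A' \<in> range (\<lambda>k. S \<union> T k)"
          then obtain j k where "A = S \<union> T j" "A' = S \<union> T k" by auto
          then show "A \<subseteq> A' \<or> A' \<subseteq> A" using lin[of j k] lin[of k j] nat_le_linear[of j k] by auto
        qed simp
        then show "x \<in> \<Union>(range E)" using x by (auto simp: E_def D_def)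
      qed
    qed
    then have mem: "(?S, \<T>') \<in> \<A>" using T(4) \<T>'(2) by (simp add: \<A>_def)
    have "le (S, \<T>) (?S, \<T>')" using \<T>'(1,3) by (simp add: le_def)
    \<comment> \<open>The contradiction lies in the first component: \<open>S\<close> has gained
      \<open>b0\<close>, even when the cycles in degree \<open>n\<close> have not grown.\<close>
    from max[OF mem this] show False using T(5) b0(2) by auto
  qed
  then have "D S = Z n" using W_B submodule_Z[THEN P.submoduleD(1)] by (auto simp: D_def)
  then show ?thesis using \<T> by auto
qed

end

text \<open>The identity of \<open>P n\<close> lifts through its canonical free cover; such a lift
  is the section \<open>s n\<close>.\<close>

lemma projective_complexI:
  assumes coh: "left_coherent R" and ex: "exact_complex R P d" and proj: "\<And>n. projective R (P n)"
  shows "\<exists>s. projective_complex R P d s"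
proof -
  have M: "left_module R (P n)" for n using ex by (simp add: exact_complex_def)
  have "\<forall>n. \<exists>f. f \<in> mod_hom R (P n) (free_cover R (P n)) \<and> (\<forall>x\<in>carrier (P n). cover_map R (P n) (f x) = x)"
  proof
    fix n
    show "\<exists>f. f \<in> mod_hom R (P n) (free_cover R (P n)) \<and> (\<forall>x\<in>carrier (P n). cover_map R (P n) (f x) = x)"
      using projective_lift[OF proj left_module_free_cover[OF M] M cover_map_hom[OF M] cover_map_surj[OF M] mod_hom_id]
      by auto
  qed
  then obtain s where "\<forall>n. s n \<in> mod_hom R (P n) (free_cover R (P n)) \<and> (\<forall>x\<in>carrier (P n). cover_map R (P n) (s n x) = x)"
    by (rule choice[THEN exE])
  then have "projective_complex R P d s"
    using coh ex by (intro projective_complex.intro) (simp_all add: exact_complex_def)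
  then show ?thesis by blast
qed

lemma fp_chain_cycle_module:
  assumes "left_coherent R" "exact_complex R P d" "\<And>n. projective R (P n)"
  shows "left_module R (cycle_module P d n)"
    and "\<exists>\<T>. fp_chain R (cycle_module P d n) \<T> (carrier (cycle_module P d n))"
proof -
  obtain s where "projective_complex R P d s" using projective_complexI[OF assms] by blast
  then interpret projective_complex R P d s .
  have eq: "cycle_module P d n = (P n)\<lparr>carrier := Z n\<rparr>" by (simp add: cycle_module_def Z_def)
  show "left_module R (cycle_module P d n)"
    unfolding eq by (rule left_module.left_module_submodule[OF left_module submodule_Z])
  show "\<exists>\<T>. fp_chain R (cycle_module P d n) \<T> (carrier (cycle_module P d n))"
    using fp_chain_cycles[of n] fp_chain_subcarrier[OF left_module] unfolding eq by auto
qed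

lemma mod_iso_retract:
  assumes M: "left_module R M" and N: "left_module R N" and e: "e \<in> mod_hom R M N"
    and bij: "bij_betw e (carrier M) (carrier N)"
  shows "retract R M N"
proof -
  interpret M: left_module R M by fact
  let ?f = "inv_into (carrier M) e"
  have im: "e ` carrier M = carrier N" and inj: "inj_on e (carrier M)" using bij by (auto simp: bij_betw_def)
  have f: "?f y \<in> carrier M" "e (?f y) = y" if "y \<in> carrier N" for y
    using that unfolding im[symmetric] by (rule inv_into_into, rule f_inv_into_f[where f = e])
  have fe: "?f (e x) = x" if "x \<in> carrier M" for x by (rule inv_into_f_f[OF inj that])
  have "?f \<in> mod_hom R N M"
  proof (rule mod_homI)
    show "?f y \<in> carrier M" if "y \<in> carrier N" for y by (rule f(1)[OF that])
    show "?f (y \<oplus>\<^bsub>N\<^esub> z) = ?f y \<oplus>\<^bsub>M\<^esub> ?f z" if "y \<in> carrier N" "z \<in> carrier N" for y z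
      using fe[of "?f y \<oplus>\<^bsub>M\<^esub> ?f z"] mod_homD(2)[OF e f(1)[OF that(1)] f(1)[OF that(2)]] f that by simp
    show "?f (a \<odot>\<^bsub>N\<^esub> y) = a \<odot>\<^bsub>M\<^esub> ?f y" if "a \<in> carrier R" "y \<in> carrier N" for a y
      using fe[of "a \<odot>\<^bsub>M\<^esub> ?f y"] mod_homD(3)[OF e that(1) f(1)[OF that(2)]] f that by simp
  qed
  then show ?thesis unfolding retract_def using e fe by blast
qed

text \<open>Unit vectors coincide over the zero ring, but then \<open>M\<close> has only one element.\<close>

lemma inj_on_singleton_unit_vec:
  assumes "left_module R M" "inj w"
  shows "inj_on (\<lambda>x. {unit_vec R (w x)}) (carrier M)"
proof (rule inj_onI)
  interpret M: left_module R M by fact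
  fix x y assume xy: "x \<in> carrier M" "y \<in> carrier M" "{unit_vec R (w x)} = {unit_vec R (w y)}"
  then have "unit_vec R (w x) (w x) = unit_vec R (w y) (w x)" by simp
  then have "w x = w y \<or> \<one>\<^bsub>R\<^esub> = \<zero>\<^bsub>R\<^esub>" by (auto simp: unit_vec_def split: if_splits)
  then show "x = y"
  proof
    assume "\<one>\<^bsub>R\<^esub> = \<zero>\<^bsub>R\<^esub>"
    then show ?thesis using M.smult_one M.smult_l_null xy(1,2) by metis
  qed (use assms(2) in \<open>auto dest: injD\<close>)
qed

theorem theorem3p6:
  fixes R :: "('r, 'x) ring_scheme"
    and P :: "int \<Rightarrow> ('r, 'm) module"
    and d :: "int \<Rightarrow> 'm \<Rightarrow> 'm"
  assumes "coherent R"
    and "exact_complex R P d"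
    and "\<And>n. projective R (P n)"
  shows "(\<forall>(n :: int) (A :: ('r, 'a) module).
            absolutely_pure R A \<longrightarrow> trivial_group (Ext1 R (cycle_module P d n) A)) \<and>
         (\<forall>n :: int. \<exists>M :: ('r, ('m, 'r) large) module.
            transfinite_extension R (finitely_presented R :: ('r, 'r coset_seq) module \<Rightarrow> bool) M \<and>
            retract R (cycle_module P d n) M)"
proof (intro conjI allI impI)
  have coh: "left_coherent R" using assms(1) by (simp add: coherent_def)
  fix n
  let ?Z = "cycle_module P d n"
  have Z: "left_module R ?Z" by (rule fp_chain_cycle_module(1)[OF coh assms(2,3)])
  obtain \<T> where T: "fp_chain R ?Z \<T> (carrier ?Z)"
    using fp_chain_cycle_module(2)[OF coh assms(2,3)] by blast
  show "trivial_group (Ext1 R ?Z A)" if "absolutely_pure R A" for A :: "('r, 'a) module"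
    by (rule trivial_Ext1_fp_chain[OF Z T that])
  \<comment> \<open>The cycle module itself is filtered; \<open>e\<close> merely copies it to the
    type required of \<open>M\<close>, sending \<open>x\<close> to a singleton that holds the unit
    vector of a one-letter word.\<close>
  define e :: "'m \<Rightarrow> ('m, 'r) large" where "e x = {unit_vec R [Inl x]}" for x
  have inj: "inj_on e (carrier ?Z)"
    unfolding e_def by (rule inj_on_singleton_unit_vec[OF Z]) (simp add: inj_def)
  let ?M = "transport_module e ?Z"
  have M: "left_module R ?M" and e: "e \<in> mod_hom R ?Z ?M"
    by (rule left_module_transport[OF Z inj], rule transport_hom[OF Z inj])
  have eZ: "e ` carrier ?Z = carrier ?M" by (simp add: transport_module_def Let_def)
  have "transfinite_extension R (finitely_presented R :: ('r, 'r coset_seq) module \<Rightarrow> bool) ?M"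
    using transfinite_extension_fp_chain[OF M] fp_chain_image[OF Z M e inj T] unfolding eZ by blast
  moreover have "retract R ?Z ?M"
    by (rule mod_iso_retract[OF Z M e]) (simp add: bij_betw_def inj eZ)
  ultimately show "\<exists>M :: ('r, ('m, 'r) large) module.
      transfinite_extension R (finitely_presented R :: ('r, 'r coset_seq) module \<Rightarrow> bool) M \<and> retract R ?Z M"
    by blast
qed

end
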